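(* Let $\mathbf{x}\in\mathbb{R}^p$ be fixed, let $q:\mathbb{R}\to\mathbb{R}$ be measurable and let $\gamma\ge0$. Suppose that: (a) the kernel $k$ is a symmetric, twice continuously differentiable density with compact support $[-1,1]$; (b) the bandwidth satisfies $nb_n^4\to 0$ and $nb_n^{d_*}\to\infty$ with $d_*=(50+20d)/(14+5d)$; (c) $\tau\mapsto r_\tau(\mathbf{z})$ is continuously differentiable for all $\mathbf{z}$ with gradient $\tau\mapsto\dot r_\tau(\mathbf{z})$; for each constant $C$, $\sup_{|\tau-\vartheta|\le Cn^{-1/2}}\sum_{i=1}^n\big(r_\tau(\mathbf{X}_{i-1})-r_\vartheta(\mathbf{X}_{i-1})-\dot r_\vartheta(\mathbf{X}_{i-1})^\top(\tau-\vartheta)\big)^2=O_p(n^{-2/3})$; $E[|\dot r_\vartheta(\mathbf{X})|^{5/2}]<\infty$; and $E[\dot r_\vartheta(\mathbf{X})\dot r_\vartheta(\mathbf{X})^\top]$ is positive definite; (d) $|q(y)|\le(1+|y|)^\gamma$ for all $y\in\mathbb{R}$, and for some constant $L$, $|q(y+s_1)-q(y+s_2)|\le L|s_1-s_2|(1+|y|)^\gamma$ for all $y\in\mathbb{R}$ and all $s_1,s_2$ in a neighborhood of $r_\vartheta(\mathbf{x})$; (e) $f$ has finite Fisher information for location and a finite absolute moment of order greater than $2\gamma+1$. Then $$\int q(y+r_{\tilde\vartheta}(\mathbf{x}))\tilde f(y)\,dy=\frac1n\sum_{i=1}^nq(\varepsilon_i+r_\vartheta(\mathbf{x}))+D_q^\top(\tilde\vartheta-\vartheta)+o_p(n^{-1/2}),$$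 $$\int q(y+r_{\tilde\vartheta}(\mathbf{x}))\tilde f_w(y)\,dy=\frac1n\sum_{i=1}^n\big(q(\varepsilon_i+r_\vartheta(\mathbf{x}))-c_q\varepsilon_i\big)+\bar D_q^\top(\tilde\vartheta-\vartheta)+o_p(n^{-1/2}),$$ where $D_q=E[q(\varepsilon+r_\vartheta(\mathbf{x}))\ell(\varepsilon)]\,(\dot r_\vartheta(\mathbf{x})-E[\dot r_\vartheta(\mathbf{X})])$, $c_q=\sigma^{-2}E[\varepsilon q(\varepsilon+r_\vartheta(\mathbf{x}))]$ and $\bar D_q=D_q+c_qE[\dot r_\vartheta(\mathbf{X})]$.
   Context: Model: $X_{1-p},\dots,X_n$ are observations from a stationary and ergodic real-valued process with $X_i=r_\vartheta(\mathbf{X}_{i-1})+\varepsilon_i$, $\mathbf{X}_{i-1}=(X_{i-p},\dots,X_{i-1})$, where $r_\tau:\mathbb{R}^p\to\mathbb{R}$ is a family of functions indexed by a $d$-dimensional parameter $\tau$ and $\vartheta$ is the true parameter. The innovations $\varepsilon_i$ are i.i.d. with mean zero, finite variance $\sigma^2$ and positive density $f$ and are independent of $\mathbf{X}_0$. $(\mathbf{X},\varepsilon)$ has the joint distribution of $(\mathbf{X}_{i-1},\varepsilon_i)$. Finite Fisher information for location means: $f$ is absolutely continuous with almost everywhere derivative $f'$ and $\int\ell^2(y)f(y)\,dy<\infty$, where $\ell=-f'/f$. Estimators: $\tilde\vartheta$ is a $n^{1/2}$-consistent estimator of $\vartheta$ (i.e. $\tilde\vartheta-\vartheta=O_p(n^{-1/2})$).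 Residuals: $\tilde\varepsilon_i=X_i-r_{\tilde\vartheta}(\mathbf{X}_{i-1})$. With $k_{b_n}(y)=k(y/b_n)/b_n$, set $\tilde f(y)=\frac1n\sum_{i=1}^nk_{b_n}(y-\tilde\varepsilon_i)$ and $\tilde f_w(y)=\frac1n\sum_{i=1}^nw_ik_{b_n}(y-\tilde\varepsilon_i)$. The weights are $w_i=1/(1+\tilde\lambda\tilde\varepsilon_i)$, with $\tilde\lambda$ chosen so that the $w_i$ are positive and $\sum_{i=1}^nw_i\tilde\varepsilon_i=0$; when there is no such $\tilde\lambda$, set $\tilde\lambda=0$. *)

theory Defs
  imports "HOL-Probability.Probability"
begin

subsection \<open>Stochastic order symbols\<close>

text \<open>Stated with outer probability, so that no measurability of \<open>Z n\<close> has to be presupposed;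
  for measurable \<open>Z n\<close> these are the usual \<open>O_p\<close> and \<open>o_p\<close>.\<close>

definition bigO_prob ::
  "'w measure \<Rightarrow> (nat \<Rightarrow> 'w \<Rightarrow> 'b::real_normed_vector) \<Rightarrow> (nat \<Rightarrow> real) \<Rightarrow> bool" where
  "bigO_prob M Z a \<longleftrightarrow>
     (\<forall>\<eta>>0. \<exists>K. \<forall>\<^sub>F n in sequentially.
        outer_measure_of M {\<omega>\<in>space M. norm (Z n \<omega>) > K * a n} \<le> ennreal \<eta>)"

definition smallo_prob ::
  "'w measure \<Rightarrow> (nat \<Rightarrow> 'w \<Rightarrow> 'b::real_normed_vector) \<Rightarrow> (nat \<Rightarrow> real) \<Rightarrow> bool" where
  "smallo_prob M Z a \<longleftrightarrow>
     (\<forall>\<eta>>0. (\<lambda>n. outer_measure_of M {\<omega>\<in>space M. norm (Z n \<omega>) > \<eta> * a n}) \<longlonglongrightarrow> 0)"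


subsection \<open>Stationary ergodic processes\<close>

definition stationary_process :: "'w measure \<Rightarrow> (nat \<Rightarrow> 'w \<Rightarrow> real) \<Rightarrow> bool" where
  "stationary_process M Y \<longleftrightarrow>
     (\<forall>i. Y i \<in> borel_measurable M) \<and>
     distr M (Pi\<^sub>M UNIV (\<lambda>_. borel)) (\<lambda>\<omega> i. Y (Suc i) \<omega>) =
     distr M (Pi\<^sub>M UNIV (\<lambda>_. borel)) (\<lambda>\<omega> i. Y i \<omega>)"

definition ergodic_process :: "'w measure \<Rightarrow> (nat \<Rightarrow> 'w \<Rightarrow> real) \<Rightarrow> bool" where
  "ergodic_process M Y \<longleftrightarrow>
     (\<forall>A \<in> sets (Pi\<^sub>M (UNIV :: nat set) (\<lambda>_. borel :: real measure)).
        {y. (\<lambda>i. y (Suc i)) \<in> A} = A \<longrightarrow>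
        measure M {\<omega>\<in>space M. (\<lambda>i. Y i \<omega>) \<in> A} \<in> {0, 1})"


subsection \<open>The nonlinear autoregressive model\<close>

text \<open>The vector \<open>(X\<^bsub>i-p+1\<^esub>, \<dots>, X\<^bsub>i\<^esub>)\<close> in \<open>\<real>\<^sup>p\<close>, where \<open>p = CARD('p)\<close> and the coordinates are
  listed in the linear order of the index type \<open>'p\<close>.\<close>

definition lag_vec :: "(int \<Rightarrow> 'w \<Rightarrow> real) \<Rightarrow> int \<Rightarrow> 'w \<Rightarrow> real ^ ('p :: {finite, linorder})" where
  "lag_vec X i \<omega> = (\<chi> j. X (i - int CARD('p) + 1 + int (card {l. l < j})) \<omega>)"

text \<open>The process is \<open>(X\<^bsub>i\<^esub>)\<close> with \<open>i \<ge> 1 - p\<close>, and the innovations are \<open>(\<epsilon>\<^bsub>i\<^esub>)\<close> with \<open>i \<ge> 1\<close>; values at other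
  indices are irrelevant.\<close>

definition ar_model ::
  "'w measure \<Rightarrow> (int \<Rightarrow> 'w \<Rightarrow> real) \<Rightarrow> (int \<Rightarrow> 'w \<Rightarrow> real)
     \<Rightarrow> (real ^ ('p :: {finite, linorder}) \<Rightarrow> real) \<Rightarrow> (real \<Rightarrow> real) \<Rightarrow> real \<Rightarrow> bool" where
  "ar_model M X eps \<rho> f \<sigma> \<longleftrightarrow>
     prob_space M \<and>
     stationary_process M (\<lambda>j. X (1 - int CARD('p) + int j)) \<and>
     ergodic_process M (\<lambda>j. X (1 - int CARD('p) + int j)) \<and>
     (\<forall>i\<ge>1. AE \<omega> in M. X i \<omega> = \<rho> (lag_vec X (i - 1) \<omega>) + eps i \<omega>) \<and>
     prob_space.indep_vars M (\<lambda>_. borel) eps {1..} \<and>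
     prob_space.indep_var M
       (Pi\<^sub>M {1 - int CARD('p)..0} (\<lambda>_. borel)) (\<lambda>\<omega>. \<lambda>i\<in>{1 - int CARD('p)..0}. X i \<omega>)
       (Pi\<^sub>M {1..} (\<lambda>_. borel)) (\<lambda>\<omega>. \<lambda>i\<in>{1..}. eps i \<omega>) \<and>
     (\<forall>y. f y > 0) \<and>
     (\<forall>i\<ge>1. distributed M lborel (eps i) (\<lambda>y. ennreal (f y))) \<and>
     (\<forall>i\<ge>1. integrable M (eps i) \<and> integral\<^sup>L M (eps i) = 0) \<and>
     (\<forall>i\<ge>1. integrable M (\<lambda>\<omega>. (eps i \<omega>)\<^sup>2) \<and> integral\<^sup>L M (\<lambda>\<omega>. (eps i \<omega>)\<^sup>2) = \<sigma>\<^sup>2)"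


subsection \<open>Finite Fisher information for location\<close>

definition abs_continuous_on :: "real set \<Rightarrow> (real \<Rightarrow> real) \<Rightarrow> bool" where
  "abs_continuous_on S f \<longleftrightarrow>
     (\<forall>\<epsilon>>0. \<exists>\<delta>>0. \<forall>D.
        finite D \<and> (\<forall>(u, v)\<in>D. u \<le> v \<and> {u..v} \<subseteq> S) \<and>
        pairwise (\<lambda>(u, v) (u', v'). {u<..<v} \<inter> {u'<..<v'} = {}) D \<and>
        (\<Sum>(u, v)\<in>D. v - u) < \<delta> \<longrightarrow>
        (\<Sum>(u, v)\<in>D. \<bar>f v - f u\<bar>) < \<epsilon>)"

definition score :: "(real \<Rightarrow> real) \<Rightarrow> (real \<Rightarrow> real) \<Rightarrow> real \<Rightarrow> real" where
  "score f f' y = - f' y / f y"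

text \<open>\<open>f'\<close> is any Borel version of the almost everywhere derivative of \<open>f\<close>. Absolute continuity is
  required on compact intervals; on the whole line it then follows, as \<open>f'\<close> is integrable.\<close>

definition finite_fisher_information :: "(real \<Rightarrow> real) \<Rightarrow> (real \<Rightarrow> real) \<Rightarrow> bool" where
  "finite_fisher_information f f' \<longleftrightarrow>
     (\<forall>a b. abs_continuous_on {a..b} f) \<and>
     f' \<in> borel_measurable borel \<and>
     (AE y in lborel. (f has_real_derivative f' y) (at y)) \<and>
     integrable lborel (\<lambda>y. (score f f' y)\<^sup>2 * f y)"


subsection \<open>Kernels, matrices\<close>

definition C2_kernel :: "(real \<Rightarrow> real) \<Rightarrow> bool" where
  "C2_kernel k \<longleftrightarrow>
     (\<forall>u. k u \<ge> 0) \<and> integrable lborel k \<and> integral\<^sup>L lborel k = 1 \<and>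
     (\<forall>u. k (- u) = k u) \<and>
     (\<exists>k' k''. (\<forall>u. (k has_real_derivative k' u) (at u)) \<and>
        (\<forall>u. (k' has_real_derivative k'' u) (at u)) \<and> continuous_on UNIV k'') \<and>
     closure {u. k u \<noteq> 0} = {-1..1}"

definition outer_prod :: "real ^ 'd \<Rightarrow> real ^ 'd ^ 'd" where
  "outer_prod v = (\<chi> i j. v $ i * v $ j)"

definition positive_definite :: "real ^ 'd ^ 'd \<Rightarrow> bool" where
  "positive_definite A \<longleftrightarrow> transpose A = A \<and> (\<forall>v. v \<noteq> 0 \<longrightarrow> v \<bullet> (A *v v) > 0)"


subsection \<open>Estimators\<close>

text \<open>\<open>est n\<close> is a statistic of the observations \<open>X\<^bsub>1-p\<^esub>, \<dots>, X\<^bsub>n\<^esub>\<close> with values in \<open>\<Theta>\<close>.\<close>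

definition is_estimator ::
  "'w measure \<Rightarrow> nat \<Rightarrow> (int \<Rightarrow> 'w \<Rightarrow> real) \<Rightarrow> (real ^ 'd) set \<Rightarrow> (nat \<Rightarrow> 'w \<Rightarrow> real ^ 'd) \<Rightarrow> bool" where
  "is_estimator M p X \<Theta> est \<longleftrightarrow>
     (\<forall>n. \<exists>T \<in> borel_measurable (Pi\<^sub>M {1 - int p..int n} (\<lambda>_. borel)).
        \<forall>\<omega>\<in>space M. est n \<omega> = T (\<lambda>i\<in>{1 - int p..int n}. X i \<omega>) \<and> est n \<omega> \<in> \<Theta>)"

definition residual ::
  "('t \<Rightarrow> real ^ ('p :: {finite, linorder}) \<Rightarrow> real) \<Rightarrow> (int \<Rightarrow> 'w \<Rightarrow> real) \<Rightarrow> (nat \<Rightarrow> 'w \<Rightarrow> 't)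
     \<Rightarrow> nat \<Rightarrow> 'w \<Rightarrow> int \<Rightarrow> real" where
  "residual r X est n \<omega> i = X i \<omega> - r (est n \<omega>) (lag_vec X (i - 1) \<omega>)"

definition admissible_multiplier :: "nat \<Rightarrow> (int \<Rightarrow> real) \<Rightarrow> real \<Rightarrow> bool" where
  "admissible_multiplier n e l \<longleftrightarrow>
     (\<forall>i\<in>{1..int n}. 1 / (1 + l * e i) > 0) \<and> (\<Sum>i=1..int n. (1 / (1 + l * e i)) * e i) = 0"

text \<open>The multiplier need not be unique when all residuals vanish, but then all weights are \<open>1\<close> anyway.\<close>

definition is_multiplier :: "nat \<Rightarrow> (int \<Rightarrow> real) \<Rightarrow> real \<Rightarrow> bool" where
  "is_multiplier n e l \<longleftrightarrow>
     (if \<exists>l'. admissible_multiplier n e l' then admissible_multiplier n e l else l = 0)"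

definition scaled_kernel :: "(real \<Rightarrow> real) \<Rightarrow> real \<Rightarrow> real \<Rightarrow> real" where
  "scaled_kernel k b y = k (y / b) / b"

definition density_est :: "(real \<Rightarrow> real) \<Rightarrow> real \<Rightarrow> nat \<Rightarrow> (int \<Rightarrow> real) \<Rightarrow> real \<Rightarrow> real" where
  "density_est k b n e y = (1 / real n) * (\<Sum>i=1..int n. scaled_kernel k b (y - e i))"

definition weighted_density_est ::
  "(real \<Rightarrow> real) \<Rightarrow> real \<Rightarrow> nat \<Rightarrow> (int \<Rightarrow> real) \<Rightarrow> real \<Rightarrow> real \<Rightarrow> real" where
  "weighted_density_est k b n e l y =
     (1 / real n) * (\<Sum>i=1..int n. (1 / (1 + l * e i)) * scaled_kernel k b (y - e i))"

end

theory Submission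
  imports Defs
begin

text \<open>
  Write \<open>g y = q (y + r \<theta> x)\<close>, \<open>\<Delta> = est n \<omega> - \<theta>\<close> and \<open>V\<^sub>i = rdot \<theta> x - rdot \<theta> X\<^bsub>i-1\<^esub>\<close>, where \<open>X\<^bsub>i-1\<^esub>\<close> is the
  vector of lagged observations. The Lipschitz condition on \<open>q\<close> says that \<open>g\<close> is Lipschitz near every
  point \<open>y\<close>, on an interval whose length does not depend on \<open>y\<close> and with a constant of order
  \<open>w y = (1 + |y|) powr \<gamma>\<close>. Hence \<open>g\<close> of a perturbed innovation can be controlled pathwise, and the smoothness
  of the density has to be used only once, for expectations.

  Substituting \<open>y = residual + b u\<close> turns both integrals into (weighted) sample means of
  \<open>g\<^sub>b (\<epsilon>\<^sub>i + h\<^sub>i)\<close>, where \<open>g\<^sub>b\<close> averages \<open>g (y + b u)\<close> over \<open>u\<close> with density \<open>k\<close>. The shift \<open>h\<^sub>i\<close> equals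
  \<open>V\<^sub>i \<bullet> \<Delta>\<close> up to errors whose sum of squares vanishes in probability; by the Lipschitz property and
  the Cauchy-Schwarz inequality these errors change the sample mean by \<open>o\<^sub>p(n\<^bsup>-1/2\<^esup>)\<close> only.

  For a fixed vector \<open>t\<close> the variables \<open>g\<^sub>b (\<epsilon>\<^sub>i + V\<^sub>i \<bullet> t / \<surd>n) - g \<epsilon>\<^sub>i\<close>, centred at their conditional means
  given the past, are martingale differences with second moments \<open>O(1/n + b\<^sup>2)\<close>, so that
  \<open>n\<^bsup>-1/2\<^esup>\<close> times their sum vanishes (\<open>fluctuation_mean_tendsto\<close>). Finite Fisher information
  gives the conditional means: \<open>h \<mapsto> E[g (\<epsilon> + h)]\<close> has a Lipschitz derivative, with value
  \<open>a = E[g \<epsilon> \<cdot> \<ell> \<epsilon>]\<close> at \<open>0\<close> (\<open>shift_mean_expansion\<close>), so the conditional means are \<open>a (V\<^sub>i \<bullet> t) / \<surd>n + O(1/n + b\<^sup>2)\<close>; the symmetry of \<open>k\<close>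
  removes the term linear in \<open>b\<close>, and \<open>n b\<^sup>4 \<rightarrow> 0\<close> makes the square harmless. Birkhoff's theorem
  (\<open>birkhoff\<close>) replaces the average of the \<open>V\<^sub>i\<close> by their mean. All terms are
  Lipschitz in \<open>t\<close> with constants bounded in probability, hence the approximation is uniform on balls
  (\<open>linearisation_error_uniform\<close>) and the random \<open>t = \<surd>n \<Delta>\<close> may be inserted
  (\<open>unweighted_expansion\<close>).

  For the weighted estimator, let \<open>\<lambda>\<close> be the multiplier. The largest residual is \<open>o\<^sub>p(\<surd>n)\<close> and the mean
  residual is \<open>O\<^sub>p(n\<^bsup>-1/2\<^esup>)\<close>, so Owen's argument for empirical likelihood shows that the multiplier exists
  with probability tending to one and equals the mean residual divided by \<open>\<sigma>\<^sup>2\<close>, up to \<open>o\<^sub>p(n\<^bsup>-1/2\<^esup>)\<close>.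
  Expanding \<open>1 / (1 + \<lambda> \<cdot> residual)\<close> to first order, the weights subtract \<open>\<lambda> E[\<epsilon> \<cdot> g \<epsilon>]\<close> from the
  unweighted mean (\<open>weighted_expansion\<close>), and the mean residual is, to the same order, the mean
  innovation minus \<open>E[rdot \<theta> X\<^sub>0] \<bullet> \<Delta>\<close>.
\<close>

section \<open>Convergence in probability as convergence along a filter\<close>

lemma outer_measure_of_Un_le:
  assumes "A \<subseteq> space M" "B \<subseteq> space M"
  shows "outer_measure_of M (A \<union> B) \<le> outer_measure_of M A + outer_measure_of M B"
proof -
  obtain E where E: "E \<in> sets M" "A \<subseteq> E" "outer_measure_of M A = emeasure M E"
    using outer_measure_of_attain[OF assms(1)] by blast
  obtain G where G: "G \<in> sets M" "B \<subseteq> G" "outer_measure_of M B = emeasure M G"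
    using outer_measure_of_attain[OF assms(2)] by blast
  have "outer_measure_of M (A \<union> B) \<le> outer_measure_of M (E \<union> G)"
    using E(2) G(2) by (intro outer_measure_of_mono) auto
  also have "\<dots> = emeasure M (E \<union> G)"
    using E(1) G(1) by simp
  also have "\<dots> \<le> emeasure M E + emeasure M G"
    using E(1) G(1) by (rule emeasure_subadditive)
  finally show ?thesis using E(3) G(3) by simp
qed

text \<open>A property of \<open>(n, \<omega>)\<close> holds eventually along this filter iff its probability tends to one. Convergence
  in probability thus becomes ordinary convergence along a filter, so the whole calculus of limits
  applies. Outer measure appears because the events in question may fail to be measurable.\<close>

definition in_prob :: "'w measure \<Rightarrow> (nat \<times> 'w) filter" where
  "in_prob M = Abs_filter (\<lambda>P. (\<lambda>n. outer_measure_of M {\<omega>\<in>space M. \<not> P (n, \<omega>)}) \<longlonglongrightarrow> 0)"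

lemma eventually_in_prob:
  "eventually P (in_prob M) \<longleftrightarrow>
     (\<lambda>n. outer_measure_of M {\<omega>\<in>space M. \<not> P (n, \<omega>)}) \<longlonglongrightarrow> 0"
  unfolding in_prob_def
proof (rule eventually_Abs_filter, rule is_filter.intro)
  show "(\<lambda>n. outer_measure_of M {\<omega>\<in>space M. \<not> True}) \<longlonglongrightarrow> 0"
    by simp
next
  fix P Q :: "nat \<times> 'a \<Rightarrow> bool"
  let ?N = "\<lambda>P n. {\<omega>\<in>space M. \<not> P (n, \<omega>)}"
  assume P: "(\<lambda>n. outer_measure_of M (?N P n)) \<longlonglongrightarrow> 0"
    and Q: "(\<lambda>n. outer_measure_of M (?N Q n)) \<longlonglongrightarrow> 0"
  have sum: "(\<lambda>n. outer_measure_of M (?N P n) + outer_measure_of M (?N Q n)) \<longlonglongrightarrow> 0"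
    using tendsto_add[OF P Q] by simp
  have "outer_measure_of M (?N (\<lambda>x. P x \<and> Q x) n)
      \<le> outer_measure_of M (?N P n) + outer_measure_of M (?N Q n)" for n
  proof -
    have "?N (\<lambda>x. P x \<and> Q x) n = ?N P n \<union> ?N Q n" by auto
    then show ?thesis by (simp only:) (rule outer_measure_of_Un_le; auto)
  qed
  then show "(\<lambda>n. outer_measure_of M (?N (\<lambda>x. P x \<and> Q x) n)) \<longlonglongrightarrow> 0"
    by (intro tendsto_sandwich[OF _ _ tendsto_const sum]) auto
next
  fix P Q :: "nat \<times> 'a \<Rightarrow> bool"
  let ?N = "\<lambda>P n. {\<omega>\<in>space M. \<not> P (n, \<omega>)}"
  assume PQ: "\<forall>x. P x \<longrightarrow> Q x" and P: "(\<lambda>n. outer_measure_of M (?N P n)) \<longlonglongrightarrow> 0"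
  have "outer_measure_of M (?N Q n) \<le> outer_measure_of M (?N P n)" for n
    using PQ by (intro outer_measure_of_mono) auto
  then show "(\<lambda>n. outer_measure_of M (?N Q n)) \<longlonglongrightarrow> 0"
    by (intro tendsto_sandwich[OF _ _ tendsto_const P]) auto
qed

lemma eventually_in_prob_fst:
  assumes "eventually Q sequentially"
  shows "eventually (\<lambda>p. Q (fst p)) (in_prob M)"
  unfolding eventually_in_prob
proof (rule tendsto_eventually)
  show "\<forall>\<^sub>F n in sequentially. outer_measure_of M {\<omega>\<in>space M. \<not> Q (fst (n, \<omega>))} = 0"
    using assms by eventually_elim simp
qed

lemma filterlim_fst_in_prob: "filterlim fst sequentially (in_prob M)"
  unfolding filterlim_iff using eventually_in_prob_fst by blast

lemma eventually_in_prob_space: "eventually (\<lambda>p. snd p \<in> space M) (in_prob M)"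
proof -
  have "{\<omega>\<in>space M. snd (n, \<omega>) \<notin> space M} = {}" for n :: nat
    by auto
  then show ?thesis
    unfolding eventually_in_prob by simp
qed

lemma eventually_in_prob_AE:
  assumes "AE \<omega> in M. P \<omega>"
  shows "eventually (\<lambda>p. P (snd p)) (in_prob M)"
proof -
  obtain N where N: "N \<in> sets M" "{\<omega>\<in>space M. \<not> P \<omega>} \<subseteq> N" "emeasure M N = 0"
    using AE_E[OF assms] by metis
  have "outer_measure_of M {\<omega>\<in>space M. \<not> P \<omega>} \<le> outer_measure_of M N"
    using N(2) by (rule outer_measure_of_mono)
  then have "outer_measure_of M {\<omega>\<in>space M. \<not> P \<omega>} = 0"
    using N by simp
  then show ?thesis
    unfolding eventually_in_prob by simp
qed

lemma smallo_prob_if_tendsto: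
  fixes Z :: "nat \<Rightarrow> 'w \<Rightarrow> real"
  assumes lim: "((\<lambda>p. Z (fst p) (snd p) * s (fst p)) \<longlongrightarrow> 0) (in_prob M)"
    and s: "\<And>n. n > 0 \<Longrightarrow> s n > 0 \<and> a n = 1 / s n"
  shows "smallo_prob M Z a"
  unfolding smallo_prob_def
proof (intro allI impI)
  fix \<eta> :: real assume \<eta>: "\<eta> > 0"
  have "eventually (\<lambda>p. \<bar>Z (fst p) (snd p) * s (fst p)\<bar> < \<eta>) (in_prob M)"
    using tendstoD[OF lim \<eta>] by simp
  moreover have "eventually (\<lambda>p. fst p > 0) (in_prob M)"
    by (rule eventually_in_prob_fst) (rule eventually_gt_at_top)
  ultimately have "eventually (\<lambda>p. norm (Z (fst p) (snd p)) \<le> \<eta> * a (fst p)) (in_prob M)"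
  proof eventually_elim
    case (elim p)
    then have "s (fst p) > 0" "a (fst p) = 1 / s (fst p)" using s by auto
    then show ?case using elim(1) by (simp add: abs_mult pos_le_divide_eq)
  qed
  then show "(\<lambda>n. outer_measure_of M {\<omega>\<in>space M. norm (Z n \<omega>) > \<eta> * a n}) \<longlonglongrightarrow> 0"
    unfolding eventually_in_prob by (simp add: not_le)
qed

text \<open>How a quantity \<open>Z\<close> of order \<open>O\<^sub>p(a)\<close> is used: events that become likely whenever \<open>Z\<close> is bounded by a constant
  multiple of \<open>a\<close> are likely, since the bound fails with arbitrarily small probability.\<close>

lemma eventually_in_prob_localise:
  assumes Z: "bigO_prob M Z a" and a: "\<And>n. a n \<ge> 0"
    and ev: "\<And>K. K > 0 \<Longrightarrow>
      eventually P (inf (in_prob M) (principal {p. norm (Z (fst p) (snd p)) \<le> K * a (fst p)}))"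
  shows "eventually P (in_prob M)"
proof -
  let ?B = "\<lambda>n. {\<omega>\<in>space M. \<not> P (n, \<omega>)}"
  have small: "\<forall>\<^sub>F n in sequentially. outer_measure_of M (?B n) < c" if c: "c > 0" for c :: ennreal
  proof -
    \<comment> \<open>Half of the tolerance is spent on the failure of the bound, half on the failure of the event under the bound.\<close>
    obtain \<eta> :: real where \<eta>: "\<eta> > 0" "ennreal \<eta> + ennreal \<eta> < c"
    proof (cases c)
      case (real r)
      then show ?thesis
        using that[of "r / 3"] c
        by (auto simp: ennreal_plus[symmetric] ennreal_less_iff simp del: ennreal_plus)
    next
      case top
      then show ?thesis using that[of 1] by (simp add: ennreal_less_top)
    qed
    obtain K' where K': "\<forall>\<^sub>F n in sequentially.
        outer_measure_of M {\<omega>\<in>space M. norm (Z n \<omega>) > K' * a n} \<le> ennreal \<eta>"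
      using Z \<eta>(1) unfolding bigO_prob_def by blast
    define K where "K = max K' 1"
    have "(\<lambda>n. outer_measure_of M {\<omega>\<in>space M. \<not> (norm (Z n \<omega>) \<le> K * a n \<longrightarrow> P (n, \<omega>))}) \<longlonglongrightarrow> 0"
      using ev[of K] unfolding eventually_inf_principal eventually_in_prob by (simp add: K_def)
    then have "\<forall>\<^sub>F n in sequentially.
        outer_measure_of M {\<omega>\<in>space M. \<not> (norm (Z n \<omega>) \<le> K * a n \<longrightarrow> P (n, \<omega>))} < ennreal \<eta>"
      by (rule order_tendstoD(2)) (use \<eta> in simp)
    with K' show ?thesis
    proof eventually_elim
      case (elim n)
      let ?C = "{\<omega>\<in>space M. norm (Z n \<omega>) > K' * a n}"
        and ?D = "{\<omega>\<in>space M. \<not> (norm (Z n \<omega>) \<le> K * a n \<longrightarrow> P (n, \<omega>))}"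
      have "K' * a n \<le> K * a n"
        using a by (intro mult_right_mono) (auto simp: K_def)
      then have "?B n \<subseteq> ?C \<union> ?D" by auto
      then have "outer_measure_of M (?B n) \<le> outer_measure_of M (?C \<union> ?D)"
        by (rule outer_measure_of_mono)
      also have "\<dots> \<le> outer_measure_of M ?C + outer_measure_of M ?D"
        by (rule outer_measure_of_Un_le) auto
      also have "\<dots> \<le> ennreal \<eta> + ennreal \<eta>"
        by (rule add_mono[OF elim(1) less_imp_le[OF elim(2)]])
      finally show ?case using \<eta>(2) by simp
    qed
  qed
  show ?thesis
    unfolding eventually_in_prob by (rule order_tendstoI) (auto intro: small)
qed

lemma tendsto_in_prob_localise:
  assumes "bigO_prob M Z a" "\<And>n. a n \<ge> 0"
    and "\<And>K. K > 0 \<Longrightarrow>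
      (f \<longlongrightarrow> l) (inf (in_prob M) (principal {p. norm (Z (fst p) (snd p)) \<le> K * a (fst p)}))"
  shows "(f \<longlongrightarrow> l) (in_prob M)"
  unfolding tendsto_def
proof (intro allI impI)
  fix S assume "open S" "l \<in> S"
  then show "eventually (\<lambda>p. f p \<in> S) (in_prob M)"
    by (intro eventually_in_prob_localise[OF assms(1,2)] topological_tendstoD[OF assms(3)])
qed

lemma bigO_prob_imp_tendsto_zero:
  fixes Z :: "nat \<Rightarrow> 'w \<Rightarrow> 'b::real_normed_vector"
  assumes Z: "bigO_prob M Z a" and a: "\<And>n. a n \<ge> 0" "a \<longlonglongrightarrow> 0"
  shows "((\<lambda>p. Z (fst p) (snd p)) \<longlongrightarrow> 0) (in_prob M)"
proof (rule tendsto_in_prob_localise[OF Z a(1)])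
  fix K :: real assume "K > 0"
  let ?F = "inf (in_prob M) (principal {p. norm (Z (fst p) (snd p)) \<le> K * a (fst p)})"
  have "((\<lambda>p. a (fst p)) \<longlongrightarrow> 0) (in_prob M)"
    by (rule filterlim_compose[OF a(2) filterlim_fst_in_prob])
  then have "((\<lambda>p. K * a (fst p)) \<longlongrightarrow> K * 0) ?F"
    by (intro tendsto_mult_left) (rule tendsto_mono[OF inf_le1])
  then have "((\<lambda>p. K * a (fst p)) \<longlongrightarrow> 0) ?F" by simp
  moreover have "\<forall>\<^sub>F p in ?F. norm (Z (fst p) (snd p)) \<le> K * a (fst p)"
    unfolding eventually_inf_principal by simp
  ultimately show "((\<lambda>p. Z (fst p) (snd p)) \<longlongrightarrow> 0) ?F"
    by (rule Lim_null_comparison[rotated])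
qed

lemma (in prob_space) tendsto_in_prob_if_AE:
  fixes Z :: "nat \<Rightarrow> 'a \<Rightarrow> real"
  assumes [measurable]: "\<And>n. Z n \<in> borel_measurable M"
    and lim: "AE \<omega> in M. (\<lambda>n. Z n \<omega>) \<longlonglongrightarrow> c"
  shows "((\<lambda>p. Z (fst p) (snd p)) \<longlongrightarrow> c) (in_prob M)"
proof (rule tendstoI)
  fix \<eta> :: real assume \<eta>: "\<eta> > 0"
  let ?I = "\<lambda>n. indicator {\<omega>\<in>space M. \<not> dist (Z n \<omega>) c < \<eta>} :: 'a \<Rightarrow> real"
  have "(\<lambda>n. \<integral>\<omega>. ?I n \<omega> \<partial>M) \<longlonglongrightarrow> (\<integral>\<omega>. 0 \<partial>M)"
  proof (rule integral_dominated_convergence[where w = "\<lambda>_. 1"])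
    show "AE \<omega> in M. (\<lambda>n. ?I n \<omega>) \<longlonglongrightarrow> 0"
      using lim
    proof eventually_elim
      case (elim \<omega>)
      have "\<forall>\<^sub>F n in sequentially. ?I n \<omega> = 0"
        using tendstoD[OF elim \<eta>] by eventually_elim (simp add: indicator_def)
      then show ?case by (rule tendsto_eventually)
    qed
  qed (auto simp: indicator_def)
  then have "(\<lambda>n. measure M {\<omega>\<in>space M. \<not> dist (Z n \<omega>) c < \<eta>}) \<longlonglongrightarrow> 0"
    by (simp add: Int_absorb2 subset_eq)
  then have "(\<lambda>n. emeasure M {\<omega>\<in>space M. \<not> dist (Z n \<omega>) c < \<eta>}) \<longlonglongrightarrow> ennreal 0"
    unfolding emeasure_eq_measure by (intro tendsto_ennrealI) simp
  then show "eventually (\<lambda>p. dist (Z (fst p) (snd p)) c < \<eta>) (in_prob M)"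
    unfolding eventually_in_prob by simp
qed

lemma (in prob_space) second_moment_tail:
  assumes [measurable]: "Z \<in> borel_measurable M"
    and int: "integrable M (\<lambda>\<omega>. (Z \<omega>)\<^sup>2)" and "c > 0"
  shows "outer_measure_of M {\<omega>\<in>space M. c \<le> \<bar>Z \<omega>\<bar>} \<le> ennreal ((\<integral>\<omega>. (Z \<omega>)\<^sup>2 \<partial>M) / c\<^sup>2)"
proof -
  have "{\<omega>\<in>space M. c \<le> \<bar>Z \<omega>\<bar>} = {\<omega>\<in>space M. c\<^sup>2 \<le> (Z \<omega>)\<^sup>2}"
    using \<open>c > 0\<close> by (auto simp: abs_le_square_iff[symmetric])
  moreover have "measure M {\<omega>\<in>space M. c\<^sup>2 \<le> (Z \<omega>)\<^sup>2} \<le> (\<integral>\<omega>. (Z \<omega>)\<^sup>2 \<partial>M) / c\<^sup>2"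
    by (rule integral_Markov_inequality_measure[OF int, where A = "space M"])
       (use \<open>c > 0\<close> in auto)
  ultimately show ?thesis
    by (simp add: emeasure_eq_measure ennreal_leI)
qed

lemma (in prob_space) tendsto_in_prob_if_L2:
  assumes [measurable]: "\<And>n. Z n \<in> borel_measurable M"
    and int: "\<And>n. integrable M (\<lambda>\<omega>. (Z n \<omega>)\<^sup>2)"
    and lim: "(\<lambda>n. \<integral>\<omega>. (Z n \<omega>)\<^sup>2 \<partial>M) \<longlonglongrightarrow> 0"
  shows "((\<lambda>p. Z (fst p) (snd p) :: real) \<longlongrightarrow> 0) (in_prob M)"
proof (rule tendstoI)
  fix \<eta> :: real assume \<eta>: "\<eta> > 0"
  have "(\<lambda>n. ennreal ((\<integral>\<omega>. (Z n \<omega>)\<^sup>2 \<partial>M) / \<eta>\<^sup>2)) \<longlonglongrightarrow> ennreal (0 / \<eta>\<^sup>2)"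
    using \<eta> by (intro tendsto_ennrealI tendsto_divide lim tendsto_const) auto
  then have lim0: "(\<lambda>n. ennreal ((\<integral>\<omega>. (Z n \<omega>)\<^sup>2 \<partial>M) / \<eta>\<^sup>2)) \<longlonglongrightarrow> 0"
    by simp
  have le: "outer_measure_of M {\<omega>\<in>space M. \<eta> \<le> \<bar>Z n \<omega>\<bar>}
      \<le> ennreal ((\<integral>\<omega>. (Z n \<omega>)\<^sup>2 \<partial>M) / \<eta>\<^sup>2)" for n
    by (rule second_moment_tail) (use int \<eta> in auto)
  have "(\<lambda>n. outer_measure_of M {\<omega>\<in>space M. \<eta> \<le> \<bar>Z n \<omega>\<bar>}) \<longlonglongrightarrow> 0"
    by (rule tendsto_sandwich[OF always_eventually always_eventually tendsto_const lim0])
       (auto intro: le simp del: outer_measure_of_eq)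
  then show "eventually (\<lambda>p. dist (Z (fst p) (snd p)) 0 < \<eta>) (in_prob M)"
    unfolding eventually_in_prob by (simp add: not_less)
qed

lemma (in prob_space) bigO_prob_if_L2:
  fixes Z :: "nat \<Rightarrow> 'a \<Rightarrow> real"
  assumes [measurable]: "\<And>n. Z n \<in> borel_measurable M"
    and int: "\<And>n. integrable M (\<lambda>\<omega>. (Z n \<omega>)\<^sup>2)"
    and le: "\<And>n. (\<integral>\<omega>. (Z n \<omega>)\<^sup>2 \<partial>M) \<le> C"
  shows "bigO_prob M Z (\<lambda>_. 1)"
  unfolding bigO_prob_def
proof (intro allI impI)
  fix \<eta> :: real assume \<eta>: "\<eta> > 0"
  define K where "K = sqrt ((\<bar>C\<bar> + 1) / \<eta>)"
  have K: "K > 0" "K\<^sup>2 = (\<bar>C\<bar> + 1) / \<eta>"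
    using \<eta> by (auto simp: K_def)
  have "outer_measure_of M {\<omega>\<in>space M. norm (Z n \<omega>) > K * 1} \<le> ennreal \<eta>" for n
  proof -
    have "outer_measure_of M {\<omega>\<in>space M. norm (Z n \<omega>) > K * 1}
        \<le> outer_measure_of M {\<omega>\<in>space M. K \<le> \<bar>Z n \<omega>\<bar>}"
      by (intro outer_measure_of_mono) auto
    also have "\<dots> \<le> ennreal ((\<integral>\<omega>. (Z n \<omega>)\<^sup>2 \<partial>M) / K\<^sup>2)"
      by (intro second_moment_tail int K) auto
    also have "\<dots> \<le> ennreal \<eta>"
      using le[of n] \<eta> K by (intro ennreal_leI) (auto simp: field_simps)
    finally show ?thesis .
  qed
  then show "\<exists>K. \<forall>\<^sub>F n in sequentially.
      outer_measure_of M {\<omega>\<in>space M. norm (Z n \<omega>) > K * 1} \<le> ennreal \<eta>"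
    by (intro exI[of _ K] always_eventually allI)
qed

text \<open>Stochastic equicontinuity in its simplest form: with a Lipschitz constant bounded in probability,
  pointwise smallness on a finite net of a ball is smallness on the ball.\<close>

lemma uniformly_small_in_prob:
  fixes Z :: "nat \<Rightarrow> 'b::euclidean_space \<Rightarrow> 'w \<Rightarrow> real"
  assumes pt: "\<And>t. ((\<lambda>p. Z (fst p) t (snd p)) \<longlongrightarrow> 0) (in_prob M)"
    and lip: "eventually (\<lambda>p. \<forall>s t. \<bar>Z (fst p) s (snd p) - Z (fst p) t (snd p)\<bar>
                 \<le> B (fst p) (snd p) * dist s t) (in_prob M)"
    and B: "((\<lambda>p. B (fst p) (snd p)) \<longlongrightarrow> \<beta>) (in_prob M)" and "\<eta> > 0"
  shows "eventually (\<lambda>p. \<forall>t\<in>cball 0 K. \<bar>Z (fst p) t (snd p)\<bar> < \<eta>) (in_prob M)"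
proof -
  define r where "r = \<eta> / (2 * (\<bar>\<beta>\<bar> + 1))"
  have r: "r > 0" "(\<bar>\<beta>\<bar> + 1) * r \<le> \<eta> / 2"
    using \<open>\<eta> > 0\<close> by (auto simp: r_def field_simps)
  obtain T where T: "finite T" "cball (0 :: 'b) K \<subseteq> (\<Union>t\<in>T. ball t r)"
    using compact_cball[of "0 :: 'b" K] r(1) unfolding compact_eq_totally_bounded by blast
  have "eventually (\<lambda>p. \<forall>t\<in>T. \<bar>Z (fst p) t (snd p)\<bar> < \<eta> / 2) (in_prob M)"
    using T(1) tendstoD[OF pt, of "\<eta> / 2"] \<open>\<eta> > 0\<close> by (simp add: eventually_ball_finite)
  moreover have "eventually (\<lambda>p. B (fst p) (snd p) < \<bar>\<beta>\<bar> + 1) (in_prob M)"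
    by (rule order_tendstoD(2)[OF B]) simp
  ultimately show ?thesis
    using lip
  proof eventually_elim
    case (elim p)
    show ?case
    proof
      fix s assume "s \<in> cball (0 :: 'b) K"
      then obtain t where t: "t \<in> T" "dist t s < r"
        using T(2) by auto
      have "\<bar>Z (fst p) s (snd p) - Z (fst p) t (snd p)\<bar> \<le> B (fst p) (snd p) * dist s t"
        using elim(3) by blast
      also have "\<dots> \<le> (\<bar>\<beta>\<bar> + 1) * r"
        using elim(2) t(2)
        by (intro order_trans[OF mult_right_mono[OF less_imp_le] mult_left_mono])
           (auto simp: dist_commute)
      finally show "\<bar>Z (fst p) s (snd p)\<bar> < \<eta>"
        using elim(1) t(1) r(2) by fastforce
    qed
  qed
qed

text \<open>If the means converge, the last summand is the difference of consecutive sums, hence \<open>o(n)\<close>; the maximum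
  of the first \<open>n\<close> terms inherits this.\<close>

lemma max_negligible_if_means_converge:
  fixes u :: "nat \<Rightarrow> real"
  assumes "(\<lambda>n. (\<Sum>i<n. u i) / real n) \<longlonglongrightarrow> c" and "\<eta> > 0"
  shows "\<forall>\<^sub>F n in sequentially. \<forall>i<n. u i \<le> \<eta> * real n"
proof -
  have "(\<lambda>n. (\<Sum>i<Suc n. u i) / real (Suc n) * (real (Suc n) / real n) - (\<Sum>i<n. u i) / real n)
      \<longlonglongrightarrow> c * 1 - c"
    by (intro tendsto_diff tendsto_mult assms LIMSEQ_Suc[OF assms(1)] LIMSEQ_Suc_n_over_n)
  then have "\<forall>\<^sub>F n in sequentially.
      (\<Sum>i<Suc n. u i) / real (Suc n) * (real (Suc n) / real n) - (\<Sum>i<n. u i) / real n < \<eta>"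
    by (rule order_tendstoD(2)) (use assms in simp)
  then have "\<forall>\<^sub>F n in sequentially. u n \<le> \<eta> * real n"
    using eventually_gt_at_top[of 0]
  proof eventually_elim
    case (elim n)
    have "(\<Sum>i<Suc n. u i) / real (Suc n) * (real (Suc n) / real n) = (\<Sum>i<n. u i) / real n + u n / real n"
      by (simp del: of_nat_Suc add: add_divide_distrib[symmetric])
    then have "u n / real n < \<eta>"
      using elim by linarith
    then show ?case using elim by (simp add: field_simps)
  qed
  then obtain N where N: "\<And>n. n \<ge> N \<Longrightarrow> u n \<le> \<eta> * real n"
    by (auto simp: eventually_sequentially)
  define m where "m = (\<Sum>i<N. \<bar>u i\<bar>)"
  have "\<forall>\<^sub>F n in sequentially. m / \<eta> \<le> real n"
    using filterlim_real_sequentially by (rule filterlim_at_top[THEN iffD1, rule_format])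
  then show ?thesis
  proof eventually_elim
    case (elim n)
    show ?case
    proof (intro allI impI)
      fix i assume i: "i < n"
      show "u i \<le> \<eta> * real n"
      proof (cases "i < N")
        case True
        have "u i \<le> \<bar>u i\<bar>" by simp
        also have "\<dots> \<le> m"
          unfolding m_def using True by (intro member_le_sum) auto
        also have "\<dots> \<le> \<eta> * real n"
          using elim \<open>\<eta> > 0\<close> by (simp add: field_simps)
        finally show ?thesis .
      next
        case False
        then have "u i \<le> \<eta> * real i" using N by simp
        also have "\<dots> \<le> \<eta> * real n" using i \<open>\<eta> > 0\<close> by simp
        finally show ?thesis .
      qed
    qed
  qed
qed

section \<open>Birkhoff's ergodic theorem\<close>

locale ergodic_system = prob_space P for P :: "'y measure" +
  fixes T :: "'y \<Rightarrow> 'y"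
  assumes T_measurable [measurable]: "T \<in> measurable P P"
    and T_preserves: "distr P P T = P"
    and T_ergodic: "\<And>A. A \<in> sets P \<Longrightarrow> {y\<in>space P. T y \<in> A} = A \<Longrightarrow> prob A = 0 \<or> prob A = 1"
begin

text \<open>The maximum of the partial sums of \<open>f\<close> along the orbit, up to length \<open>n\<close>, including the empty sum. The recursion
  through \<open>T y\<close> is the form in which invariance of the measure can be used.\<close>

fun max_sum :: "('y \<Rightarrow> real) \<Rightarrow> nat \<Rightarrow> 'y \<Rightarrow> real" where
  "max_sum f 0 y = 0"
| "max_sum f (Suc n) y = max 0 (f y + max_sum f n (T y))"

lemma max_sum_nonneg: "0 \<le> max_sum f n y"
  by (cases n) auto

lemma max_sum_Suc_le: "max_sum f n y \<le> max_sum f (Suc n) y"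
proof (induction n arbitrary: y)
  case 0
  then show ?case by simp
next
  case (Suc n)
  have "max_sum f n (T y) \<le> max_sum f (Suc n) (T y)" by (rule Suc)
  then show ?case
    unfolding max_sum.simps(2)[of f "Suc n"] max_sum.simps(2)[of f n y] by linarith
qed

lemma max_sum_mono: "m \<le> n \<Longrightarrow> max_sum f m y \<le> max_sum f n y"
  by (rule lift_Suc_mono_le[of "\<lambda>n. max_sum f n y"]) (auto intro: max_sum_Suc_le simp del: max_sum.simps)

lemma sum_le_max_sum: "(\<Sum>i<n. f ((T ^^ i) y)) \<le> max_sum f n y"
proof (induction n arbitrary: y)
  case 0
  then show ?case by simp
next
  case (Suc n)
  have "(\<Sum>i<Suc n. f ((T ^^ i) y)) = f y + (\<Sum>i<n. f ((T ^^ i) (T y)))"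
    by (simp add: sum.lessThan_Suc_shift funpow_swap1 del: sum.lessThan_Suc)
  also have "\<dots> \<le> f y + max_sum f n (T y)"
    using Suc by simp
  finally show ?case by simp
qed

lemma integrable_comp_T:
  fixes f :: "'y \<Rightarrow> real"
  assumes f: "integrable P f"
  shows "integrable P (\<lambda>y. f (T y))" and "(\<integral>y. f (T y) \<partial>P) = (\<integral>y. f y \<partial>P)"
proof -
  have [measurable]: "f \<in> borel_measurable P" using f by simp
  show "integrable P (\<lambda>y. f (T y))"
    by (rule integrable_distr[OF T_measurable]) (simp add: T_preserves f)
  show "(\<integral>y. f (T y) \<partial>P) = (\<integral>y. f y \<partial>P)"
    using integral_distr[OF T_measurable, of f] by (simp add: T_preserves)
qed

lemma integrable_max_sum:
  assumes f: "integrable P f"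
  shows "integrable P (max_sum f n)"
proof (induction n)
  case 0
  have "max_sum f 0 = (\<lambda>y. 0)" by auto
  then show ?case by simp
next
  case (Suc n)
  have "integrable P (\<lambda>y. max 0 (f y + max_sum f n (T y)))"
    using f integrable_comp_T(1)[OF Suc] by (intro integrable_max) auto
  moreover have "max_sum f (Suc n) = (\<lambda>y. max 0 (f y + max_sum f n (T y)))" by auto
  ultimately show ?case by simp
qed

text \<open>Garsia's argument. The points with unbounded partial sums form a strictly invariant set, of
  probability \<open>0\<close> or \<open>1\<close>. On it the increment \<open>max_sum f (Suc n) y - max_sum f n (T y)\<close> converges to \<open>f y\<close>, while
  its integral is nonnegative by invariance of the measure; probability \<open>1\<close> would therefore force a nonnegative integral of \<open>f\<close>.\<close>

lemma AE_bounded_max_sum: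
  assumes f: "integrable P f" and neg: "(\<integral>y. f y \<partial>P) < 0"
  shows "AE y in P. \<exists>c. \<forall>n. max_sum f n y \<le> c"
proof -
  have [measurable]: "f \<in> borel_measurable P" using f by simp
  have [measurable]: "max_sum f n \<in> borel_measurable P" for n
    using integrable_max_sum[OF f] by simp
  define A where "A = {y\<in>space P. \<forall>c::nat. \<exists>n. max_sum f n y > real c}"
  have [measurable]: "A \<in> sets P"
    unfolding A_def by measurable
  have "{y\<in>space P. T y \<in> A} = A"
  proof (intro equalityI subsetI)
    fix y assume y: "y \<in> {y\<in>space P. T y \<in> A}"
    have "\<exists>n. max_sum f n y > real c" for c :: nat
    proof -
      \<comment> \<open>The excess over \<open>c\<close> absorbs the summand \<open>f y\<close>.\<close>
      obtain n where "max_sum f n (T y) > real (c + nat \<lceil>\<bar>f y\<bar>\<rceil>)"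
        using y unfolding A_def by blast
      then have "max_sum f (Suc n) y > real c" by (simp; linarith)
      then show ?thesis ..
    qed
    then show "y \<in> A" using y unfolding A_def by auto
  next
    fix y assume y: "y \<in> A"
    have "\<exists>n. max_sum f n (T y) > real c" for c :: nat
    proof -
      obtain n where n: "max_sum f n y > real (c + nat \<lceil>\<bar>f y\<bar>\<rceil>)"
        using y unfolding A_def by blast
      have "n \<noteq> 0"
      proof
        assume "n = 0"
        moreover have "0 \<le> real (c + nat \<lceil>\<bar>f y\<bar>\<rceil>)" by (rule of_nat_0_le_iff)
        ultimately show False using n by (simp del: of_nat_add of_nat_nat)
      qed
      then obtain m where "n = Suc m" by (cases n) auto
      then have "max_sum f m (T y) > real c"
        using n by (simp add: max_def split: if_splits; linarith)
      then show ?thesis ..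
    qed
    moreover have "y \<in> space P" using y unfolding A_def by auto
    ultimately show "y \<in> {y\<in>space P. T y \<in> A}"
      using measurable_space[OF T_measurable] unfolding A_def by auto
  qed
  then have "prob A = 0 \<or> prob A = 1"
    by (intro T_ergodic) auto
  moreover have "prob A \<noteq> 1"
  proof
    assume "prob A = 1"
    then have AE_A: "AE y in P. y \<in> A"
      by (rule AE_prob_1)
    have "(\<lambda>n. \<integral>y. max (- max_sum f n (T y)) (f y) \<partial>P) \<longlonglongrightarrow> (\<integral>y. f y \<partial>P)"
    proof (rule integral_dominated_convergence[where w = "\<lambda>y. \<bar>f y\<bar>"])
      show "AE y in P. (\<lambda>n. max (- max_sum f n (T y)) (f y)) \<longlonglongrightarrow> f y"
        using AE_A
      proof eventually_elim
        case (elim y)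
        then have "T y \<in> A" using \<open>{y\<in>space P. T y \<in> A} = A\<close> by blast
        then obtain m where m: "max_sum f m (T y) > real (nat \<lceil>\<bar>f y\<bar>\<rceil>)"
          unfolding A_def by blast
        have "\<forall>\<^sub>F n in sequentially. max (- max_sum f n (T y)) (f y) = f y"
          using eventually_ge_at_top[of m]
        proof eventually_elim
          case (elim n)
          then show ?case
            using max_sum_mono[OF elim, of f "T y"] m by (simp add: max_def; linarith)
        qed
        then show ?case by (rule tendsto_eventually)
      qed
      show "AE y in P. norm (max (- max_sum f n (T y)) (f y)) \<le> \<bar>f y\<bar>" for n
      proof (rule AE_I2)
        fix y
        show "norm (max (- max_sum f n (T y)) (f y)) \<le> \<bar>f y\<bar>"
          using max_sum_nonneg[of f n "T y"] by (auto simp: max_def abs_if)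
      qed
    qed (use f in auto)
    moreover have "0 \<le> (\<integral>y. max (- max_sum f n (T y)) (f y) \<partial>P)" for n
    proof -
      have "max (- max_sum f n (T y)) (f y) = max_sum f (Suc n) y - max_sum f n (T y)" for y
        by (simp add: max_def)
      then have "(\<integral>y. max (- max_sum f n (T y)) (f y) \<partial>P)
          = (\<integral>y. max_sum f (Suc n) y - max_sum f n (T y) \<partial>P)"
        by (simp only:)
      also have "\<dots> = (\<integral>y. max_sum f (Suc n) y \<partial>P) - (\<integral>y. max_sum f n y \<partial>P)"
        using integrable_max_sum[OF f] integrable_comp_T[OF integrable_max_sum[OF f]]
        by (simp del: max_sum.simps)
      also have "\<dots> \<ge> 0"
        using integral_mono[OF integrable_max_sum[OF f] integrable_max_sum[OF f] max_sum_Suc_le]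
        by (simp del: max_sum.simps)
      finally show ?thesis .
    qed
    ultimately have "0 \<le> (\<integral>y. f y \<partial>P)"
      by (intro LIMSEQ_le_const) auto
    then show False using neg by simp
  qed
  ultimately have "AE y in P. y \<notin> A"
    by (intro AE_not_in) (auto simp: emeasure_eq_measure null_sets_def)
  then show ?thesis
  proof (rule AE_mp, intro AE_I2 impI)
    fix y assume "y \<in> space P" "y \<notin> A"
    then show "\<exists>c. \<forall>n. max_sum f n y \<le> c"
      unfolding A_def by (auto simp: not_less)
  qed
qed

lemma AE_upper_mean:
  assumes f: "integrable P f" and "c > (\<integral>y. f y \<partial>P)"
  shows "AE y in P. \<forall>\<^sub>F n in sequentially. (\<Sum>i<n. f ((T ^^ i) y)) / real n < c"
proof -
  define c' where "c' = ((\<integral>y. f y \<partial>P) + c) / 2"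
  have c': "c' > (\<integral>y. f y \<partial>P)" "c' < c"
    using assms by (auto simp: c'_def)
  have "AE y in P. \<exists>d. \<forall>n. max_sum (\<lambda>y. f y - c') n y \<le> d"
    using f c' by (intro AE_bounded_max_sum) (auto simp: prob_space)
  then show ?thesis
  proof eventually_elim
    case (elim y)
    then obtain d where d: "max_sum (\<lambda>y. f y - c') n y \<le> d" for n by blast
    have "\<forall>\<^sub>F n in sequentially. (\<bar>d\<bar> + 1) / (c - c') \<le> real n"
      using filterlim_real_sequentially by (rule filterlim_at_top[THEN iffD1, rule_format])
    then show ?case
      using eventually_gt_at_top[of 0]
    proof eventually_elim
      case (elim n)
      have "(\<Sum>i<n. f ((T ^^ i) y)) - real n * c' \<le> d"
        using sum_le_max_sum[of "\<lambda>y. f y - c'" y n] d[of n] by (simp add: sum_subtractf)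
      moreover have "d < real n * (c - c')"
        using elim c' by (auto simp: field_simps)
      ultimately show ?case
        using elim by (simp add: field_simps)
    qed
  qed
qed

text \<open>Bounded partial sums of \<open>f - c\<close>, for \<open>c\<close> slightly above the mean, bound the upper limit of the averages; the lower
  limit follows from \<open>- f\<close>.\<close>

theorem birkhoff:
  assumes f: "integrable P f"
  shows "AE y in P. (\<lambda>n. (\<Sum>i<n. f ((T ^^ i) y)) / real n) \<longlonglongrightarrow> (\<integral>y. f y \<partial>P)"
proof -
  let ?e = "\<integral>y. f y \<partial>P"
  have "AE y in P. \<forall>m::nat. \<forall>\<^sub>F n in sequentially. (\<Sum>i<n. f ((T ^^ i) y)) / real n < ?e + 1 / Suc m"
    unfolding AE_all_countable using f by (intro allI AE_upper_mean) auto
  moreover have "AE y in P. \<forall>m::nat. \<forall>\<^sub>F n in sequentially.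
      (\<Sum>i<n. - f ((T ^^ i) y)) / real n < - ?e + 1 / Suc m"
    unfolding AE_all_countable using f by (intro allI AE_upper_mean) auto
  ultimately show ?thesis
  proof eventually_elim
    case (elim y)
    show ?case
    proof (rule tendstoI)
      fix \<eta> :: real assume "\<eta> > 0"
      then obtain m where m: "1 / real (Suc m) < \<eta>"
        using nat_approx_posE by blast
      show "\<forall>\<^sub>F n in sequentially. dist ((\<Sum>i<n. f ((T ^^ i) y)) / real n) ?e < \<eta>"
        using elim(1)[rule_format, of m] elim(2)[rule_format, of m]
        by eventually_elim (use m in \<open>auto simp: dist_real_def sum_negf abs_if\<close>)
    qed
  qed
qed

end

section \<open>Absolute continuity and the fundamental theorem of calculus\<close>

text \<open>The derivative may fail to exist on a null set \<open>N\<close>. In the gauge integral such points are controlled through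
  the gauge: intervals tagged in \<open>N\<close> are kept inside an open set of small measure, where absolute
  continuity bounds the total increment of \<open>f\<close>; the other intervals obey the usual estimate of differentiability.\<close>

lemma abs_continuous_on_has_integral:
  fixes f g :: "real \<Rightarrow> real"
  assumes ac: "abs_continuous_on {a..b} f" and "a \<le> b"
    and N: "negligible N"
    and der: "\<And>x. x \<in> {a..b} - N \<Longrightarrow> (f has_real_derivative g x) (at x)"
  shows "(g has_integral (f b - f a)) {a..b}"
proof -
  define g0 where "g0 x = (if x \<in> N then 0 else g x)" for x
  have "(g0 has_integral (f b - f a)) {a..b}"
    unfolding has_integral_real
  proof (intro allI impI)
    fix \<epsilon> :: real assume \<epsilon>: "\<epsilon> > 0"
    obtain \<delta> where \<delta>: "\<delta> > 0" "\<And>D. finite D \<Longrightarrow> (\<forall>(u, v)\<in>D. u \<le> v \<and> {u..v} \<subseteq> {a..b}) \<Longrightarrow>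
        pairwise (\<lambda>(u, v) (u', v'). {u<..<v} \<inter> {u'<..<v'} = {}) D \<Longrightarrow>
        (\<Sum>(u, v)\<in>D. v - u) < \<delta> \<Longrightarrow> (\<Sum>(u, v)\<in>D. \<bar>f v - f u\<bar>) < \<epsilon> / 2"
      using ac[unfolded abs_continuous_on_def, rule_format, of "\<epsilon> / 2"] \<epsilon> by auto
    have Nnull: "N \<in> null_sets lebesgue"
      using N by (simp add: negligible_iff_null_sets)
    obtain U where U: "open U" "N \<subseteq> U" "emeasure lebesgue (U - N) < ennreal \<delta>"
      using sets_lebesgue_outer_open[of N \<delta>] Nnull \<delta>(1) by blast
    have "emeasure lebesgue U = emeasure lebesgue (U - N)"
      using Nnull U(1) by (simp add: emeasure_Diff_null_set)
    then have mU: "emeasure lebesgue U < ennreal \<delta>" using U(3) by simp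
    then have fmU: "U \<in> lmeasurable"
      using U(1) by (intro fmeasurableI) (auto simp: less_top[symmetric] top_unique)
    have mU': "measure lebesgue U < \<delta>"
      using mU fmU \<delta>(1) by (simp add: emeasure_eq_measure2 ennreal_less_iff)
    define \<epsilon>' where "\<epsilon>' = \<epsilon> / (4 * (b - a + 1))"
    have \<epsilon>': "\<epsilon>' > 0" "\<epsilon>' * (b - a) < \<epsilon> / 2"
    proof -
      have "\<epsilon> * a \<le> \<epsilon> * b"
        using \<epsilon> \<open>a \<le> b\<close> by (intro mult_left_mono) auto
      then have "\<epsilon> * (b - a) * 2 < \<epsilon> * (b - a + 1) * 4"
        using \<epsilon> unfolding distrib_left distrib_right right_diff_distrib left_diff_distrib by linarith
      then show "\<epsilon>' * (b - a) < \<epsilon> / 2"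
        using \<open>a \<le> b\<close> by (simp add: \<epsilon>'_def field_simps)
    qed (use \<epsilon> \<open>a \<le> b\<close> in \<open>simp add: \<epsilon>'_def\<close>)
    have "\<exists>d>0. (x \<in> N \<longrightarrow> ball x d \<subseteq> U) \<and>
        (x \<in> {a..b} - N \<longrightarrow> (\<forall>y. \<bar>y - x\<bar> < d \<longrightarrow> \<bar>f y - f x - g x * (y - x)\<bar> \<le> \<epsilon>' * \<bar>y - x\<bar>))" for x
    proof (cases "x \<in> N")
      case True
      then show ?thesis using U(1,2) by (auto simp: open_contains_ball)
    next
      case False
      show ?thesis
      proof (cases "x \<in> {a..b}")
        case True
        then have "(f has_derivative (*) (g x)) (at x)"
          using der False by (simp add: has_field_derivative_def)
        then obtain d where "d > 0" "\<And>y. \<bar>y - x\<bar> < d \<Longrightarrow> \<bar>f y - f x - g x * (y - x)\<bar> \<le> \<epsilon>' * \<bar>y - x\<bar>"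
          using \<epsilon>'(1) unfolding has_derivative_at_alt by (auto; metis)
        then show ?thesis using False by blast
      qed (use False in \<open>auto intro: exI[of _ 1]\<close>)
    qed
    then obtain d where d: "\<And>x. d x > 0" "\<And>x. x \<in> N \<Longrightarrow> ball x (d x) \<subseteq> U"
      "\<And>x y. x \<in> {a..b} - N \<Longrightarrow> \<bar>y - x\<bar> < d x \<Longrightarrow> \<bar>f y - f x - g x * (y - x)\<bar> \<le> \<epsilon>' * \<bar>y - x\<bar>"
      by metis
    show "\<exists>\<gamma>. gauge \<gamma> \<and> (\<forall>\<D>. \<D> tagged_division_of {a..b} \<and> \<gamma> fine \<D> \<longrightarrow>
        norm ((\<Sum>(x, K)\<in>\<D>. measure lborel K *\<^sub>R g0 x) - (f b - f a)) < \<epsilon>)"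
    proof (intro exI[of _ "\<lambda>x. ball x (d x)"] conjI allI impI)
      show "gauge (\<lambda>x. ball x (d x))"
        using d(1) by (simp add: gauge_ball_dependent)
    next
      fix p assume "p tagged_division_of {a..b} \<and> (\<lambda>x. ball x (d x)) fine p"
      then have p: "p tagged_division_of {a..b}" and fine: "(\<lambda>x. ball x (d x)) fine p"
        by auto
      have fin: "finite p" using p by blast
      have K: "\<exists>u v. K = {u..v} \<and> u \<le> x \<and> x \<le> v \<and> a \<le> u \<and> v \<le> b" if "(x, K) \<in> p" for x K
      proof -
        obtain u v where uv: "K = cbox u v"
          using tagged_division_ofD(4)[OF p \<open>(x, K) \<in> p\<close>] by blast
        have "x \<in> K" "K \<subseteq> {a..b}"
          using tagged_division_ofD(2,3)[OF p \<open>(x, K) \<in> p\<close>] by auto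
        then show ?thesis using uv by auto
      qed
      have ba: "b - a = (\<Sum>(x,K)\<in>p. Sup K - Inf K)" "f b - f a = (\<Sum>(x,K)\<in>p. f (Sup K) - f (Inf K))"
        using additive_tagged_division_1[OF \<open>a \<le> b\<close> p, of "\<lambda>x. x"]
          additive_tagged_division_1[OF \<open>a \<le> b\<close> p, of f] by auto
      \<comment> \<open>Intervals tagged in \<open>N\<close> are kept in \<open>p2\<close> only if they are nondegenerate: the others contribute nothing, and
        without them the interval determines its tag.\<close>
      define p1 where "p1 = {(x, K). (x, K) \<in> p \<and> x \<notin> N}"
      define p2 where "p2 = {(x, K). (x, K) \<in> p \<and> x \<in> N \<and> Inf K < Sup K}"
      let ?T = "\<lambda>(x, K). measure lborel K *\<^sub>R g0 x - (f (Sup K) - f (Inf K))"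
      have sub: "p1 \<subseteq> p" "p2 \<subseteq> p" and disj: "p1 \<inter> p2 = {}"
        by (auto simp: p1_def p2_def)
      have fin12: "finite p1" "finite p2" using sub fin finite_subset by auto
      have zero: "?T z = 0" if "z \<in> p - (p1 \<union> p2)" for z
      proof -
        obtain x K where z: "z = (x, K)" by (cases z)
        then have xK: "(x, K) \<in> p" "x \<in> N" "\<not> Inf K < Sup K"
          using that by (auto simp: p1_def p2_def)
        then obtain u v where "K = {u..v}" "u \<le> x" "x \<le> v"
          using K by blast
        moreover from this xK(3) have "u = v" by simp
        ultimately show ?thesis using z xK(2) by (simp add: g0_def)
      qed
      have "(\<Sum>(x, K)\<in>p. measure lborel K *\<^sub>R g0 x) - (f b - f a) = (\<Sum>z\<in>p. ?T z)"
        unfolding ba(2) by (simp add: sum_subtractf[symmetric] case_prod_unfold)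
      also have "\<dots> = (\<Sum>z\<in>p1 \<union> p2. ?T z)"
        using fin sub zero by (intro sum.mono_neutral_right) auto
      also have "\<dots> = (\<Sum>z\<in>p1. ?T z) + (\<Sum>z\<in>p2. ?T z)"
        using fin12 disj by (rule sum.union_disjoint)
      finally have split: "(\<Sum>(x, K)\<in>p. measure lborel K *\<^sub>R g0 x) - (f b - f a)
          = (\<Sum>z\<in>p1. ?T z) + (\<Sum>z\<in>p2. ?T z)" .
      have "\<bar>\<Sum>z\<in>p1. ?T z\<bar> \<le> (\<Sum>z\<in>p1. \<bar>?T z\<bar>)" by (rule sum_abs)
      also have "\<dots> \<le> (\<Sum>z\<in>p1. \<epsilon>' * (case z of (x, K) \<Rightarrow> Sup K - Inf K))"
      proof (rule sum_mono)
        fix z assume "z \<in> p1"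
        then obtain x K where z: "z = (x, K)" "(x, K) \<in> p" "x \<notin> N"
          by (auto simp: p1_def)
        obtain u v where uv: "K = {u..v}" "u \<le> x" "x \<le> v" "a \<le> u" "v \<le> b"
          using K[OF z(2)] by blast
        have "K \<subseteq> ball x (d x)" using fine z(2) by blast
        moreover have "u \<in> K" "v \<in> K" using uv by auto
        ultimately have "u \<in> ball x (d x)" "v \<in> ball x (d x)" by blast+
        then have "\<bar>u - x\<bar> < d x" "\<bar>v - x\<bar> < d x"
          by (auto simp: dist_real_def)
        then have "\<bar>f u - f x - g x * (u - x)\<bar> \<le> \<epsilon>' * \<bar>u - x\<bar>" "\<bar>f v - f x - g x * (v - x)\<bar> \<le> \<epsilon>' * \<bar>v - x\<bar>"
          using uv z(3) by (intro d(3); simp)+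
        moreover have "\<epsilon>' * \<bar>u - x\<bar> + \<epsilon>' * \<bar>v - x\<bar> = \<epsilon>' * (v - u)"
          using uv by (simp add: algebra_simps)
        moreover have "(v - u) * g x - (f v - f u)
            = (f u - f x - g x * (u - x)) - (f v - f x - g x * (v - x))"
          by (simp add: algebra_simps)
        ultimately have "\<bar>(v - u) * g x - (f v - f u)\<bar> \<le> \<epsilon>' * (v - u)"
          by linarith
        then show "\<bar>?T z\<bar> \<le> \<epsilon>' * (case z of (x, K) \<Rightarrow> Sup K - Inf K)"
          using uv z by (simp add: g0_def)
      qed
      also have "\<dots> = \<epsilon>' * (\<Sum>(x, K)\<in>p1. Sup K - Inf K)"
        by (simp add: sum_distrib_left case_prod_unfold)
      also have "\<dots> \<le> \<epsilon>' * (\<Sum>(x, K)\<in>p. Sup K - Inf K)"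
      proof (intro mult_left_mono sum_mono2 fin sub)
        fix z assume "z \<in> p - p1"
        then obtain x K where "z = (x, K)" "(x, K) \<in> p" by (cases z) auto
        then show "0 \<le> (case z of (x, K) \<Rightarrow> Sup K - Inf K)"
          using K[of x K] by auto
      qed (use \<epsilon>' in auto)
      finally have bound1: "\<bar>\<Sum>z\<in>p1. ?T z\<bar> < \<epsilon> / 2"
        using \<epsilon>' ba(1) by simp
      have inj: "inj_on snd p2"
      proof (rule inj_onI)
        fix z z' assume z: "z \<in> p2" "z' \<in> p2" "snd z = snd z'"
        obtain x K where xK: "z = (x, K)" "(x, K) \<in> p" "Inf K < Sup K" using z(1) by (auto simp: p2_def)
        obtain x' where xK': "z' = (x', K)" "(x', K) \<in> p" using z(2,3) xK by (auto simp: p2_def)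
        have "interior K \<noteq> {}" using K[OF xK(2)] xK(3) by auto
        then show "z = z'"
          using tagged_division_ofD(5)[OF p xK(2) xK'(2)] xK xK' by auto
      qed
      have Kp2: "\<exists>x. (x, K) \<in> p \<and> x \<in> N \<and> Inf K < Sup K" if "K \<in> snd ` p2" for K
        using that by (auto simp: p2_def)
      have "p2 tagged_partial_division_of {a..b}"
        using p sub(2) tagged_partial_division_subset unfolding tagged_division_of_def by blast
      then have div: "(snd ` p2) division_of \<Union> (snd ` p2)"
        by (rule partial_division_of_tagged_division)
      define D where "D = (\<lambda>K. (Inf K, Sup K)) ` (snd ` p2)"
      have injD: "inj_on (\<lambda>K. (Inf K, Sup K)) (snd ` p2)"
      proof (rule inj_onI)
        fix K K' assume "K \<in> snd ` p2" "K' \<in> snd ` p2" "(Inf K, Sup K) = (Inf K', Sup K')"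
        then show "K = K'"
          using Kp2[of K] Kp2[of K'] K by (smt (verit) Pair_inject cInf_atLeastAtMost cSup_atLeastAtMost)
      qed
      have sumD: "(\<Sum>(u, v)\<in>D. h u v) = (\<Sum>(x, K)\<in>p2. h (Inf K) (Sup K))" for h :: "real \<Rightarrow> real \<Rightarrow> real"
        unfolding D_def by (simp add: sum.reindex injD inj case_prod_unfold)
      have Kcont: "Sup K - Inf K = measure lebesgue K" if "K \<in> snd ` p2" for K
        using Kp2[OF that] K by force
      have "(\<Sum>(u, v)\<in>D. v - u) = (\<Sum>K\<in>snd ` p2. Sup K - Inf K)"
        unfolding D_def by (simp add: sum.reindex injD)
      also have "\<dots> = (\<Sum>K\<in>snd ` p2. measure lebesgue K)"
        using Kcont by (rule sum.cong[OF refl])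
      also have "\<dots> = measure lebesgue (\<Union> (snd ` p2))"
        by (rule content_division[OF div])
      also have "\<dots> \<le> measure lebesgue U"
      proof (rule measure_mono_fmeasurable[OF _ _ fmU])
        show "\<Union> (snd ` p2) \<subseteq> U"
          using fine d(2) by (fastforce simp: p2_def fine_def)
        show "\<Union> (snd ` p2) \<in> sets lebesgue"
          using div lmeasurable_division by blast
      qed
      finally have len: "(\<Sum>(u, v)\<in>D. v - u) < \<delta>" using mU' by simp
      have "(\<Sum>(u, v)\<in>D. \<bar>f v - f u\<bar>) < \<epsilon> / 2"
      proof (rule \<delta>(2))
        show "finite D" unfolding D_def using fin12 by auto
        show "\<forall>(u, v)\<in>D. u \<le> v \<and> {u..v} \<subseteq> {a..b}"
          unfolding D_def using Kp2 K by fastforce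
        show "pairwise (\<lambda>(u, v) (u', v'). {u<..<v} \<inter> {u'<..<v'} = {}) D"
        proof (rule pairwiseI)
          fix A A' assume A: "A \<in> D" "A' \<in> D" "A \<noteq> A'"
          obtain x K where xK: "(x, K) \<in> p2" "A = (Inf K, Sup K)"
            using A(1) by (auto simp: D_def)
          obtain x' K' where xK': "(x', K') \<in> p2" "A' = (Inf K', Sup K')"
            using A(2) by (auto simp: D_def)
          have p12: "(x, K) \<in> p" "(x', K') \<in> p" "Inf K < Sup K" "Inf K' < Sup K'"
            using xK(1) xK'(1) by (auto simp: p2_def)
          have "interior K \<inter> interior K' = {}"
            using tagged_division_ofD(5)[OF p p12(1,2)] A(3) xK(2) xK'(2) by auto
          then have "{Inf K<..<Sup K} \<inter> {Inf K'<..<Sup K'} = {}"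
            using K[OF p12(1)] K[OF p12(2)] by auto
          then show "(\<lambda>(u, v) (u', v'). {u<..<v} \<inter> {u'<..<v'} = {}) A A'"
            using xK(2) xK'(2) by simp
        qed
      qed (rule len)
      moreover have "\<bar>\<Sum>z\<in>p2. ?T z\<bar> \<le> (\<Sum>(x, K)\<in>p2. \<bar>f (Sup K) - f (Inf K)\<bar>)"
      proof -
        have "(\<Sum>z\<in>p2. ?T z) = (\<Sum>(x, K)\<in>p2. - (f (Sup K) - f (Inf K)))"
          by (intro sum.cong) (auto simp: p2_def g0_def)
        also have "\<bar>\<dots>\<bar> \<le> (\<Sum>(x, K)\<in>p2. \<bar>f (Sup K) - f (Inf K)\<bar>)"
          by (rule order_trans[OF sum_abs]) (auto intro!: sum_mono)
        finally show ?thesis .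
      qed
      ultimately have bound2: "\<bar>\<Sum>z\<in>p2. ?T z\<bar> < \<epsilon> / 2"
        using sumD[of "\<lambda>u v. \<bar>f v - f u\<bar>"] by linarith
      show "norm ((\<Sum>(x, K)\<in>p. measure lborel K *\<^sub>R g0 x) - (f b - f a)) < \<epsilon>"
        unfolding split using bound1 bound2 by simp
    qed
  qed
  then show ?thesis
    by (rule has_integral_spike[OF N, rotated]) (auto simp: g0_def)
qed

section \<open>Location shifts of a Lipschitz functional\<close>

text \<open>The functional \<open>g\<close> is Lipschitz at scale \<open>\<delta>\<close> around each point, with weight \<open>w\<close> square integrable under the
  density \<open>f\<close>; its growth is measured by the same weight.\<close>

locale shifted_functional =
  fixes f f' w g k :: "real \<Rightarrow> real" and C L \<delta> :: real
  assumes f_pos: "\<And>y. f y > 0"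
    and f_measurable [measurable]: "f \<in> borel_measurable borel"
    and fisher: "finite_fisher_information f f'"
    and w_measurable [measurable]: "w \<in> borel_measurable borel"
    and w_ge_1: "\<And>y. w y \<ge> 1"
    and w_square_integrable: "integrable lborel (\<lambda>y. (w y)\<^sup>2 * f y)"
    and g_measurable [measurable]: "g \<in> borel_measurable borel"
    and g_growth: "\<And>y. \<bar>g y\<bar> \<le> C * w y"
    and L_nonneg: "L \<ge> 0" and \<delta>_pos: "\<delta> > 0"
    and g_lipschitz: "\<And>y h h'. \<bar>h\<bar> \<le> \<delta> \<Longrightarrow> \<bar>h'\<bar> \<le> \<delta> \<Longrightarrow> \<bar>g (y + h) - g (y + h')\<bar> \<le> L * \<bar>h - h'\<bar> * w y"
    and k_measurable [measurable]: "k \<in> borel_measurable borel"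
    and k_nonneg: "\<And>u. k u \<ge> 0"
    and k_integrable: "integrable lborel k" and k_integral: "(\<integral>u. k u \<partial>lborel) = 1"
    and k_even: "\<And>u. k (- u) = k u"
    and k_support: "\<And>u. \<bar>u\<bar> > 1 \<Longrightarrow> k u = 0"
begin

lemma f'_measurable [measurable]: "f' \<in> borel_measurable borel"
  using fisher by (simp add: finite_fisher_information_def)

lemma C_nonneg: "C \<ge> 0"
proof -
  have "0 \<le> C * w 0" using g_growth[of 0] by simp
  then show ?thesis using w_ge_1[of 0] by (simp add: zero_le_mult_iff)
qed

lemma g_shift_bound: "\<bar>h\<bar> \<le> \<delta> \<Longrightarrow> \<bar>g (y + h)\<bar> \<le> (C + L * \<delta>) * w y"
proof -
  assume h: "\<bar>h\<bar> \<le> \<delta>"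
  have "\<bar>g (y + h) - g (y + 0)\<bar> \<le> L * \<bar>h - 0\<bar> * w y"
    by (rule g_lipschitz) (use h \<delta>_pos in auto)
  also have "\<dots> \<le> L * \<delta> * w y"
    using h L_nonneg w_ge_1[of y] by (intro mult_right_mono mult_left_mono) auto
  finally show ?thesis using g_growth[of y] by (simp add: algebra_simps)
qed

lemma w_f_integrable: "integrable lborel (\<lambda>y. w y * f y)"
proof (rule Bochner_Integration.integrable_bound[OF w_square_integrable])
  show "AE y in lborel. norm (w y * f y) \<le> norm ((w y)\<^sup>2 * f y)"
  proof (rule AE_I2)
    fix y
    have "w y * 1 \<le> w y * w y" using w_ge_1[of y] by (intro mult_left_mono) auto
    then show "norm (w y * f y) \<le> norm ((w y)\<^sup>2 * f y)"
      using w_ge_1[of y] f_pos[of y] by (simp add: power2_eq_square)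
  qed
qed simp

text \<open>Since \<open>|f'|\<close> is \<open>|score| \<cdot> f\<close>, this is the inequality between geometric and arithmetic means for \<open>w\<close> and the score.\<close>

lemma w_f'_integrable: "integrable lborel (\<lambda>y. w y * \<bar>f' y\<bar>)"
proof (rule Bochner_Integration.integrable_bound)
  show "integrable lborel (\<lambda>y. (w y)\<^sup>2 * f y + (score f f' y)\<^sup>2 * f y)"
    using w_square_integrable fisher by (simp add: finite_fisher_information_def)
  show "AE y in lborel. norm (w y * \<bar>f' y\<bar>) \<le> norm ((w y)\<^sup>2 * f y + (score f f' y)\<^sup>2 * f y)"
  proof (rule AE_I2)
    fix y
    have "0 \<le> (w y - \<bar>score f f' y\<bar>)\<^sup>2" by simp
    then have "2 * (w y * \<bar>score f f' y\<bar>) \<le> (w y)\<^sup>2 + (score f f' y)\<^sup>2"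
      by (simp add: power2_diff)
    moreover have "0 \<le> w y * \<bar>score f f' y\<bar>" using w_ge_1[of y] by simp
    ultimately have "w y * \<bar>score f f' y\<bar> \<le> (w y)\<^sup>2 + (score f f' y)\<^sup>2" by linarith
    then have "w y * \<bar>score f f' y\<bar> * f y \<le> ((w y)\<^sup>2 + (score f f' y)\<^sup>2) * f y"
      using f_pos[of y] by (intro mult_right_mono) auto
    moreover have "w y * \<bar>score f f' y\<bar> * f y = w y * \<bar>f' y\<bar>"
      using f_pos[of y] by (simp add: score_def abs_divide)
    ultimately show "norm (w y * \<bar>f' y\<bar>) \<le> norm ((w y)\<^sup>2 * f y + (score f f' y)\<^sup>2 * f y)"
      using w_ge_1[of y] f_pos[of y] by (simp add: distrib_right)
  qed
qed simp

lemma f'_integrable: "integrable lborel f'"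
proof (rule Bochner_Integration.integrable_bound[OF w_f'_integrable])
  show "AE y in lborel. norm (f' y) \<le> norm (w y * \<bar>f' y\<bar>)"
  proof (rule AE_I2)
    fix y
    have "1 * \<bar>f' y\<bar> \<le> w y * \<bar>f' y\<bar>" using w_ge_1[of y] by (intro mult_right_mono) auto
    then show "norm (f' y) \<le> norm (w y * \<bar>f' y\<bar>)" using w_ge_1[of y] by (simp add: abs_mult)
  qed
qed simp

lemma f_increment:
  assumes "u \<le> v"
  shows "f (y - v) - f (y - u) = - (\<integral>x. indicator {u..v} x * f' (y - x) \<partial>lborel)"
proof -
  have "AE y in lborel. (f has_real_derivative f' y) (at y)"
    using fisher by (simp add: finite_fisher_information_def)
  then obtain N where N: "N \<in> null_sets lborel" "{y. \<not> (f has_real_derivative f' y) (at y)} \<subseteq> N"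
    by (auto elim!: AE_E simp: null_sets_def)
  have "negligible N"
    using N(1) by (simp add: negligible_iff_null_sets null_sets_completionI)
  then have "(f' has_integral (f (y - u) - f (y - v))) {y - v..y - u}"
    by (rule abs_continuous_on_has_integral[rotated 2])
       (use N assms fisher in \<open>auto simp: finite_fisher_information_def\<close>)
  moreover have "set_integrable lborel {y - v..y - u} f'"
    unfolding set_integrable_def using f'_integrable by (intro integrable_mult_indicator) auto
  ultimately have "f (y - u) - f (y - v) = (LINT x:{y - v..y - u}|lborel. f' x)"
    by (simp add: set_borel_integral_eq_integral(2) integral_unique)
  also have "\<dots> = (\<integral>x. indicator {y - v..y - u} (y + (-1) * x) * f' (y + (-1) * x) \<partial>lborel)"
    unfolding set_lebesgue_integral_def
    by (subst lborel_integral_real_affine[of "-1" _ y]) auto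
  also have "\<dots> = (\<integral>x. indicator {u..v} x * f' (y - x) \<partial>lborel)"
    by (intro Bochner_Integration.integral_cong) (auto simp: indicator_def)
  finally show ?thesis by simp
qed

definition shift_mean :: "real \<Rightarrow> real" where
  "shift_mean h = (\<integral>y. g (y + h) * f y \<partial>lborel)"

text \<open>The derivative of \<open>shift_mean\<close>, with the derivative placed on the density. At \<open>0\<close> it is the expectation of \<open>g\<close> times the score.\<close>

definition shift_slope :: "real \<Rightarrow> real" where
  "shift_slope h = - (\<integral>y. g (y + h) * f' y \<partial>lborel)"

definition slope_lipschitz :: real where
  "slope_lipschitz = L * (\<integral>y. w y * \<bar>f' y\<bar> \<partial>lborel)"

lemma slope_lipschitz_nonneg: "slope_lipschitz \<ge> 0"
  unfolding slope_lipschitz_def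
proof (rule mult_nonneg_nonneg[OF L_nonneg], rule Bochner_Integration.integral_nonneg)
  show "0 \<le> w y * \<bar>f' y\<bar>" for y
    using w_ge_1[of y] by simp
qed

lemma g_shift_f_integrable:
  assumes "\<bar>h\<bar> \<le> \<delta>"
  shows "integrable lborel (\<lambda>y. g (y + h) * f y)"
proof (rule Bochner_Integration.integrable_bound)
  show "integrable lborel (\<lambda>y. (C + L * \<delta>) * (w y * f y))"
    using w_f_integrable by simp
  show "AE y in lborel. norm (g (y + h) * f y) \<le> norm ((C + L * \<delta>) * (w y * f y))"
  proof (rule AE_I2)
    fix y
    have "\<bar>g (y + h)\<bar> * f y \<le> (C + L * \<delta>) * w y * f y"
      using g_shift_bound[OF assms, of y] f_pos[of y] by (intro mult_right_mono) auto
    then show "norm (g (y + h) * f y) \<le> norm ((C + L * \<delta>) * (w y * f y))"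
      using f_pos[of y] by (simp add: abs_mult mult.assoc[symmetric])
        (metis abs_ge_self abs_mult order_trans)
  qed
qed simp

lemma g_shift_f'_bound:
  assumes "\<bar>h\<bar> \<le> \<delta>"
  shows "\<bar>g (y + h) * f' y\<bar> \<le> (C + L * \<delta>) * (w y * \<bar>f' y\<bar>)"
  using mult_right_mono[OF g_shift_bound[OF assms, of y], of "\<bar>f' y\<bar>"]
  by (simp add: abs_mult mult.assoc)

lemma g_shift_f'_integrable:
  assumes "\<bar>h\<bar> \<le> \<delta>"
  shows "integrable lborel (\<lambda>y. g (y + h) * f' y)"
proof (rule Bochner_Integration.integrable_bound)
  show "integrable lborel (\<lambda>y. (C + L * \<delta>) * (w y * \<bar>f' y\<bar>))"
    using w_f'_integrable by simp
  show "AE y in lborel. norm (g (y + h) * f' y) \<le> norm ((C + L * \<delta>) * (w y * \<bar>f' y\<bar>))"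
    using g_shift_f'_bound[OF assms]
    by (intro AE_I2) (metis abs_ge_self order_trans real_norm_def)
qed simp

text \<open>Move the shift to the density, write the increment of \<open>f\<close> as an integral of \<open>f'\<close>, and exchange the two integrals.\<close>

lemma shift_mean_increment:
  assumes "- \<delta> \<le> u" "u \<le> v" "v \<le> \<delta>"
  shows "integrable lborel (\<lambda>x. indicator {u..v} x * shift_slope x)"
    and "shift_mean v - shift_mean u = (\<integral>x. indicator {u..v} x * shift_slope x \<partial>lborel)"
proof -
  have trans: "(\<integral>y. F (y + h) \<partial>lborel) = (\<integral>y. F y \<partial>lborel)" for F :: "real \<Rightarrow> real" and h
    using lborel_integral_real_affine[of 1 F h] by (simp add: add.commute)
  have transI: "integrable lborel (\<lambda>y. F (y + h)) \<longleftrightarrow> integrable lborel F" for F :: "real \<Rightarrow> real" and h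
    using lborel_integrable_real_affine_iff[of 1 F h] by (simp add: add.commute)
  have shift: "shift_mean h = (\<integral>y. g y * f (y - h) \<partial>lborel)" for h
    using trans[of "\<lambda>y. g y * f (y - h)" h] by (simp add: shift_mean_def)
  have shiftI: "integrable lborel (\<lambda>y. g y * f (y - h))" if "\<bar>h\<bar> \<le> \<delta>" for h
    using g_shift_f_integrable[OF that] transI[of "\<lambda>y. g y * f (y - h)" h] by simp
  have slope: "shift_slope h = - (\<integral>y. g y * f' (y - h) \<partial>lborel)" for h
    using trans[of "\<lambda>y. g y * f' (y - h)" h] by (simp add: shift_slope_def)
  have slopeI: "integrable lborel (\<lambda>y. g y * f' (y - h))" if "\<bar>h\<bar> \<le> \<delta>" for h
    using g_shift_f'_integrable[OF that] transI[of "\<lambda>y. g y * f' (y - h)" h] by simp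
  let ?F = "\<lambda>(x, y). indicator {u..v} x * (g y * f' (y - x)) :: real"
  let ?K = "(C + L * \<delta>) * (\<integral>y. w y * \<bar>f' y\<bar> \<partial>lborel)"
  have inner: "(\<integral>y. \<bar>g y * f' (y - x)\<bar> \<partial>lborel) \<le> ?K" if "\<bar>x\<bar> \<le> \<delta>" for x
  proof -
    have "(\<integral>y. \<bar>g y * f' (y - x)\<bar> \<partial>lborel) = (\<integral>y. \<bar>g (y + x) * f' y\<bar> \<partial>lborel)"
      using trans[of "\<lambda>y. \<bar>g y * f' (y - x)\<bar>" x] by simp
    also have "\<dots> \<le> (\<integral>y. (C + L * \<delta>) * (w y * \<bar>f' y\<bar>) \<partial>lborel)"
      using g_shift_f'_integrable[OF that] w_f'_integrable g_shift_f'_bound[OF that]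
      by (intro integral_mono) auto
    finally show ?thesis by simp
  qed
  have F: "integrable (lborel \<Otimes>\<^sub>M lborel) ?F"
  proof (rule lborel_pair.Fubini_integrable)
    show "?F \<in> borel_measurable (lborel \<Otimes>\<^sub>M lborel)"
      by (measurable)
    show "AE x in lborel. integrable lborel (\<lambda>y. ?F (x, y))"
      using slopeI assms by (intro AE_I2) (auto simp: indicator_def)
    show "integrable lborel (\<lambda>x. \<integral>y. norm (?F (x, y)) \<partial>lborel)"
    proof (rule Bochner_Integration.integrable_bound)
      show "integrable lborel (\<lambda>x. indicator {u..v} x *\<^sub>R ?K)"
        using assms by simp
      show "AE x in lborel. norm (\<integral>y. norm (?F (x, y)) \<partial>lborel) \<le> norm (indicator {u..v} x *\<^sub>R ?K)"
      proof (rule AE_I2)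
        fix x
        show "norm (\<integral>y. norm (?F (x, y)) \<partial>lborel) \<le> norm (indicator {u..v} x *\<^sub>R ?K)"
          using inner[of x] assms by (auto simp: indicator_def intro: order_trans[OF _ abs_ge_self])
      qed
    qed simp
  qed
  have out: "(\<integral>y. ?F (x, y) \<partial>lborel) = - (indicator {u..v} x * shift_slope x)" for x
    by (simp add: slope)
  show "integrable lborel (\<lambda>x. indicator {u..v} x * shift_slope x)"
    using lborel_pair.integrable_fst'[OF F] unfolding out by simp
  have "shift_mean v - shift_mean u = (\<integral>y. g y * f (y - v) - g y * f (y - u) \<partial>lborel)"
    unfolding shift using shiftI assms by simp
  also have "\<dots> = (\<integral>y. - (\<integral>x. ?F (x, y) \<partial>lborel) \<partial>lborel)"
  proof (intro Bochner_Integration.integral_cong refl)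
    fix y
    have "(\<integral>x. ?F (x, y) \<partial>lborel) = (\<integral>x. g y * (indicator {u..v} x * f' (y - x)) \<partial>lborel)"
      by (simp add: mult.left_commute)
    then show "g y * f (y - v) - g y * f (y - u) = - (\<integral>x. ?F (x, y) \<partial>lborel)"
      using f_increment[OF assms(2), of y] by (simp add: right_diff_distrib[symmetric])
  qed
  also have "\<dots> = - (\<integral>x. (\<integral>y. ?F (x, y) \<partial>lborel) \<partial>lborel)"
    using lborel_pair.Fubini_integral[of "\<lambda>x y. ?F (x, y)"] F by simp
  also have "\<dots> = (\<integral>x. indicator {u..v} x * shift_slope x \<partial>lborel)"
    unfolding out by simp
  finally show "shift_mean v - shift_mean u = (\<integral>x. indicator {u..v} x * shift_slope x \<partial>lborel)" .
qed

lemma shift_slope_lipschitz: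
  assumes "\<bar>h\<bar> \<le> \<delta>"
  shows "\<bar>shift_slope h - shift_slope 0\<bar> \<le> slope_lipschitz * \<bar>h\<bar>"
proof -
  have 0: "\<bar>0\<bar> \<le> \<delta>" using \<delta>_pos by simp
  note int = g_shift_f'_integrable[OF assms] g_shift_f'_integrable[OF 0]
  have "shift_slope h - shift_slope 0 = (\<integral>y. g (y + 0) * f' y - g (y + h) * f' y \<partial>lborel)"
    using int by (simp add: shift_slope_def)
  also have "\<bar>\<dots>\<bar> \<le> (\<integral>y. \<bar>g (y + 0) * f' y - g (y + h) * f' y\<bar> \<partial>lborel)"
    by (rule integral_abs_bound)
  also have "\<dots> \<le> (\<integral>y. L * \<bar>h\<bar> * (w y * \<bar>f' y\<bar>) \<partial>lborel)"
  proof (rule integral_mono)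
    fix y
    have "\<bar>g (y + 0) - g (y + h)\<bar> * \<bar>f' y\<bar> \<le> L * \<bar>0 - h\<bar> * w y * \<bar>f' y\<bar>"
      by (intro mult_right_mono g_lipschitz) (use assms \<delta>_pos in auto)
    then show "\<bar>g (y + 0) * f' y - g (y + h) * f' y\<bar> \<le> L * \<bar>h\<bar> * (w y * \<bar>f' y\<bar>)"
      by (simp add: abs_mult[symmetric] left_diff_distrib mult.assoc)
  qed (use int w_f'_integrable in auto)
  finally show ?thesis by (simp add: slope_lipschitz_def mult_ac)
qed

text \<open>The integral form of the remainder, for a derivative that is Lipschitz. Positive and negative shifts are covered by one estimate on an
  interval with end point \<open>0\<close>.\<close>

lemma shift_mean_expansion:
  assumes "\<bar>h\<bar> \<le> \<delta>"
  shows "\<bar>shift_mean h - shift_mean 0 - shift_slope 0 * h\<bar> \<le> slope_lipschitz * h\<^sup>2"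
proof -
  have *: "\<bar>shift_mean v - shift_mean u - shift_slope 0 * (v - u)\<bar> \<le> slope_lipschitz * m * (v - u)"
    if uv: "- m \<le> u" "u \<le> v" "v \<le> m" and m: "m \<le> \<delta>" for u v m
  proof -
    have c: "(\<integral>x. indicator {u..v} x * c \<partial>lborel) = c * (v - u)"
      "integrable lborel (\<lambda>x. indicator {u..v} x * c)" for c :: real
      using uv by (auto simp: integrable_mult_left_iff)
    have inc: "integrable lborel (\<lambda>x. indicator {u..v} x * shift_slope x)"
      "shift_mean v - shift_mean u = (\<integral>x. indicator {u..v} x * shift_slope x \<partial>lborel)"
      using shift_mean_increment[of u v] uv m by auto
    have "shift_mean v - shift_mean u - shift_slope 0 * (v - u)
        = (\<integral>x. indicator {u..v} x * shift_slope x - indicator {u..v} x * shift_slope 0 \<partial>lborel)"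
      by (subst Bochner_Integration.integral_diff[OF inc(1) c(2)]) (simp only: inc(2) c(1))
    then have "\<bar>shift_mean v - shift_mean u - shift_slope 0 * (v - u)\<bar>
        \<le> (\<integral>x. \<bar>indicator {u..v} x * shift_slope x - indicator {u..v} x * shift_slope 0\<bar> \<partial>lborel)"
      by (simp only: integral_abs_bound)
    also have "\<dots> \<le> (\<integral>x. indicator {u..v} x * (slope_lipschitz * m) \<partial>lborel)"
    proof (rule integral_mono)
      fix x
      have "\<bar>shift_slope x - shift_slope 0\<bar> \<le> slope_lipschitz * m" if "u \<le> x" "x \<le> v"
        using that uv m slope_lipschitz_nonneg
        by (intro order_trans[OF shift_slope_lipschitz] mult_left_mono) auto
      then show "\<bar>indicator {u..v} x * shift_slope x - indicator {u..v} x * shift_slope 0\<bar>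
          \<le> indicator {u..v} x * (slope_lipschitz * m)"
        by (simp add: indicator_def)
    qed (use inc c in auto)
    finally show ?thesis unfolding c by simp
  qed
  show ?thesis
  proof (cases "h \<ge> 0")
    case True
    then show ?thesis using *[of h 0 h] assms by (simp add: power2_eq_square mult.assoc)
  next
    case False
    then show ?thesis using *[of "- h" h 0] assms by (simp add: power2_eq_square mult.assoc abs_minus_commute abs_le_iff)
  qed
qed

text \<open>The average of \<open>g\<close> against a scaled kernel centred at \<open>y\<close>, after rescaling the integration variable.\<close>

definition smoothed :: "real \<Rightarrow> real \<Rightarrow> real" where
  "smoothed \<beta> y = (\<integral>u. g (y + \<beta> * u) * k u \<partial>lborel)"

lemma smoothed_measurable [measurable]: "smoothed \<beta> \<in> borel_measurable borel"
  unfolding smoothed_def by measurable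

lemma abs_scaled_le: "\<bar>u\<bar> \<le> 1 \<Longrightarrow> \<bar>\<beta> * u\<bar> \<le> \<bar>\<beta>\<bar>" for \<beta> u :: real
  using mult_left_mono[of "\<bar>u\<bar>" 1 "\<bar>\<beta>\<bar>"] by (simp add: abs_mult)

lemma kernel_average_bound:
  assumes [measurable]: "F \<in> borel_measurable borel"
    and F: "\<And>u. \<bar>u\<bar> \<le> 1 \<Longrightarrow> \<bar>F u\<bar> \<le> B"
  shows "integrable lborel (\<lambda>u. F u * k u)" and "\<bar>\<integral>u. F u * k u \<partial>lborel\<bar> \<le> B"
proof -
  have le: "\<bar>F u * k u\<bar> \<le> B * k u" for u
    using F[of u] k_support[of u] k_nonneg[of u]
    by (cases "\<bar>u\<bar> \<le> 1") (auto simp: abs_mult intro: mult_right_mono)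
  show int: "integrable lborel (\<lambda>u. F u * k u)"
  proof (rule Bochner_Integration.integrable_bound)
    show "integrable lborel (\<lambda>u. B * k u)" using k_integrable by simp
    show "AE u in lborel. norm (F u * k u) \<le> norm (B * k u)"
      using le by (intro AE_I2) (metis abs_ge_self order_trans real_norm_def)
  qed simp
  have "\<bar>\<integral>u. F u * k u \<partial>lborel\<bar> \<le> (\<integral>u. \<bar>F u * k u\<bar> \<partial>lborel)"
    by (rule integral_abs_bound)
  also have "\<dots> \<le> (\<integral>u. B * k u \<partial>lborel)"
    using int k_integrable le by (intro integral_mono) auto
  finally show "\<bar>\<integral>u. F u * k u \<partial>lborel\<bar> \<le> B" by (simp add: k_integral)
qed

lemma kernel_mean_zero:
  "integrable lborel (\<lambda>u. u * k u)" "(\<integral>u. u * k u \<partial>lborel) = 0"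
proof -
  show "integrable lborel (\<lambda>u. u * k u)"
    by (rule kernel_average_bound[of "\<lambda>u. u" 1]) auto
  have "(\<integral>u. u * k u \<partial>lborel) = (\<integral>u. - (u * k u) \<partial>lborel)"
    by (subst lborel_integral_real_affine[of "-1" _ 0]) (auto simp: k_even)
  then show "(\<integral>u. u * k u \<partial>lborel) = 0" by simp
qed

lemma smoothed_integrable:
  assumes "\<bar>h\<bar> + \<bar>\<beta>\<bar> \<le> \<delta>"
  shows "integrable lborel (\<lambda>u. g (y + h + \<beta> * u) * k u)"
proof (rule kernel_average_bound)
  show "\<bar>g (y + h + \<beta> * u)\<bar> \<le> (C + L * \<delta>) * w y" if "\<bar>u\<bar> \<le> 1" for u
    using g_shift_bound[of "h + \<beta> * u" y] abs_scaled_le[OF that, of \<beta>] assms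
    by (simp add: add.assoc)
qed simp

lemma smoothed_lipschitz:
  assumes "\<bar>h\<bar> + \<bar>\<beta>\<bar> \<le> \<delta>" "\<bar>h'\<bar> + \<bar>\<beta>\<bar> \<le> \<delta>"
  shows "\<bar>smoothed \<beta> (y + h) - smoothed \<beta> (y + h')\<bar> \<le> L * \<bar>h - h'\<bar> * w y"
proof -
  have "smoothed \<beta> (y + h) - smoothed \<beta> (y + h')
      = (\<integral>u. (g (y + h + \<beta> * u) - g (y + h' + \<beta> * u)) * k u \<partial>lborel)"
    unfolding smoothed_def left_diff_distrib
    using smoothed_integrable[OF assms(1)] smoothed_integrable[OF assms(2)] by simp
  also have "\<bar>\<dots>\<bar> \<le> L * \<bar>h - h'\<bar> * w y"
  proof (rule kernel_average_bound)
    show "\<bar>g (y + h + \<beta> * u) - g (y + h' + \<beta> * u)\<bar> \<le> L * \<bar>h - h'\<bar> * w y" if "\<bar>u\<bar> \<le> 1" for u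
      using g_lipschitz[of "h + \<beta> * u" "h' + \<beta> * u" y] abs_scaled_le[OF that, of \<beta>] assms
      by (simp add: add.assoc)
  qed simp
  finally show ?thesis .
qed

lemma smoothed_minus_le:
  assumes "\<bar>h\<bar> + \<bar>\<beta>\<bar> \<le> \<delta>"
  shows "\<bar>smoothed \<beta> (y + h) - g y\<bar> \<le> L * (\<bar>h\<bar> + \<bar>\<beta>\<bar>) * w y"
proof -
  have "smoothed \<beta> (y + h) - g y = (\<integral>u. (g (y + h + \<beta> * u) - g y) * k u \<partial>lborel)"
    unfolding smoothed_def left_diff_distrib
    using smoothed_integrable[OF assms] k_integrable by (simp add: k_integral)
  also have "\<bar>\<dots>\<bar> \<le> L * (\<bar>h\<bar> + \<bar>\<beta>\<bar>) * w y"
  proof (rule kernel_average_bound)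
    fix u :: real assume u: "\<bar>u\<bar> \<le> 1"
    have "\<bar>g (y + (h + \<beta> * u)) - g (y + 0)\<bar> \<le> L * \<bar>h + \<beta> * u - 0\<bar> * w y"
      using abs_scaled_le[OF u, of \<beta>] assms \<delta>_pos by (intro g_lipschitz) auto
    also have "\<dots> \<le> L * (\<bar>h\<bar> + \<bar>\<beta>\<bar>) * w y"
      using abs_scaled_le[OF u, of \<beta>] L_nonneg w_ge_1[of y]
      by (intro mult_right_mono mult_left_mono) auto
    finally show "\<bar>g (y + h + \<beta> * u) - g y\<bar> \<le> L * (\<bar>h\<bar> + \<bar>\<beta>\<bar>) * w y"
      by (simp add: add.assoc)
  qed simp
  finally show ?thesis .
qed

text \<open>By Fubini the left-hand mean is a kernel average of shifted means. The terms linear in \<open>u\<close> cancel because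
  the kernel is even, so the bandwidth enters only quadratically.\<close>

lemma smoothed_mean_expansion:
  assumes "\<bar>h\<bar> + \<bar>\<beta>\<bar> \<le> \<delta>"
  shows "\<bar>(\<integral>y. smoothed \<beta> (y + h) * f y \<partial>lborel) - shift_mean 0 - shift_slope 0 * h\<bar>
      \<le> slope_lipschitz * (\<bar>h\<bar> + \<bar>\<beta>\<bar>)\<^sup>2"
proof -
  have [measurable]: "shift_mean \<in> borel_measurable borel"
    unfolding shift_mean_def[abs_def] by measurable
  let ?F = "\<lambda>(y, u). g (y + h + \<beta> * u) * k u * f y"
  have F: "integrable (lborel \<Otimes>\<^sub>M lborel) ?F"
  proof (rule lborel_pair.Fubini_integrable)
    show "?F \<in> borel_measurable (lborel \<Otimes>\<^sub>M lborel)" by measurable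
    show "AE y in lborel. integrable lborel (\<lambda>u. ?F (y, u))"
      using smoothed_integrable[OF assms] by (intro AE_I2) simp
    show "integrable lborel (\<lambda>y. \<integral>u. norm (?F (y, u)) \<partial>lborel)"
    proof (rule Bochner_Integration.integrable_bound)
      show "integrable lborel (\<lambda>y. (C + L * \<delta>) * (w y * f y))"
        using w_f_integrable by simp
      show "AE y in lborel. norm (\<integral>u. norm (?F (y, u)) \<partial>lborel) \<le> norm ((C + L * \<delta>) * (w y * f y))"
      proof (rule AE_I2)
        fix y
        have "(\<integral>u. norm (?F (y, u)) \<partial>lborel) = (\<integral>u. \<bar>g (y + h + \<beta> * u)\<bar> * k u * f y \<partial>lborel)"
          using f_pos[of y] k_nonneg by (simp add: abs_mult)
        also have "\<dots> = (\<integral>u. \<bar>g (y + h + \<beta> * u)\<bar> * k u \<partial>lborel) * f y"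
          by simp
        also have "\<bar>\<dots>\<bar> \<le> ((C + L * \<delta>) * w y) * f y"
          unfolding abs_mult
        proof (intro mult_mono kernel_average_bound)
          show "\<bar>\<bar>g (y + h + \<beta> * u)\<bar>\<bar> \<le> (C + L * \<delta>) * w y" if "\<bar>u\<bar> \<le> 1" for u
            using g_shift_bound[of "h + \<beta> * u" y] abs_scaled_le[OF that, of \<beta>] assms
            by (simp add: add.assoc)
          show "0 \<le> (C + L * \<delta>) * w y"
            using C_nonneg L_nonneg \<delta>_pos w_ge_1[of y] by simp
        qed (use f_pos[of y] in auto)
        finally show "norm (\<integral>u. norm (?F (y, u)) \<partial>lborel) \<le> norm ((C + L * \<delta>) * (w y * f y))"
          by (simp add: mult.assoc)
      qed
    qed simp
  qed
  have "(\<integral>y. smoothed \<beta> (y + h) * f y \<partial>lborel) = (\<integral>y. (\<integral>u. ?F (y, u) \<partial>lborel) \<partial>lborel)"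
    by (simp add: smoothed_def)
  also have "\<dots> = (\<integral>u. (\<integral>y. ?F (y, u) \<partial>lborel) \<partial>lborel)"
    using lborel_pair.Fubini_integral[of "\<lambda>y u. ?F (y, u)"] F by simp
  also have "\<dots> = (\<integral>u. shift_mean (h + \<beta> * u) * k u \<partial>lborel)"
  proof (intro Bochner_Integration.integral_cong refl)
    fix u
    have "(\<integral>y. ?F (y, u) \<partial>lborel) = (\<integral>y. g (y + (h + \<beta> * u)) * f y * k u \<partial>lborel)"
      by (intro Bochner_Integration.integral_cong) (auto simp: add.assoc)
    then show "(\<integral>y. ?F (y, u) \<partial>lborel) = shift_mean (h + \<beta> * u) * k u"
      by (simp add: shift_mean_def)
  qed
  finally have eq: "(\<integral>y. smoothed \<beta> (y + h) * f y \<partial>lborel)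
      = (\<integral>u. shift_mean (h + \<beta> * u) * k u \<partial>lborel)" .
  let ?R = "\<lambda>u. shift_mean (h + \<beta> * u) - shift_mean 0 - shift_slope 0 * (h + \<beta> * u)"
  have R: "\<bar>?R u\<bar> \<le> slope_lipschitz * (\<bar>h\<bar> + \<bar>\<beta>\<bar>)\<^sup>2" if "\<bar>u\<bar> \<le> 1" for u
  proof -
    have le: "\<bar>h + \<beta> * u\<bar> \<le> \<bar>h\<bar> + \<bar>\<beta>\<bar>"
      using abs_scaled_le[OF that, of \<beta>] by linarith
    then have "\<bar>?R u\<bar> \<le> slope_lipschitz * (h + \<beta> * u)\<^sup>2"
      using assms by (intro shift_mean_expansion) auto
    also have "\<dots> \<le> slope_lipschitz * (\<bar>h\<bar> + \<bar>\<beta>\<bar>)\<^sup>2"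
      using le slope_lipschitz_nonneg by (intro mult_left_mono) (auto simp: abs_le_square_iff[symmetric])
    finally show ?thesis .
  qed
  note R_int = kernel_average_bound[of ?R, OF _ R]
  have "(\<integral>u. shift_mean (h + \<beta> * u) * k u \<partial>lborel)
      = (\<integral>u. ?R u * k u + (shift_mean 0 + shift_slope 0 * h) * k u + shift_slope 0 * \<beta> * (u * k u) \<partial>lborel)"
    by (intro Bochner_Integration.integral_cong) (auto simp: algebra_simps)
  also have "\<dots> = (\<integral>u. ?R u * k u \<partial>lborel) + (shift_mean 0 + shift_slope 0 * h)"
    using R_int(1) k_integrable kernel_mean_zero by (simp add: k_integral)
  finally show ?thesis
    using R_int(2) eq by simp
qed

end

section \<open>Empirical likelihood multipliers\<close>

definition sample_mean :: "nat \<Rightarrow> (int \<Rightarrow> real) \<Rightarrow> real" where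
  "sample_mean n u = (1 / real n) * (\<Sum>i=1..int n. u i)"

lemma sum_int_interval: "(\<Sum>i=1..int n. F i) = (\<Sum>i<n. F (int i + 1))"
  by (rule sum.reindex_bij_witness[of _ "\<lambda>i. int i + 1" "\<lambda>i. nat (i - 1)"]) auto

lemma sample_mean_cong: "(\<And>i. i \<in> {1..int n} \<Longrightarrow> u i = v i) \<Longrightarrow> sample_mean n u = sample_mean n v"
  unfolding sample_mean_def by (metis (no_types, lifting) sum.cong)

lemma sample_mean_add: "sample_mean n (\<lambda>i. u i + v i) = sample_mean n u + sample_mean n v"
  unfolding sample_mean_def by (simp add: sum.distrib distrib_left)

lemma sample_mean_diff: "sample_mean n (\<lambda>i. u i - v i) = sample_mean n u - sample_mean n v"
  unfolding sample_mean_def by (simp add: sum_subtractf right_diff_distrib)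

lemma sample_mean_cmult: "sample_mean n (\<lambda>i. c * u i) = c * sample_mean n u"
  unfolding sample_mean_def by (simp add: sum_distrib_left mult_ac)

lemma sample_mean_const: "n > 0 \<Longrightarrow> sample_mean n (\<lambda>i. c) = c"
  unfolding sample_mean_def by simp

lemma sample_mean_mono:
  "(\<And>i. i \<in> {1..int n} \<Longrightarrow> u i \<le> v i) \<Longrightarrow> sample_mean n u \<le> sample_mean n v"
  unfolding sample_mean_def by (intro mult_left_mono sum_mono) auto

lemma sample_mean_nonneg: "(\<And>i. i \<in> {1..int n} \<Longrightarrow> 0 \<le> u i) \<Longrightarrow> 0 \<le> sample_mean n u"
  unfolding sample_mean_def by (intro mult_nonneg_nonneg sum_nonneg) auto

lemma abs_sample_mean_le: "\<bar>sample_mean n u\<bar> \<le> sample_mean n (\<lambda>i. \<bar>u i\<bar>)"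
  unfolding sample_mean_def abs_mult by (intro mult_mono) auto

lemma sample_mean_Cauchy_Schwarz:
  "sample_mean n (\<lambda>i. \<bar>u i * v i\<bar>)
     \<le> sqrt (sample_mean n (\<lambda>i. (u i)\<^sup>2)) * sqrt (sample_mean n (\<lambda>i. (v i)\<^sup>2))"
proof -
  have "(\<Sum>i=1..int n. \<bar>u i\<bar> * \<bar>v i\<bar>)\<^sup>2 \<le> (\<Sum>i=1..int n. \<bar>u i\<bar>\<^sup>2) * (\<Sum>i=1..int n. \<bar>v i\<bar>\<^sup>2)"
    by (rule Cauchy_Schwarz_ineq_sum)
  then have "(sample_mean n (\<lambda>i. \<bar>u i * v i\<bar>))\<^sup>2
      \<le> sample_mean n (\<lambda>i. (u i)\<^sup>2) * sample_mean n (\<lambda>i. (v i)\<^sup>2)"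
    unfolding sample_mean_def
    by (simp add: power_mult_distrib abs_mult power_divide divide_right_mono power2_eq_square[of "real n"])
  then show ?thesis
    by (simp add: real_le_rsqrt real_sqrt_mult[symmetric])
qed

text \<open>The product of the factors \<open>1 + l \<cdot> e i\<close> vanishes at both ends of the interval on which they are all positive and is \<open>1\<close> at
  \<open>l = 0\<close>, so it has an interior maximum. The derivative of its logarithm vanishes there, which is the
  equation for the multiplier.\<close>

lemma admissible_multiplier_exists:
  assumes neg: "i \<in> {1..int n}" "e i < 0" and pos: "j \<in> {1..int n}" "e j > 0"
  shows "\<exists>l. admissible_multiplier n e l"
proof -
  let ?I = "{1..int n}"
  define hi where "hi = Max (e ` ?I)"
  define lo where "lo = Min (e ` ?I)"
  have hi: "hi \<in> e ` ?I" "\<And>m. m \<in> ?I \<Longrightarrow> e m \<le> hi" and lo: "lo \<in> e ` ?I" "\<And>m. m \<in> ?I \<Longrightarrow> lo \<le> e m"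
    unfolding hi_def lo_def using neg(1) by (intro Max_in Min_in Max_ge Min_le; force)+
  have sgn: "lo < 0" "hi > 0"
    using hi(2)[OF pos(1)] lo(2)[OF neg(1)] neg pos by auto
  define l1 where "l1 = - 1 / hi"
  define l2 where "l2 = - 1 / lo"
  have l12: "l1 < 0" "0 < l2" using sgn by (auto simp: l1_def l2_def field_simps)
  have fac: "1 + l * e m > 0" if "l1 < l" "l < l2" "m \<in> ?I" for l m
  proof (cases "l \<ge> 0")
    case True
    have "1 + l * lo > 0" using that(2) sgn by (simp add: l2_def field_simps)
    moreover have "l * lo \<le> l * e m" using True lo(2)[OF that(3)] by (rule mult_left_mono[rotated])
    ultimately show ?thesis by linarith
  next
    case False
    have "1 + l * hi > 0" using that(1) sgn by (simp add: l1_def field_simps)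
    moreover have "l * hi \<le> l * e m" using False hi(2)[OF that(3)] by (intro mult_left_mono_neg) auto
    ultimately show ?thesis by linarith
  qed
  define p where "p l = (\<Prod>m\<in>?I. 1 + l * e m)" for l
  have "continuous_on {l1..l2} p" unfolding p_def by (intro continuous_intros)
  then obtain l0 where l0: "l0 \<in> {l1..l2}" "\<And>l. l \<in> {l1..l2} \<Longrightarrow> p l \<le> p l0"
    using continuous_attains_sup[of "{l1..l2}" p] l12 by force
  have "p l0 \<ge> 1" using l0(2)[of 0] l12 by (simp add: p_def)
  moreover have "p l1 = 0" "p l2 = 0"
    using hi(1) lo(1) sgn unfolding p_def l1_def l2_def by (auto simp: prod_zero_iff)
  ultimately have l0': "l1 < l0" "l0 < l2"
    using l0(1) by (auto simp: less_le)
  define s where "s l = (\<Sum>m\<in>?I. ln (1 + l * e m))" for l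
  have sp: "s l = ln (p l)" "p l > 0" if "l1 < l" "l < l2" for l
    unfolding s_def p_def
    by (subst ln_prod) (use fac[OF that] in \<open>force intro: prod_pos\<close>)+
  have "(s has_real_derivative (\<Sum>m\<in>?I. e m / (1 + l0 * e m))) (at l0)"
    unfolding s_def using fac[OF l0'] by (auto intro!: derivative_eq_intros sum.cong simp: field_simps)
  moreover have "\<forall>l. \<bar>l0 - l\<bar> < min (l0 - l1) (l2 - l0) \<longrightarrow> s l \<le> s l0"
  proof (intro allI impI)
    fix l assume "\<bar>l0 - l\<bar> < min (l0 - l1) (l2 - l0)"
    then have l: "l1 < l" "l < l2" by auto
    then show "s l \<le> s l0"
      using sp[OF l] sp[OF l0'] l0(2)[of l] by simp
  qed
  ultimately have "(\<Sum>m\<in>?I. e m / (1 + l0 * e m)) = 0"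
    using l0' by (intro DERIV_local_max[of s _ l0 "min (l0 - l1) (l2 - l0)"]) auto
  then show ?thesis
    unfolding admissible_multiplier_def using fac[OF l0'] by (intro exI[of _ l0]) auto
qed

text \<open>Residuals of one sign only would have a mean square of at most \<open>Z\<close> times the absolute value of their mean.\<close>

lemma multiplier_exists_if_mean_small:
  assumes "n > 0" and Z: "\<And>i. i \<in> {1..int n} \<Longrightarrow> \<bar>e i\<bar> \<le> Z"
    and small: "Z * \<bar>sample_mean n e\<bar> < sample_mean n (\<lambda>i. (e i)\<^sup>2)"
  shows "\<exists>l. admissible_multiplier n e l"
proof -
  have Z0: "Z \<ge> 0" using Z[of 1] \<open>n > 0\<close> by auto
  have no: False if "c = 1 \<or> c = -1" and sign: "\<And>i. i \<in> {1..int n} \<Longrightarrow> c * e i \<ge> 0" for c :: real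
  proof -
    have "sample_mean n (\<lambda>i. (e i)\<^sup>2) \<le> sample_mean n (\<lambda>i. Z * c * e i)"
    proof (rule sample_mean_mono)
      fix i assume i: "i \<in> {1..int n}"
      have "(e i)\<^sup>2 = \<bar>e i\<bar> * (c * e i)"
        using that(1) sign[OF i] by (auto simp: power2_eq_square)
      also have "\<dots> \<le> Z * (c * e i)" using Z[OF i] sign[OF i] by (rule mult_right_mono)
      finally show "(e i)\<^sup>2 \<le> Z * c * e i" by (simp add: mult.assoc)
    qed
    also have "\<dots> = Z * (c * sample_mean n e)" by (simp add: sample_mean_cmult mult.assoc)
    also have "\<dots> \<le> Z * \<bar>sample_mean n e\<bar>"
      using that(1) Z0 by (intro mult_left_mono) auto
    finally show False using small by simp
  qed
  obtain i where "i \<in> {1..int n}" "e i < 0" using no[of 1] by force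
  moreover obtain j where "j \<in> {1..int n}" "e j > 0" using no[of "-1"] by force
  ultimately show ?thesis by (rule admissible_multiplier_exists)
qed

lemma multiplier_equation:
  assumes "admissible_multiplier n e l"
  shows "l * sample_mean n (\<lambda>i. (e i)\<^sup>2 / (1 + l * e i)) = sample_mean n e"
proof -
  have pos: "1 + l * e i > 0" if "i \<in> {1..int n}" for i
    using assms that by (auto simp: admissible_multiplier_def)
  have "sample_mean n (\<lambda>i. e i - l * ((e i)\<^sup>2 / (1 + l * e i))) = sample_mean n (\<lambda>i. 1 / (1 + l * e i) * e i)"
  proof (rule sample_mean_cong)
    fix i assume "i \<in> {1..int n}"
    then have "1 + l * e i \<noteq> 0" using pos[of i] by simp
    then show "e i - l * ((e i)\<^sup>2 / (1 + l * e i)) = 1 / (1 + l * e i) * e i"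
      by (simp add: divide_simps power2_eq_square) (simp add: algebra_simps)
  qed
  also have "\<dots> = 0" using assms by (simp add: admissible_multiplier_def sample_mean_def)
  finally show ?thesis unfolding sample_mean_diff sample_mean_cmult by simp
qed

text \<open>Owen's bound: bounding each denominator by \<open>1 + |l| Z\<close> in the equation for the multiplier gives an inequality
  that is linear in \<open>|l|\<close>.\<close>

lemma multiplier_bound:
  assumes "n > 0" and l: "admissible_multiplier n e l"
    and Z: "\<And>i. i \<in> {1..int n} \<Longrightarrow> \<bar>e i\<bar> \<le> Z"
  shows "\<bar>l\<bar> * (sample_mean n (\<lambda>i. (e i)\<^sup>2) - Z * \<bar>sample_mean n e\<bar>) \<le> \<bar>sample_mean n e\<bar>"
proof -
  have Z0: "Z \<ge> 0" using Z[of 1] \<open>n > 0\<close> by auto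
  let ?D = "sample_mean n (\<lambda>i. (e i)\<^sup>2 / (1 + l * e i))"
  have "sample_mean n (\<lambda>i. (e i)\<^sup>2) \<le> sample_mean n (\<lambda>i. (1 + \<bar>l\<bar> * Z) * ((e i)\<^sup>2 / (1 + l * e i)))"
  proof (rule sample_mean_mono)
    fix i assume i: "i \<in> {1..int n}"
    have pos: "1 + l * e i > 0" using l i by (auto simp: admissible_multiplier_def)
    have "l * e i \<le> \<bar>l\<bar> * \<bar>e i\<bar>" by (metis abs_ge_self abs_mult)
    also have "\<dots> \<le> \<bar>l\<bar> * Z" using Z[OF i] by (intro mult_left_mono) auto
    finally have "(e i)\<^sup>2 * (1 + l * e i) \<le> (e i)\<^sup>2 * (1 + \<bar>l\<bar> * Z)"
      by (intro mult_left_mono) auto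
    then show "(e i)\<^sup>2 \<le> (1 + \<bar>l\<bar> * Z) * ((e i)\<^sup>2 / (1 + l * e i))"
      using pos by (simp add: pos_le_divide_eq mult.commute)
  qed
  also have "\<dots> = (1 + \<bar>l\<bar> * Z) * ?D" by (rule sample_mean_cmult)
  finally have "\<bar>l\<bar> * sample_mean n (\<lambda>i. (e i)\<^sup>2) \<le> \<bar>l\<bar> * ((1 + \<bar>l\<bar> * Z) * ?D)"
    by (intro mult_left_mono) auto
  also have "\<dots> = (1 + \<bar>l\<bar> * Z) * (\<bar>l\<bar> * ?D)" by simp
  also have "\<bar>l\<bar> * ?D = \<bar>sample_mean n e\<bar>"
  proof -
    have "?D \<ge> 0" using l by (intro sample_mean_nonneg) (force simp: admissible_multiplier_def less_imp_le)
    then show ?thesis using multiplier_equation[OF l] by (metis abs_mult abs_of_nonneg)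
  qed
  finally show ?thesis by (simp add: algebra_simps)
qed

lemma multiplier_factor_ge_half:
  fixes e l Z :: real
  assumes "\<bar>e\<bar> \<le> Z" "\<bar>l\<bar> * Z \<le> 1 / 2"
  shows "1 + l * e \<ge> 1 / 2"
proof -
  have "\<bar>l * e\<bar> \<le> \<bar>l\<bar> * Z" unfolding abs_mult using assms(1) by (intro mult_left_mono) auto
  then show ?thesis using assms(2) by linarith
qed

lemma multiplier_expansion:
  assumes l: "admissible_multiplier n e l"
    and Z: "\<And>i. i \<in> {1..int n} \<Longrightarrow> \<bar>e i\<bar> \<le> Z" and lZ: "\<bar>l\<bar> * Z \<le> 1 / 2"
  shows "\<bar>l * sample_mean n (\<lambda>i. (e i)\<^sup>2) - sample_mean n e\<bar> \<le> 2 * l\<^sup>2 * Z * sample_mean n (\<lambda>i. (e i)\<^sup>2)"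
proof -
  have "l * sample_mean n (\<lambda>i. (e i)\<^sup>2) - sample_mean n e
      = l * sample_mean n (\<lambda>i. (e i)\<^sup>2 - (e i)\<^sup>2 / (1 + l * e i))"
    by (simp add: multiplier_equation[OF l, symmetric] sample_mean_diff right_diff_distrib)
  also have "\<bar>\<dots>\<bar> \<le> \<bar>l\<bar> * sample_mean n (\<lambda>i. \<bar>(e i)\<^sup>2 - (e i)\<^sup>2 / (1 + l * e i)\<bar>)"
    unfolding abs_mult by (intro mult_left_mono abs_sample_mean_le) auto
  also have "\<dots> \<le> \<bar>l\<bar> * sample_mean n (\<lambda>i. 2 * (\<bar>l\<bar> * Z) * (e i)\<^sup>2)"
  proof (intro mult_left_mono sample_mean_mono)
    fix i assume i: "i \<in> {1..int n}"
    have h: "1 + l * e i \<ge> 1 / 2" by (rule multiplier_factor_ge_half[OF Z[OF i] lZ])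
    have "(e i)\<^sup>2 - (e i)\<^sup>2 / (1 + l * e i) = (e i)\<^sup>2 * (l * e i / (1 + l * e i))"
      using h by (simp add: field_simps)
    also have "\<bar>\<dots>\<bar> = (e i)\<^sup>2 * (\<bar>l * e i\<bar> / (1 + l * e i))"
      using h by (simp add: abs_mult)
    also have "\<dots> \<le> (e i)\<^sup>2 * (\<bar>l * e i\<bar> / (1 / 2))"
      using h by (intro mult_left_mono divide_left_mono) auto
    also have "\<dots> \<le> (e i)\<^sup>2 * (\<bar>l\<bar> * Z / (1 / 2))"
      unfolding abs_mult using Z[OF i] by (intro mult_left_mono divide_right_mono) auto
    finally show "\<bar>(e i)\<^sup>2 - (e i)\<^sup>2 / (1 + l * e i)\<bar> \<le> 2 * (\<bar>l\<bar> * Z) * (e i)\<^sup>2"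
      by (simp add: mult_ac)
  qed auto
  also have "\<dots> = 2 * l\<^sup>2 * Z * sample_mean n (\<lambda>i. (e i)\<^sup>2)"
    unfolding sample_mean_cmult power2_abs[of l, symmetric] by (simp add: power2_eq_square)
  finally show ?thesis .
qed

lemma weighted_mean_expansion:
  assumes Z: "\<And>i. i \<in> {1..int n} \<Longrightarrow> \<bar>e i\<bar> \<le> Z" and lZ: "\<bar>l\<bar> * Z \<le> 1 / 2"
  shows "\<bar>sample_mean n (\<lambda>i. 1 / (1 + l * e i) * G i) - (sample_mean n G - l * sample_mean n (\<lambda>i. e i * G i))\<bar>
    \<le> 2 * l\<^sup>2 * Z * sample_mean n (\<lambda>i. \<bar>e i * G i\<bar>)"
proof -
  have "sample_mean n (\<lambda>i. 1 / (1 + l * e i) * G i) - (sample_mean n G - l * sample_mean n (\<lambda>i. e i * G i))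
      = sample_mean n (\<lambda>i. 1 / (1 + l * e i) * G i - (G i - l * (e i * G i)))"
    by (simp add: sample_mean_diff sample_mean_cmult)
  then have "\<bar>sample_mean n (\<lambda>i. 1 / (1 + l * e i) * G i) - (sample_mean n G - l * sample_mean n (\<lambda>i. e i * G i))\<bar>
      \<le> sample_mean n (\<lambda>i. \<bar>1 / (1 + l * e i) * G i - (G i - l * (e i * G i))\<bar>)"
    by (simp only: abs_sample_mean_le)
  also have "\<dots> \<le> sample_mean n (\<lambda>i. 2 * l\<^sup>2 * Z * \<bar>e i * G i\<bar>)"
  proof (intro sample_mean_mono)
    fix i assume i: "i \<in> {1..int n}"
    have h: "1 + l * e i \<ge> 1 / 2" by (rule multiplier_factor_ge_half[OF Z[OF i] lZ])
    have "1 / (1 + l * e i) * G i - (G i - l * (e i * G i)) = l\<^sup>2 * e i * (e i * G i) / (1 + l * e i)"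
      using h by (simp add: field_simps power2_eq_square)
    also have "\<bar>\<dots>\<bar> = l\<^sup>2 * \<bar>e i\<bar> * \<bar>e i * G i\<bar> / (1 + l * e i)"
      using h by (simp add: abs_mult)
    also have "\<dots> \<le> l\<^sup>2 * \<bar>e i\<bar> * \<bar>e i * G i\<bar> / (1 / 2)"
      using h by (intro divide_left_mono) auto
    also have "\<dots> \<le> l\<^sup>2 * Z * \<bar>e i * G i\<bar> / (1 / 2)"
      using Z[OF i] by (intro divide_right_mono mult_right_mono mult_left_mono) auto
    finally show "\<bar>1 / (1 + l * e i) * G i - (G i - l * (e i * G i))\<bar> \<le> 2 * l\<^sup>2 * Z * \<bar>e i * G i\<bar>"
      by simp
  qed
  also have "\<dots> = 2 * l\<^sup>2 * Z * sample_mean n (\<lambda>i. \<bar>e i * G i\<bar>)" by (rule sample_mean_cmult)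
  finally show ?thesis .
qed

section \<open>Independence and ergodic averages in the autoregressive model\<close>

text \<open>Independence of two random variables with values in spaces of different types, expressed through the
  product of their laws; for equal types it is the usual notion.\<close>

definition (in prob_space) indep_pair ::
  "'b measure \<Rightarrow> ('a \<Rightarrow> 'b) \<Rightarrow> 'c measure \<Rightarrow> ('a \<Rightarrow> 'c) \<Rightarrow> bool" where
  "indep_pair S X T Y \<longleftrightarrow> X \<in> measurable M S \<and> Y \<in> measurable M T \<and>
     distr M S X \<Otimes>\<^sub>M distr M T Y = distr M (S \<Otimes>\<^sub>M T) (\<lambda>\<omega>. (X \<omega>, Y \<omega>))"

lemma (in prob_space) indep_pair_iff_indep_var: "indep_pair S X T Y \<longleftrightarrow> indep_var S X T Y"
  unfolding indep_pair_def indep_var_distribution_eq ..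

lemma (in prob_space) indep_pair_compose:
  assumes ind: "indep_pair S X T Y" and F: "F \<in> measurable S S'" and G: "G \<in> measurable T T'"
  shows "indep_pair S' (\<lambda>\<omega>. F (X \<omega>)) T' (\<lambda>\<omega>. G (Y \<omega>))"
proof -
  note F [measurable] G [measurable]
  have [measurable]: "X \<in> measurable M S" "Y \<in> measurable M T"
    using ind by (auto simp: indep_pair_def)
  interpret DY: prob_space "distr M T' (\<lambda>\<omega>. G (Y \<omega>))" by (rule prob_space_distr) simp
  have "distr M S' (\<lambda>\<omega>. F (X \<omega>)) = distr (distr M S X) S' F"
    "distr M T' (\<lambda>\<omega>. G (Y \<omega>)) = distr (distr M T Y) T' G"
    by (simp_all add: distr_distr comp_def)
  then have "distr M S' (\<lambda>\<omega>. F (X \<omega>)) \<Otimes>\<^sub>M distr M T' (\<lambda>\<omega>. G (Y \<omega>))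
      = distr (distr M S X \<Otimes>\<^sub>M distr M T Y) (S' \<Otimes>\<^sub>M T') (\<lambda>(x, y). (F x, G y))"
    using DY.sigma_finite_measure_axioms by (simp add: pair_measure_distr)
  also have "\<dots> = distr M (S' \<Otimes>\<^sub>M T') (\<lambda>\<omega>. (F (X \<omega>), G (Y \<omega>)))"
    using ind by (simp add: indep_pair_def distr_distr comp_def)
  finally show ?thesis
    by (simp add: indep_pair_def)
qed

lemma (in prob_space) indep_pair_cong_AE:
  assumes ind: "indep_pair S X T Y" and X': "X' \<in> measurable M S" and eq: "AE \<omega> in M. X \<omega> = X' \<omega>"
  shows "indep_pair S X' T Y"
proof -
  have rv [measurable]: "X \<in> measurable M S" "Y \<in> measurable M T"
    using ind by (auto simp: indep_pair_def)
  note X' [measurable]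
  have "distr M S X' = distr M S X"
    using eq by (intro distr_cong_AE) auto
  moreover have "distr M (S \<Otimes>\<^sub>M T) (\<lambda>\<omega>. (X' \<omega>, Y \<omega>)) = distr M (S \<Otimes>\<^sub>M T) (\<lambda>\<omega>. (X \<omega>, Y \<omega>))"
    using eq by (intro distr_cong_AE) auto
  ultimately show ?thesis
    using ind rv X' unfolding indep_pair_def by simp
qed

text \<open>Together the hypotheses say that \<open>W\<close>, \<open>Y1\<close>, \<open>Y2\<close> are mutually independent. The law of the triple is computed by
  integrating over \<open>w\<close> the product measure of a slice.\<close>

lemma (in prob_space) indep_pair_assoc:
  assumes ind: "indep_pair S W (T1 \<Otimes>\<^sub>M T2) (\<lambda>\<omega>. (Y1 \<omega>, Y2 \<omega>))" and ind12: "indep_pair T1 Y1 T2 Y2"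
  shows "indep_pair (S \<Otimes>\<^sub>M T1) (\<lambda>\<omega>. (W \<omega>, Y1 \<omega>)) T2 Y2"
proof -
  have rv [measurable]: "W \<in> measurable M S" "Y1 \<in> measurable M T1" "Y2 \<in> measurable M T2"
    using ind ind12 by (auto simp: indep_pair_def)
  have indW: "indep_pair S W T1 Y1"
    using indep_pair_compose[OF ind measurable_ident measurable_fst] by simp
  let ?DW = "distr M S W" and ?D1 = "distr M T1 Y1" and ?D2 = "distr M T2 Y2"
  interpret DW: prob_space ?DW by (rule prob_space_distr) simp
  interpret D1: prob_space ?D1 by (rule prob_space_distr) simp
  interpret D2: prob_space ?D2 by (rule prob_space_distr) simp
  interpret D12: pair_prob_space ?D1 ?D2 ..
  interpret DW1: prob_space "distr M (S \<Otimes>\<^sub>M T1) (\<lambda>\<omega>. (W \<omega>, Y1 \<omega>))"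
    by (rule prob_space_distr) simp
  have D12: "distr M (T1 \<Otimes>\<^sub>M T2) (\<lambda>\<omega>. (Y1 \<omega>, Y2 \<omega>)) = ?D1 \<Otimes>\<^sub>M ?D2"
    using ind12 unfolding indep_pair_def by simp
  have DW12: "distr M (S \<Otimes>\<^sub>M (T1 \<Otimes>\<^sub>M T2)) (\<lambda>\<omega>. (W \<omega>, Y1 \<omega>, Y2 \<omega>)) = ?DW \<Otimes>\<^sub>M (?D1 \<Otimes>\<^sub>M ?D2)"
    using ind unfolding indep_pair_def D12 by simp
  have DW1: "distr M (S \<Otimes>\<^sub>M T1) (\<lambda>\<omega>. (W \<omega>, Y1 \<omega>)) = ?DW \<Otimes>\<^sub>M ?D1"
    using indW unfolding indep_pair_def by simp
  have "distr M (S \<Otimes>\<^sub>M T1) (\<lambda>\<omega>. (W \<omega>, Y1 \<omega>)) \<Otimes>\<^sub>M ?D2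
      = distr M ((S \<Otimes>\<^sub>M T1) \<Otimes>\<^sub>M T2) (\<lambda>\<omega>. ((W \<omega>, Y1 \<omega>), Y2 \<omega>))"
  proof (rule pair_measure_eqI)
    fix A B assume "A \<in> sets (distr M (S \<Otimes>\<^sub>M T1) (\<lambda>\<omega>. (W \<omega>, Y1 \<omega>)))" "B \<in> sets ?D2"
    then have A [measurable]: "A \<in> sets (S \<Otimes>\<^sub>M T1)" and B [measurable]: "B \<in> sets T2"
      by auto
    let ?E = "{v \<in> space (S \<Otimes>\<^sub>M (T1 \<Otimes>\<^sub>M T2)). (fst v, fst (snd v)) \<in> A \<and> snd (snd v) \<in> B}"
    have E: "?E \<in> sets (S \<Otimes>\<^sub>M (T1 \<Otimes>\<^sub>M T2))"
      by measurable
    have slice: "emeasure (?D1 \<Otimes>\<^sub>M ?D2) (Pair w -` ?E) = emeasure ?D1 (Pair w -` A) * emeasure ?D2 B"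
      if "w \<in> space S" for w
    proof -
      have "Pair w -` ?E = (Pair w -` A) \<times> B"
        using that sets.sets_into_space[OF A] sets.sets_into_space[OF B]
        by (auto simp: space_pair_measure)
      then show ?thesis
        by (simp add: D2.emeasure_pair_measure_Times sets_Pair1)
    qed
    have "emeasure (distr M ((S \<Otimes>\<^sub>M T1) \<Otimes>\<^sub>M T2) (\<lambda>\<omega>. ((W \<omega>, Y1 \<omega>), Y2 \<omega>))) (A \<times> B)
        = emeasure M ((\<lambda>\<omega>. ((W \<omega>, Y1 \<omega>), Y2 \<omega>)) -` (A \<times> B) \<inter> space M)"
      by (rule emeasure_distr) auto
    also have "(\<lambda>\<omega>. ((W \<omega>, Y1 \<omega>), Y2 \<omega>)) -` (A \<times> B) \<inter> space M
        = (\<lambda>\<omega>. (W \<omega>, Y1 \<omega>, Y2 \<omega>)) -` ?E \<inter> space M"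
      using measurable_space[OF rv(1)] measurable_space[OF rv(2)] measurable_space[OF rv(3)]
      by (auto simp: space_pair_measure)
    also have "emeasure M \<dots> = emeasure (?DW \<Otimes>\<^sub>M (?D1 \<Otimes>\<^sub>M ?D2)) ?E"
      unfolding DW12[symmetric] using E by (intro emeasure_distr[symmetric]) auto
    also have "\<dots> = (\<integral>\<^sup>+ w. emeasure (?D1 \<Otimes>\<^sub>M ?D2) (Pair w -` ?E) \<partial>?DW)"
    proof (rule D12.emeasure_pair_measure_alt)
      show "?E \<in> sets (?DW \<Otimes>\<^sub>M (?D1 \<Otimes>\<^sub>M ?D2))"
        using E by (simp cong: sets_pair_measure_cong)
    qed
    also have "\<dots> = (\<integral>\<^sup>+ w. emeasure ?D1 (Pair w -` A) * emeasure ?D2 B \<partial>?DW)"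
      by (intro nn_integral_cong slice) simp
    also have "\<dots> = (\<integral>\<^sup>+ w. emeasure ?D1 (Pair w -` A) \<partial>?DW) * emeasure ?D2 B"
    proof (rule nn_integral_multc)
      have "A \<in> sets (?DW \<Otimes>\<^sub>M ?D1)" by (simp cong: sets_pair_measure_cong)
      then show "(\<lambda>w. emeasure ?D1 (Pair w -` A)) \<in> borel_measurable ?DW"
        by (rule D1.measurable_emeasure_Pair)
    qed
    also have "(\<integral>\<^sup>+ w. emeasure ?D1 (Pair w -` A) \<partial>?DW) = emeasure (?DW \<Otimes>\<^sub>M ?D1) A"
      by (rule D1.emeasure_pair_measure_alt[symmetric]) (simp cong: sets_pair_measure_cong)
    finally show "emeasure (distr M (S \<Otimes>\<^sub>M T1) (\<lambda>\<omega>. (W \<omega>, Y1 \<omega>))) A * emeasure ?D2 B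
        = emeasure (distr M ((S \<Otimes>\<^sub>M T1) \<Otimes>\<^sub>M T2) (\<lambda>\<omega>. ((W \<omega>, Y1 \<omega>), Y2 \<omega>))) (A \<times> B)"
      by (simp add: DW1)
  qed (auto intro: DW1.sigma_finite_measure_axioms D2.sigma_finite_measure_axioms cong: sets_pair_measure_cong)
  then show ?thesis
    unfolding indep_pair_def by simp
qed

lemma borel_measurable_vec_lambda_nth:
  fixes F :: "'p::finite \<Rightarrow> 'a \<Rightarrow> real"
  assumes "\<And>j. F j \<in> borel_measurable N"
  shows "(\<lambda>\<omega>. \<chi> j. F j \<omega>) \<in> borel_measurable N"
proof -
  have "(\<lambda>\<omega>. (\<chi> j. F j \<omega>) \<bullet> axis j 1) \<in> borel_measurable N" for j
    using assms by (simp add: inner_axis)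
  then show ?thesis
    by (subst borel_measurable_euclidean_space) (auto simp: Basis_vec_def)
qed

lemma card_below_less_card: "card {l. l < (j :: 'p::{finite, linorder})} < CARD('p)"
  by (rule psubset_card_mono) auto

text \<open>The order \<open>p\<close> is a parameter tied to the index type by an equation, so that notions whose type does not mention
  \<open>'p\<close> can depend on it.\<close>

locale ar_process =
  fixes M :: "'w measure" and X eps :: "int \<Rightarrow> 'w \<Rightarrow> real"
    and \<rho> :: "real ^ ('p :: {finite, linorder}) \<Rightarrow> real" and f :: "real \<Rightarrow> real" and \<sigma> :: real
    and p :: nat
  assumes p_eq: "p = CARD('p)" and model: "ar_model M X eps \<rho> f \<sigma>"
    and \<rho>_measurable [measurable]: "\<rho> \<in> borel_measurable borel"
begin

lemma model_prob_space: "prob_space M"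
  using model by (simp add: ar_model_def)

sublocale prob_space M
  by (rule model_prob_space)

lemma stationary: "stationary_process M (\<lambda>j. X (1 - int p + int j))"
  and ergodic: "ergodic_process M (\<lambda>j. X (1 - int p + int j))"
  and recursion: "\<And>i. i \<ge> 1 \<Longrightarrow> AE \<omega> in M. X i \<omega> = \<rho> (lag_vec X (i - 1) \<omega>) + eps i \<omega>"
  and innovations_indep: "indep_vars (\<lambda>_. borel) eps {1..}"
  and initial_indep: "indep_var (Pi\<^sub>M {1 - int p..0} (\<lambda>_. borel)) (\<lambda>\<omega>. \<lambda>i\<in>{1 - int p..0}. X i \<omega>)
       (Pi\<^sub>M {1..} (\<lambda>_. borel)) (\<lambda>\<omega>. \<lambda>i\<in>{1..}. eps i \<omega>)"
  and density_pos: "\<And>y. f y > 0"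
  and innovation_distributed: "\<And>i. i \<ge> 1 \<Longrightarrow> distributed M lborel (eps i) (\<lambda>y. ennreal (f y))"
  using model unfolding ar_model_def p_eq by blast+

lemma innovation_measurable [measurable]: "i \<ge> 1 \<Longrightarrow> eps i \<in> borel_measurable M"
  using distributed_measurable[OF innovation_distributed] by simp

lemma observation_measurable [measurable]:
  assumes "i \<ge> 1 - int p"
  shows "X i \<in> borel_measurable M"
proof -
  have "i = 1 - int p + int (nat (i - 1 + int p))" using assms by simp
  then show ?thesis using stationary unfolding stationary_process_def by metis
qed

lemma density_measurable [measurable]: "f \<in> borel_measurable borel"
proof -
  have "(\<lambda>y. ennreal (f y)) \<in> borel_measurable lborel"
    using distributed_borel_measurable[OF innovation_distributed[of 1]] by simp
  then have "(\<lambda>y. enn2real (ennreal (f y))) \<in> borel_measurable lborel" by measurable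
  then show ?thesis using density_pos by (simp add: less_imp_le)
qed

lemma lag_measurable [measurable]:
  "i \<ge> 0 \<Longrightarrow> (lag_vec X i :: 'w \<Rightarrow> (real, 'p) vec) \<in> borel_measurable M"
  unfolding lag_vec_def[abs_def] p_eq[symmetric]
  by (intro borel_measurable_vec_lambda_nth observation_measurable) auto

lemma innovation_integral:
  assumes "i \<ge> 1" and [measurable]: "F \<in> borel_measurable borel"
  shows "integrable M (\<lambda>\<omega>. F (eps i \<omega>) :: real) \<longleftrightarrow> integrable lborel (\<lambda>y. F y * f y)"
    and "(\<integral>\<omega>. F (eps i \<omega>) \<partial>M) = (\<integral>y. F y * f y \<partial>lborel)"
  using distributed_integrable[OF innovation_distributed[OF assms(1)], of F]
    distributed_integral[OF innovation_distributed[OF assms(1)], of F] density_pos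
  by (simp_all add: less_imp_le mult.commute)

abbreviation past :: "int \<Rightarrow> 'w \<Rightarrow> int \<Rightarrow> real" where
  "past j \<equiv> \<lambda>\<omega>. \<lambda>i\<in>{1 - int p..j - 1}. X i \<omega>"

text \<open>The lag vector as a functional of a trajectory; needed to express everything at time \<open>j\<close> through the past.\<close>

definition lag_of :: "int \<Rightarrow> (int \<Rightarrow> real) \<Rightarrow> (real, 'p) vec" where
  "lag_of i v = (\<chi> j. v (i - int p + 1 + int (card {l. l < j})))"

lemma lag_of_measurable:
  assumes "0 \<le> i" "i < j"
  shows "lag_of i \<in> borel_measurable (Pi\<^sub>M {1 - int p..j - 1} (\<lambda>_. borel))"
  unfolding lag_of_def[abs_def]
proof (rule borel_measurable_vec_lambda_nth, rule measurable_component_singleton)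
  fix l :: 'p
  show "i - int p + 1 + int (card {m. m < l}) \<in> {1 - int p..j - 1}"
    using card_below_less_card[of l] assms p_eq by auto
qed

lemma lag_of_past:
  assumes "0 \<le> i" "i < j"
  shows "lag_of i (past j \<omega>) = lag_vec X i \<omega>"
proof -
  have "i - int p + 1 + int (card {m. m < l}) \<in> {1 - int p..j - 1}" for l :: 'p
    using card_below_less_card[of l] assms p_eq by auto
  then show ?thesis
    unfolding lag_of_def lag_vec_def p_eq[symmetric] by (simp add: vec_eq_iff)
qed

lemma past_measurable [measurable]: "past j \<in> measurable M (Pi\<^sub>M {1 - int p..j - 1} (\<lambda>_. borel))"
  by (rule measurable_restrict) simp

text \<open>Induction on time: the next observation is, almost surely, a function of the past and of the current
  innovation, and the latter is independent of the later ones.\<close>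

lemma past_future_indep:
  assumes "j \<ge> 1"
  shows "indep_pair (Pi\<^sub>M {1 - int p..j - 1} (\<lambda>_. borel)) (past j)
    (Pi\<^sub>M {j..} (\<lambda>_. borel)) (\<lambda>\<omega>. \<lambda>i\<in>{j..}. eps i \<omega>)"
  using assms
proof (induction j rule: int_ge_induct)
  case base
  then show ?case using initial_indep by (simp only: indep_pair_iff_indep_var diff_self)
next
  case (step j)
  let ?S = "Pi\<^sub>M {1 - int p..j - 1} (\<lambda>_. borel :: real measure)"
    and ?S' = "Pi\<^sub>M {1 - int p..j + 1 - 1} (\<lambda>_. borel :: real measure)"
    and ?T = "Pi\<^sub>M {j + 1..} (\<lambda>_. borel :: real measure)"
  let ?E = "\<lambda>\<omega>. \<lambda>i\<in>{j + 1..}. eps i \<omega>"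
  let ?split = "\<lambda>e. (e j, \<lambda>i\<in>{j + 1..}. e i) :: real \<times> (int \<Rightarrow> real)"
  have split: "?split \<in> measurable (Pi\<^sub>M {j..} (\<lambda>_. borel)) (borel \<Otimes>\<^sub>M ?T)"
    by (intro measurable_Pair measurable_restrict measurable_component_singleton) auto
  have "indep_pair ?S (past j) (borel \<Otimes>\<^sub>M ?T) (\<lambda>\<omega>. ?split (\<lambda>i\<in>{j..}. eps i \<omega>))"
    using indep_pair_compose[OF step.IH measurable_ident split] by (simp only: id_apply)
  moreover have "(\<lambda>\<omega>. ?split (\<lambda>i\<in>{j..}. eps i \<omega>)) = (\<lambda>\<omega>. (eps j \<omega>, ?E \<omega>))"
    by (auto simp: fun_eq_iff restrict_def)
  ultimately have 1: "indep_pair ?S (past j) (borel \<Otimes>\<^sub>M ?T) (\<lambda>\<omega>. (eps j \<omega>, ?E \<omega>))"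
    by (simp only:)
  have "indep_var (Pi\<^sub>M {j} (\<lambda>_. borel)) (\<lambda>\<omega>. \<lambda>i\<in>{j}. eps i \<omega>) ?T ?E"
    by (rule indep_var_restrict[OF innovations_indep]) (use step.hyps in auto)
  then have single: "indep_pair (Pi\<^sub>M {j} (\<lambda>_. borel)) (\<lambda>\<omega>. \<lambda>i\<in>{j}. eps i \<omega>) ?T ?E"
    by (simp add: indep_pair_iff_indep_var)
  have proj: "(\<lambda>e. e j) \<in> borel_measurable (Pi\<^sub>M {j} (\<lambda>_. borel :: real measure))"
    by (rule measurable_component_singleton) simp
  have "indep_pair borel (\<lambda>\<omega>. (\<lambda>i\<in>{j}. eps i \<omega>) j) ?T ?E"
    using indep_pair_compose[OF single proj measurable_ident] by (simp only: id_apply)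
  then have 2: "indep_pair borel (eps j) ?T ?E"
    by (simp only: restrict_apply' singletonI)
  let ?next = "\<lambda>(v, e). \<lambda>i\<in>{1 - int p..j + 1 - 1}. if i = j then \<rho> (lag_of (j - 1) v) + e else v i"
  have [measurable]: "lag_of (j - 1) \<in> borel_measurable ?S"
    by (rule lag_of_measurable) (use step.hyps in auto)
  have next_meas: "?next \<in> measurable (?S \<Otimes>\<^sub>M borel) ?S'"
    unfolding case_prod_unfold
  proof (rule measurable_restrict)
    fix i assume i: "i \<in> {1 - int p..j + 1 - 1}"
    show "(\<lambda>x. if i = j then \<rho> (lag_of (j - 1) (fst x)) + snd x else fst x i)
        \<in> borel_measurable (?S \<Otimes>\<^sub>M borel)"
    proof (cases "i = j")
      case False
      then have "i \<in> {1 - int p..j - 1}" using i by auto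
      then have "(\<lambda>v. v i) \<in> borel_measurable ?S" by (rule measurable_component_singleton)
      then have "(\<lambda>x. fst x i) \<in> borel_measurable (?S \<Otimes>\<^sub>M borel)"
        by (rule measurable_compose[OF measurable_fst])
      then show ?thesis using False by simp
    qed simp
  qed
  have 3: "indep_pair ?S' (\<lambda>\<omega>. ?next (past j \<omega>, eps j \<omega>)) ?T ?E"
    using indep_pair_compose[OF indep_pair_assoc[OF 1 2] next_meas measurable_ident]
    by (simp only: id_apply)
  show ?case
  proof (rule indep_pair_cong_AE[OF 3])
    show "AE \<omega> in M. ?next (past j \<omega>, eps j \<omega>) = past (j + 1) \<omega>"
      using recursion[OF step.hyps]
    proof eventually_elim
      case (elim \<omega>)
      have "lag_of (j - 1) (past j \<omega>) = lag_vec X (j - 1) \<omega>"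
        by (rule lag_of_past) (use step.hyps in auto)
      then show ?case
        using elim by (auto simp: fun_eq_iff restrict_def)
    qed
  qed (rule past_measurable)
qed

lemma past_innovation_indep:
  assumes "j \<ge> 1"
  shows "indep_pair (Pi\<^sub>M {1 - int p..j - 1} (\<lambda>_. borel)) (past j) borel (eps j)"
proof -
  have "(\<lambda>e. e j) \<in> borel_measurable (Pi\<^sub>M {j..} (\<lambda>_. borel))"
    by (rule measurable_component_singleton) auto
  from indep_pair_compose[OF past_future_indep[OF assms] measurable_ident this]
  show ?thesis by simp
qed

lemma lag_innovation_indep:
  assumes "j \<ge> 1"
  shows "indep_pair borel (lag_vec X (j - 1) :: 'w \<Rightarrow> (real, 'p) vec) borel (eps j)"
proof -
  have "lag_of (j - 1) \<in> borel_measurable (Pi\<^sub>M {1 - int p..j - 1} (\<lambda>_. borel))"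
    using assms by (intro lag_of_measurable) auto
  from indep_pair_compose[OF past_innovation_indep[OF assms] this measurable_ident]
  show ?thesis using assms by (simp add: lag_of_past)
qed

text \<open>The martingale difference property, in integrated form. It is Fubini's theorem for the law of the past and the
  next innovation, which is a product by independence.\<close>

lemma integral_past_innovation_zero:
  assumes "j \<ge> 1"
    and meas: "(\<lambda>(v, y). F v y) \<in> borel_measurable (Pi\<^sub>M {1 - int p..j - 1} (\<lambda>_. borel) \<Otimes>\<^sub>M borel)"
    and int: "integrable M (\<lambda>\<omega>. F (past j \<omega>) (eps j \<omega>) :: real)"
    and zero: "\<And>v. (\<integral>y. F v y * f y \<partial>lborel) = 0"
  shows "(\<integral>\<omega>. F (past j \<omega>) (eps j \<omega>) \<partial>M) = 0"
proof -
  let ?S = "Pi\<^sub>M {1 - int p..j - 1} (\<lambda>_. borel :: real measure)"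
  let ?DW = "distr M ?S (past j)" and ?DE = "distr M borel (eps j)"
  have [measurable]: "eps j \<in> borel_measurable M" using assms(1) by simp
  interpret DW: prob_space ?DW by (rule prob_space_distr) simp
  interpret DE: prob_space ?DE by (rule prob_space_distr) simp
  interpret pair_sigma_finite ?DW ?DE ..
  have D: "?DW \<Otimes>\<^sub>M ?DE = distr M (?S \<Otimes>\<^sub>M borel) (\<lambda>\<omega>. (past j \<omega>, eps j \<omega>))"
    using past_innovation_indep[OF assms(1)] unfolding indep_pair_def by simp
  have pair: "(\<lambda>\<omega>. (past j \<omega>, eps j \<omega>)) \<in> measurable M (?S \<Otimes>\<^sub>M borel)" by simp
  have "integrable (?DW \<Otimes>\<^sub>M ?DE) (\<lambda>(v, y). F v y)"
    unfolding D using int meas by (subst integrable_distr_eq[OF pair]) (auto simp: case_prod_unfold)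
  then have "(\<integral>v. (\<integral>y. F v y \<partial>?DE) \<partial>?DW) = integral\<^sup>L (?DW \<Otimes>\<^sub>M ?DE) (\<lambda>(v, y). F v y)"
    by (rule integral_fst)
  also have "\<dots> = (\<integral>\<omega>. F (past j \<omega>) (eps j \<omega>) \<partial>M)"
    unfolding D using meas by (subst integral_distr[OF pair]) (auto simp: case_prod_unfold)
  finally have "(\<integral>\<omega>. F (past j \<omega>) (eps j \<omega>) \<partial>M) = (\<integral>v. (\<integral>y. F v y \<partial>?DE) \<partial>?DW)" ..
  also have "\<dots> = (\<integral>v. 0 \<partial>?DW)"
  proof (rule Bochner_Integration.integral_cong[OF refl])
    fix v assume "v \<in> space ?DW"
    then have [measurable]: "F v \<in> borel_measurable borel"
      using measurable_compose[OF measurable_Pair1' meas, of v] by simp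
    have "(\<integral>y. F v y \<partial>?DE) = (\<integral>\<omega>. F v (eps j \<omega>) \<partial>M)"
      by (rule integral_distr) auto
    then show "(\<integral>y. F v y \<partial>?DE) = 0"
      using innovation_integral(2)[OF assms(1), of "F v"] zero by simp
  qed
  finally show ?thesis by simp
qed

definition path_law :: "(nat \<Rightarrow> real) measure" where
  "path_law = distr M (Pi\<^sub>M UNIV (\<lambda>_. borel)) (\<lambda>\<omega> j. X (1 - int p + int j) \<omega>)"

definition shift :: "(nat \<Rightarrow> real) \<Rightarrow> nat \<Rightarrow> real" where
  "shift y = (\<lambda>i. y (Suc i))"

lemma sets_path_law [measurable_cong, simp]: "sets path_law = sets (Pi\<^sub>M UNIV (\<lambda>_. borel))"
  by (simp add: path_law_def)

lemma space_path_law [simp]: "space path_law = UNIV"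
  by (simp add: path_law_def space_PiM)

lemma path_measurable [measurable]:
  "(\<lambda>\<omega> j. X (1 - int p + int j) \<omega>) \<in> measurable M (Pi\<^sub>M UNIV (\<lambda>_. borel))"
  by (rule measurable_PiM_single') (auto simp: space_PiM)

lemma shift_measurable [measurable]:
  "shift \<in> measurable (Pi\<^sub>M UNIV (\<lambda>_. borel)) (Pi\<^sub>M UNIV (\<lambda>_. borel))"
  unfolding shift_def by (rule measurable_PiM_single') (auto simp: space_PiM)

text \<open>Stationarity and ergodicity of the process are statements about the shift on the space of trajectories.\<close>

sublocale path: ergodic_system path_law shift
proof -
  interpret path_law: prob_space path_law
    unfolding path_law_def by (rule prob_space_distr) simp
  show "ergodic_system path_law shift"
  proof
    show "shift \<in> measurable path_law path_law" by measurable
    have "distr path_law path_law shift = distr path_law (Pi\<^sub>M UNIV (\<lambda>_. borel)) shift"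
      by (rule distr_cong) auto
    also have "\<dots> = distr M (Pi\<^sub>M UNIV (\<lambda>_. borel)) (shift \<circ> (\<lambda>\<omega> j. X (1 - int p + int j) \<omega>))"
      unfolding path_law_def by (rule distr_distr) auto
    also have "\<dots> = path_law"
      using stationary unfolding stationary_process_def path_law_def comp_def shift_def by simp
    finally show "distr path_law path_law shift = path_law" .
    fix A assume A: "A \<in> sets path_law" "{y \<in> space path_law. shift y \<in> A} = A"
    then have "measure M {\<omega>\<in>space M. (\<lambda>j. X (1 - int p + int j) \<omega>) \<in> A} \<in> {0, 1}"
      using ergodic unfolding ergodic_process_def shift_def by simp
    moreover have "measure path_law A = measure M {\<omega>\<in>space M. (\<lambda>j. X (1 - int p + int j) \<omega>) \<in> A}"
      unfolding path_law_def using A(1)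
      by (subst measure_distr) (auto intro!: arg_cong[where f = "measure M"])
    ultimately show "measure path_law A = 0 \<or> measure path_law A = 1" by simp
  qed
qed

lemma shift_funpow: "(shift ^^ i) y j = y (i + j)"
  by (induction i arbitrary: y j) (auto simp: shift_def funpow_swap1 simp del: funpow.simps simp: funpow_Suc_right)

definition path_lag :: "(nat \<Rightarrow> real) \<Rightarrow> (real, 'p) vec" where
  "path_lag y = (\<chi> j. y (card {l. l < j}))"

definition path_innovation :: "(nat \<Rightarrow> real) \<Rightarrow> real" where
  "path_innovation y = y p - \<rho> (path_lag y)"

lemma path_lag_measurable [measurable]: "path_lag \<in> borel_measurable (Pi\<^sub>M UNIV (\<lambda>_. borel))"
  unfolding path_lag_def[abs_def] by (intro borel_measurable_vec_lambda_nth) measurable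

lemma path_innovation_measurable [measurable]:
  "path_innovation \<in> borel_measurable (Pi\<^sub>M UNIV (\<lambda>_. borel))"
  unfolding path_innovation_def[abs_def] by measurable

text \<open>What makes Birkhoff's theorem applicable to averages of functions of lag vectors and innovations: at every time
  they are the same functionals of the shifted trajectory.\<close>

lemma path_functionals:
  "AE \<omega> in M. \<forall>i::nat.
     path_lag ((shift ^^ i) (\<lambda>j. X (1 - int p + int j) \<omega>)) = lag_vec X (int i) \<omega> \<and>
     path_innovation ((shift ^^ i) (\<lambda>j. X (1 - int p + int j) \<omega>)) = eps (int i + 1) \<omega>"
  unfolding AE_all_countable
proof
  fix i :: nat
  show "AE \<omega> in M.
     path_lag ((shift ^^ i) (\<lambda>j. X (1 - int p + int j) \<omega>)) = lag_vec X (int i) \<omega> \<and>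
     path_innovation ((shift ^^ i) (\<lambda>j. X (1 - int p + int j) \<omega>)) = eps (int i + 1) \<omega>"
    using recursion[of "int i + 1", simplified]
  proof eventually_elim
    case (elim \<omega>)
    have lag: "path_lag ((shift ^^ i) (\<lambda>j. X (1 - int p + int j) \<omega>)) = lag_vec X (int i) \<omega>"
      unfolding path_lag_def lag_vec_def p_eq[symmetric] shift_funpow
      by (auto simp: vec_eq_iff intro!: arg_cong[where f = "\<lambda>i. X i \<omega>"])
    then show ?case
      using elim unfolding path_innovation_def lag shift_funpow by (simp add: algebra_simps)
  qed
qed

context
  fixes \<phi> :: "real \<Rightarrow> (real, 'p) vec \<Rightarrow> real"
  assumes \<phi> [measurable]: "(\<lambda>(y, z). \<phi> y z) \<in> borel_measurable (borel \<Otimes>\<^sub>M borel)"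
begin

lemma functional_integrable:
  "integrable M (\<lambda>\<omega>. \<phi> (eps (int i + 1) \<omega>) (lag_vec X (int i) \<omega>))
    \<longleftrightarrow> integrable path_law (\<lambda>y. \<phi> (path_innovation ((shift ^^ i) y)) (path_lag ((shift ^^ i) y)))"
  and functional_integral:
  "(\<integral>\<omega>. \<phi> (eps (int i + 1) \<omega>) (lag_vec X (int i) \<omega>) \<partial>M)
    = (\<integral>y. \<phi> (path_innovation ((shift ^^ i) y)) (path_lag ((shift ^^ i) y)) \<partial>path_law)"
proof -
  have [measurable]: "(shift ^^ i) \<in> measurable (Pi\<^sub>M UNIV (\<lambda>_. borel)) (Pi\<^sub>M UNIV (\<lambda>_. borel))"
    by (rule measurable_compose_n) measurable
  have [measurable]: "(\<lambda>\<omega>. \<phi> (eps (int i + 1) \<omega>) (lag_vec X (int i) \<omega>)) \<in> borel_measurable M"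
    by measurable
  have eq: "AE \<omega> in M. \<phi> (eps (int i + 1) \<omega>) (lag_vec X (int i) \<omega>)
      = \<phi> (path_innovation ((shift ^^ i) (\<lambda>j. X (1 - int p + int j) \<omega>)))
          (path_lag ((shift ^^ i) (\<lambda>j. X (1 - int p + int j) \<omega>)))"
    using path_functionals by eventually_elim simp
  show "integrable M (\<lambda>\<omega>. \<phi> (eps (int i + 1) \<omega>) (lag_vec X (int i) \<omega>))
    \<longleftrightarrow> integrable path_law (\<lambda>y. \<phi> (path_innovation ((shift ^^ i) y)) (path_lag ((shift ^^ i) y)))"
    unfolding path_law_def
    by (subst integrable_distr_eq) (measurable, rule integrable_cong_AE[OF _ _ eq], measurable)
  show "(\<integral>\<omega>. \<phi> (eps (int i + 1) \<omega>) (lag_vec X (int i) \<omega>) \<partial>M)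
    = (\<integral>y. \<phi> (path_innovation ((shift ^^ i) y)) (path_lag ((shift ^^ i) y)) \<partial>path_law)"
    unfolding path_law_def
    by (subst integral_distr) (measurable, rule integral_cong_AE[OF _ _ eq], measurable)
qed

lemma functional_stationary:
  assumes int: "integrable M (\<lambda>\<omega>. \<phi> (eps 1 \<omega>) (lag_vec X 0 \<omega>))" and "i \<ge> 1"
  shows "integrable M (\<lambda>\<omega>. \<phi> (eps i \<omega>) (lag_vec X (i - 1) \<omega>))"
    and "(\<integral>\<omega>. \<phi> (eps i \<omega>) (lag_vec X (i - 1) \<omega>) \<partial>M) = (\<integral>\<omega>. \<phi> (eps 1 \<omega>) (lag_vec X 0 \<omega>) \<partial>M)"
proof -
  let ?F = "\<lambda>y. \<phi> (path_innovation y) (path_lag y)"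
  have int0: "integrable path_law ?F"
    using functional_integrable[of 0] int by simp
  have *: "integrable path_law (\<lambda>y. ?F ((shift ^^ m) y)) \<and>
      (\<integral>y. ?F ((shift ^^ m) y) \<partial>path_law) = (\<integral>y. ?F y \<partial>path_law)" for m
  proof (induction m)
    case 0
    then show ?case using int0 by simp
  next
    case (Suc m)
    then show ?case
      using path.integrable_comp_T[of "\<lambda>y. ?F ((shift ^^ m) y)"]
      by (simp add: funpow_swap1)
  qed
  define m where "m = nat (i - 1)"
  have m: "i = int m + 1" using \<open>i \<ge> 1\<close> by (auto simp: m_def)
  show "integrable M (\<lambda>\<omega>. \<phi> (eps i \<omega>) (lag_vec X (i - 1) \<omega>))"
    using functional_integrable[of m] *[of m] unfolding m by simp
  show "(\<integral>\<omega>. \<phi> (eps i \<omega>) (lag_vec X (i - 1) \<omega>) \<partial>M) = (\<integral>\<omega>. \<phi> (eps 1 \<omega>) (lag_vec X 0 \<omega>) \<partial>M)"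
    using functional_integral[of m] functional_integral[of 0] *[of m] unfolding m by simp
qed

lemma ergodic_average:
  assumes int: "integrable M (\<lambda>\<omega>. \<phi> (eps 1 \<omega>) (lag_vec X 0 \<omega>))"
  shows "AE \<omega> in M. (\<lambda>n. (\<Sum>i<n. \<phi> (eps (int i + 1) \<omega>) (lag_vec X (int i) \<omega>)) / real n)
    \<longlonglongrightarrow> (\<integral>\<omega>. \<phi> (eps 1 \<omega>) (lag_vec X 0 \<omega>) \<partial>M)"
proof -
  let ?F = "\<lambda>y. \<phi> (path_innovation y) (path_lag y)"
  have int0: "integrable path_law ?F"
    using functional_integrable[of 0] int by simp
  have eq0: "(\<integral>y. ?F y \<partial>path_law) = (\<integral>\<omega>. \<phi> (eps 1 \<omega>) (lag_vec X 0 \<omega>) \<partial>M)"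
    using functional_integral[of 0] by simp
  have "AE y in path_law. (\<lambda>n. (\<Sum>i<n. ?F ((shift ^^ i) y)) / real n) \<longlonglongrightarrow> (\<integral>y. ?F y \<partial>path_law)"
    by (rule path.birkhoff[OF int0])
  then have "AE \<omega> in M. (\<lambda>n. (\<Sum>i<n. ?F ((shift ^^ i) (\<lambda>j. X (1 - int p + int j) \<omega>))) / real n)
      \<longlonglongrightarrow> (\<integral>y. ?F y \<partial>path_law)"
    unfolding path_law_def by (rule AE_distrD[OF path_measurable])
  then show ?thesis
    using path_functionals
  proof eventually_elim
    case (elim \<omega>)
    then show ?case by (simp add: eq0)
  qed
qed

lemma sample_mean_tendsto_in_prob:
  assumes int: "integrable M (\<lambda>\<omega>. \<phi> (eps 1 \<omega>) (lag_vec X 0 \<omega>))"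
  shows "((\<lambda>q. sample_mean (fst q) (\<lambda>i. \<phi> (eps i (snd q)) (lag_vec X (i - 1) (snd q))))
    \<longlongrightarrow> (\<integral>\<omega>. \<phi> (eps 1 \<omega>) (lag_vec X 0 \<omega>) \<partial>M)) (in_prob M)"
proof (rule tendsto_in_prob_if_AE)
  show "(\<lambda>\<omega>. sample_mean n (\<lambda>i. \<phi> (eps i \<omega>) (lag_vec X (i - 1) \<omega>))) \<in> borel_measurable M" for n
    unfolding sample_mean_def sum_int_interval by measurable
  show "AE \<omega> in M. (\<lambda>n. sample_mean n (\<lambda>i. \<phi> (eps i \<omega>) (lag_vec X (i - 1) \<omega>)))
      \<longlonglongrightarrow> (\<integral>\<omega>. \<phi> (eps 1 \<omega>) (lag_vec X 0 \<omega>) \<partial>M)"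
    using ergodic_average[OF int] by eventually_elim (simp add: sample_mean_def sum_int_interval)
qed

lemma max_negligible_in_prob:
  assumes int: "integrable M (\<lambda>\<omega>. \<phi> (eps 1 \<omega>) (lag_vec X 0 \<omega>))" and "\<eta> > 0"
  shows "eventually (\<lambda>q. \<forall>i\<in>{1..int (fst q)}. \<phi> (eps i (snd q)) (lag_vec X (i - 1) (snd q)) \<le> \<eta> * real (fst q))
    (in_prob M)"
proof -
  let ?A = "\<lambda>n \<omega>. \<forall>i<n. \<phi> (eps (int i + 1) \<omega>) (lag_vec X (int i) \<omega>) \<le> \<eta> * real n"
  have "((\<lambda>q. indicator {\<omega>\<in>space M. ?A (fst q) \<omega>} (snd q) :: real) \<longlongrightarrow> 1) (in_prob M)"
  proof (rule tendsto_in_prob_if_AE)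
    show "indicator {\<omega>\<in>space M. ?A n \<omega>} \<in> borel_measurable M" for n
      by measurable
    show "AE \<omega> in M. (\<lambda>n. indicator {\<omega>\<in>space M. ?A n \<omega>} \<omega> :: real) \<longlonglongrightarrow> 1"
      using ergodic_average[OF int] AE_space
    proof eventually_elim
      case (elim \<omega>)
      have "\<forall>\<^sub>F n in sequentially. (indicator {\<omega>\<in>space M. ?A n \<omega>} \<omega> :: real) = 1"
        using max_negligible_if_means_converge[OF elim(1) \<open>\<eta> > 0\<close>]
        by eventually_elim (use elim(2) in simp)
      then show ?case by (rule tendsto_eventually)
    qed
  qed
  then have "eventually (\<lambda>q. (indicator {\<omega>\<in>space M. ?A (fst q) \<omega>} (snd q) :: real) > 0) (in_prob M)"
    by (rule order_tendstoD) simp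
  then show ?thesis
  proof eventually_elim
    case (elim q)
    then have A: "?A (fst q) (snd q)" by (auto simp: indicator_def split: if_splits)
    show ?case
    proof
      fix i assume "i \<in> {1..int (fst q)}"
      then have "nat (i - 1) < fst q" "int (nat (i - 1)) = i - 1" by auto
      then show "\<phi> (eps i (snd q)) (lag_vec X (i - 1) (snd q)) \<le> \<eta> * real (fst q)"
        using A[rule_format, of "nat (i - 1)"] by simp
    qed
  qed
qed

end

text \<open>Convergence of the average of squares forces the largest square to be \<open>o\<^sub>p(n)\<close>.\<close>

lemma max_root_negligible_in_prob:
  assumes u [measurable]: "(\<lambda>(y, z). u y z :: real) \<in> borel_measurable (borel \<Otimes>\<^sub>M borel)"
    and int: "integrable M (\<lambda>\<omega>. (u (eps 1 \<omega>) (lag_vec X 0 \<omega> :: (real, 'p) vec))\<^sup>2)" and "\<eta> > 0"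
  shows "eventually (\<lambda>q. \<forall>i\<in>{1..int (fst q)}. \<bar>u (eps i (snd q)) (lag_vec X (i - 1) (snd q))\<bar> \<le> \<eta> * sqrt (real (fst q)))
    (in_prob M)"
proof -
  have "eventually (\<lambda>q. \<forall>i\<in>{1..int (fst q)}. (u (eps i (snd q)) (lag_vec X (i - 1) (snd q)))\<^sup>2 \<le> \<eta>\<^sup>2 * real (fst q))
    (in_prob M)"
    by (rule max_negligible_in_prob[of "\<lambda>y z. (u y z)\<^sup>2", OF _ int])
       (measurable, use \<open>\<eta> > 0\<close> in simp)
  then show ?thesis
  proof eventually_elim
    case (elim q)
    show ?case
    proof
      fix i assume "i \<in> {1..int (fst q)}"
      then have "\<bar>u (eps i (snd q)) (lag_vec X (i - 1) (snd q))\<bar>\<^sup>2 \<le> (\<eta> * sqrt (real (fst q)))\<^sup>2"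
        using elim by (simp add: power_mult_distrib)
      then show "\<bar>u (eps i (snd q)) (lag_vec X (i - 1) (snd q))\<bar> \<le> \<eta> * sqrt (real (fst q))"
        by (rule power2_le_imp_le) (use \<open>\<eta> > 0\<close> in simp)
    qed
  qed
qed

end

section \<open>Martingale structure of centred sums\<close>

text \<open>Truncation keeps random shifts inside the range where the Lipschitz bound holds, without affecting shifts that are already small.\<close>

definition clip :: "real \<Rightarrow> real \<Rightarrow> real" where
  "clip c x = max (- c) (min c x)"

lemma clip_measurable [measurable]: "clip c \<in> borel_measurable borel"
  unfolding clip_def[abs_def] by measurable

lemma abs_clip_le: "c \<ge> 0 \<Longrightarrow> \<bar>clip c x\<bar> \<le> c" "c \<ge> 0 \<Longrightarrow> \<bar>clip c x\<bar> \<le> \<bar>x\<bar>"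
  by (auto simp: clip_def)

lemma clip_lipschitz: "\<bar>clip c x - clip c y\<bar> \<le> \<bar>x - y\<bar>"
  by (auto simp: clip_def)

lemma clip_eq: "\<bar>x\<bar> \<le> c \<Longrightarrow> clip c x = x"
  by (auto simp: clip_def)

lemma sum_squares_le: "(a + b)\<^sup>2 \<le> 2 * a\<^sup>2 + 2 * b\<^sup>2" for a b :: real
  using zero_le_power2[of "a - b"] by (simp add: power2_sum power2_diff)

context ar_process
begin

lemma innovation_eq: "i \<ge> 1 \<Longrightarrow> AE \<omega> in M. eps i \<omega> = X i \<omega> - \<rho> (lag_vec X (i - 1) \<omega>)"
  using recursion[of i] by auto

lemma density_integrable: "integrable lborel f" "(\<integral>y. f y \<partial>lborel) = 1"
  using innovation_integral[of 1 "\<lambda>_. 1"] by (auto simp: prob_space)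

context
  fixes \<zeta> :: "real \<Rightarrow> (real, 'p) vec \<Rightarrow> real" and w :: "real \<Rightarrow> real" and B :: real
  assumes \<zeta> [measurable]: "(\<lambda>(y, z). \<zeta> y z) \<in> borel_measurable (borel \<Otimes>\<^sub>M borel)"
    and w [measurable]: "w \<in> borel_measurable borel"
    and bound: "\<And>y z. \<bar>\<zeta> y z\<bar> \<le> B * w y"
    and w2: "integrable lborel (\<lambda>y. (w y)\<^sup>2 * f y)"
    and centred: "\<And>z. (\<integral>y. \<zeta> y z * f y \<partial>lborel) = 0"
begin

lemma centred_product_integrable:
  assumes "i \<ge> 1" "j \<ge> 1"
  shows "integrable M (\<lambda>\<omega>. \<zeta> (eps i \<omega>) (lag_vec X (i - 1) \<omega>) * \<zeta> (eps j \<omega>) (lag_vec X (j - 1) \<omega>))"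
proof -
  have [measurable]: "eps i \<in> borel_measurable M" "eps j \<in> borel_measurable M"
    "(lag_vec X (i - 1) :: 'w \<Rightarrow> (real, 'p) vec) \<in> borel_measurable M"
    "(lag_vec X (j - 1) :: 'w \<Rightarrow> (real, 'p) vec) \<in> borel_measurable M"
    using assms by auto
  have "integrable M (\<lambda>\<omega>. (w (eps i \<omega>))\<^sup>2)" "integrable M (\<lambda>\<omega>. (w (eps j \<omega>))\<^sup>2)"
    using innovation_integral(1)[of _ "\<lambda>y. (w y)\<^sup>2"] w2 assms by auto
  then have "integrable M (\<lambda>\<omega>. B\<^sup>2 * ((w (eps i \<omega>))\<^sup>2 + (w (eps j \<omega>))\<^sup>2))"
    by simp
  then show ?thesis
  proof (rule Bochner_Integration.integrable_bound)
    show "AE \<omega> in M. norm (\<zeta> (eps i \<omega>) (lag_vec X (i - 1) \<omega>) * \<zeta> (eps j \<omega>) (lag_vec X (j - 1) \<omega>))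
        \<le> norm (B\<^sup>2 * ((w (eps i \<omega>))\<^sup>2 + (w (eps j \<omega>))\<^sup>2))"
    proof (rule AE_I2)
      fix \<omega>
      let ?a = "\<zeta> (eps i \<omega>) (lag_vec X (i - 1) \<omega>)" and ?b = "\<zeta> (eps j \<omega>) (lag_vec X (j - 1) \<omega>)"
      have sq: "(\<zeta> y z)\<^sup>2 \<le> B\<^sup>2 * (w y)\<^sup>2" for y z
        using power_mono[OF bound, of _ _ 2] by (simp add: power_mult_distrib)
      have "2 * \<bar>?a * ?b\<bar> \<le> ?a\<^sup>2 + ?b\<^sup>2"
        using zero_le_power2[of "\<bar>?a\<bar> - \<bar>?b\<bar>"] by (simp add: power2_diff abs_mult)
      then have "\<bar>?a * ?b\<bar> \<le> ?a\<^sup>2 + ?b\<^sup>2" by linarith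
      also have "\<dots> \<le> B\<^sup>2 * ((w (eps i \<omega>))\<^sup>2 + (w (eps j \<omega>))\<^sup>2)"
        using sq[of "eps i \<omega>" "lag_vec X (i - 1) \<omega>"] sq[of "eps j \<omega>" "lag_vec X (j - 1) \<omega>"]
        by (simp add: distrib_left)
      finally show "norm (?a * ?b) \<le> norm (B\<^sup>2 * ((w (eps i \<omega>))\<^sup>2 + (w (eps j \<omega>))\<^sup>2))"
        by simp
    qed
  qed measurable
qed

text \<open>The earlier factor is, almost surely, a function of the past at time \<open>j\<close>, because \<open>\<epsilon>\<^sub>i\<close> can be recovered from
  the observations.\<close>

lemma centred_orthogonal:
  assumes "1 \<le> i" "i < j"
  shows "(\<integral>\<omega>. \<zeta> (eps i \<omega>) (lag_vec X (i - 1) \<omega>) * \<zeta> (eps j \<omega>) (lag_vec X (j - 1) \<omega>) \<partial>M) = 0"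
proof -
  let ?S = "Pi\<^sub>M {1 - int p..j - 1} (\<lambda>_. borel :: real measure)"
  define u where "u v = \<zeta> (v i - \<rho> (lag_of (i - 1) v)) (lag_of (i - 1) v)" for v
  define F where "F v y = u v * \<zeta> y (lag_of (j - 1) v)" for v y
  have [measurable]: "lag_of (i - 1) \<in> borel_measurable ?S" "lag_of (j - 1) \<in> borel_measurable ?S"
    by (rule lag_of_measurable; use assms in simp)+
  have [measurable]: "(\<lambda>v. v i) \<in> borel_measurable ?S"
    by (rule measurable_component_singleton) (use assms in auto)
  have F: "(\<lambda>(v, y). F v y) \<in> borel_measurable (?S \<Otimes>\<^sub>M borel)"
    unfolding F_def u_def by measurable
  have [measurable]: "eps i \<in> borel_measurable M" "eps j \<in> borel_measurable M"
    "(lag_vec X (i - 1) :: 'w \<Rightarrow> (real, 'p) vec) \<in> borel_measurable M"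
    "(lag_vec X (j - 1) :: 'w \<Rightarrow> (real, 'p) vec) \<in> borel_measurable M"
    using assms by auto
  have Fm: "(\<lambda>\<omega>. F (past j \<omega>) (eps j \<omega>)) \<in> borel_measurable M"
    using measurable_compose[OF measurable_Pair[OF past_measurable \<open>eps j \<in> borel_measurable M\<close>] F] by simp
  have eq: "AE \<omega> in M. F (past j \<omega>) (eps j \<omega>)
      = \<zeta> (eps i \<omega>) (lag_vec X (i - 1) \<omega>) * \<zeta> (eps j \<omega>) (lag_vec X (j - 1) \<omega>)"
    using innovation_eq[OF assms(1)]
  proof eventually_elim
    case (elim \<omega>)
    have "past j \<omega> i = X i \<omega>" using assms by simp
    moreover have "lag_of (i - 1) (past j \<omega>) = lag_vec X (i - 1) \<omega>" "lag_of (j - 1) (past j \<omega>) = lag_vec X (j - 1) \<omega>"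
      using assms by (auto intro!: lag_of_past)
    ultimately show ?case unfolding F_def u_def using elim by (simp only:)
  qed
  have "integrable M (\<lambda>\<omega>. F (past j \<omega>) (eps j \<omega>))"
    by (subst integrable_cong_AE[OF Fm _ eq]) (use centred_product_integrable assms in auto)
  then have "(\<integral>\<omega>. F (past j \<omega>) (eps j \<omega>) \<partial>M) = 0"
  proof (rule integral_past_innovation_zero[rotated 2])
    show "(\<integral>y. F v y * f y \<partial>lborel) = 0" for v
      using centred[of "lag_of (j - 1) v"] by (simp add: F_def mult.assoc)
  qed (use assms F in auto)
  then show ?thesis
    using integral_cong_AE[OF Fm _ eq] by simp
qed

lemma centred_sum_second_moment:
  shows "integrable M (\<lambda>\<omega>. (\<Sum>i=1..int n. \<zeta> (eps i \<omega>) (lag_vec X (i - 1) \<omega>))\<^sup>2)"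
    and "(\<integral>\<omega>. (\<Sum>i=1..int n. \<zeta> (eps i \<omega>) (lag_vec X (i - 1) \<omega>))\<^sup>2 \<partial>M)
      = (\<Sum>i=1..int n. \<integral>\<omega>. (\<zeta> (eps i \<omega>) (lag_vec X (i - 1) \<omega>))\<^sup>2 \<partial>M)"
proof -
  let ?a = "\<lambda>i \<omega>. \<zeta> (eps i \<omega>) (lag_vec X (i - 1) \<omega>)"
  have sq: "(\<Sum>i=1..int n. ?a i \<omega>)\<^sup>2 = (\<Sum>i=1..int n. \<Sum>j=1..int n. ?a i \<omega> * ?a j \<omega>)" for \<omega>
    by (simp add: power2_eq_square sum_product)
  have int: "integrable M (\<lambda>\<omega>. ?a i \<omega> * ?a j \<omega>)" if "i \<in> {1..int n}" "j \<in> {1..int n}" for i j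
    using that by (intro centred_product_integrable) auto
  show "integrable M (\<lambda>\<omega>. (\<Sum>i=1..int n. ?a i \<omega>)\<^sup>2)"
    unfolding sq by (intro Bochner_Integration.integrable_sum int)
  have "(\<integral>\<omega>. (\<Sum>i=1..int n. ?a i \<omega>)\<^sup>2 \<partial>M)
      = (\<Sum>i=1..int n. \<integral>\<omega>. (\<Sum>j=1..int n. ?a i \<omega> * ?a j \<omega>) \<partial>M)"
    unfolding sq by (intro Bochner_Integration.integral_sum Bochner_Integration.integrable_sum int)
  also have "\<dots> = (\<Sum>i=1..int n. \<Sum>j=1..int n. \<integral>\<omega>. ?a i \<omega> * ?a j \<omega> \<partial>M)"
    by (intro sum.cong refl Bochner_Integration.integral_sum int)
  also have "\<dots> = (\<Sum>i=1..int n. \<Sum>j=1..int n. if j = i then \<integral>\<omega>. (?a i \<omega>)\<^sup>2 \<partial>M else 0)"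
  proof (intro sum.cong refl)
    fix i j assume ij: "i \<in> {1..int n}" "j \<in> {1..int n}"
    consider "i < j" | "i = j" | "j < i" by linarith
    then show "(\<integral>\<omega>. ?a i \<omega> * ?a j \<omega> \<partial>M) = (if j = i then \<integral>\<omega>. (?a i \<omega>)\<^sup>2 \<partial>M else 0)"
    proof cases
      case 1
      then show ?thesis using centred_orthogonal[of i j] ij by simp
    next
      case 2
      then show ?thesis by (simp add: power2_eq_square)
    next
      case 3
      then show ?thesis using centred_orthogonal[of j i] ij by (simp add: mult.commute)
    qed
  qed
  also have "\<dots> = (\<Sum>i=1..int n. \<integral>\<omega>. (?a i \<omega>)\<^sup>2 \<partial>M)"
    by (simp add: sum.delta)
  finally show "(\<integral>\<omega>. (\<Sum>i=1..int n. ?a i \<omega>)\<^sup>2 \<partial>M) = (\<Sum>i=1..int n. \<integral>\<omega>. (?a i \<omega>)\<^sup>2 \<partial>M)" .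
qed

end

lemma product_expectation:
  assumes [measurable]: "u \<in> borel_measurable borel" "v \<in> borel_measurable borel"
    and u: "integrable M (\<lambda>\<omega>. u (eps i \<omega>) :: real)" and v: "integrable M (\<lambda>\<omega>. v (lag_vec X (i - 1) \<omega> :: (real, 'p) vec) :: real)"
    and "i \<ge> 1"
  shows "integrable M (\<lambda>\<omega>. u (eps i \<omega>) * v (lag_vec X (i - 1) \<omega>))"
    and "(\<integral>\<omega>. u (eps i \<omega>) * v (lag_vec X (i - 1) \<omega>) \<partial>M)
      = (\<integral>\<omega>. u (eps i \<omega>) \<partial>M) * (\<integral>\<omega>. v (lag_vec X (i - 1) \<omega>) \<partial>M)"
proof -
  have "indep_pair borel (\<lambda>\<omega>. v (lag_vec X (i - 1) \<omega>)) borel (\<lambda>\<omega>. u (eps i \<omega>))"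
    by (rule indep_pair_compose[OF lag_innovation_indep[OF \<open>i \<ge> 1\<close>]]) auto
  then have ind: "indep_var borel (\<lambda>\<omega>. v (lag_vec X (i - 1) \<omega>)) borel (\<lambda>\<omega>. u (eps i \<omega>))"
    by (simp add: indep_pair_iff_indep_var)
  show "integrable M (\<lambda>\<omega>. u (eps i \<omega>) * v (lag_vec X (i - 1) \<omega>))"
    using indep_var_integrable[OF ind v u] by (simp add: mult.commute)
  show "(\<integral>\<omega>. u (eps i \<omega>) * v (lag_vec X (i - 1) \<omega>) \<partial>M)
      = (\<integral>\<omega>. u (eps i \<omega>) \<partial>M) * (\<integral>\<omega>. v (lag_vec X (i - 1) \<omega>) \<partial>M)"
    using indep_var_lebesgue_integral[OF ind v u] by (simp add: mult.commute)
qed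

end

text \<open>The shift of the \<open>i\<close>-th innovation will be an inner product with \<open>V\<close> evaluated at the lag vector.\<close>

locale ar_functional = ar_process M X eps \<rho> f \<sigma> p + shifted_functional f f' w g k C L \<delta>
  for M :: "'w measure" and X eps :: "int \<Rightarrow> 'w \<Rightarrow> real"
    and \<rho> :: "(real, 'p :: {finite, linorder}) vec \<Rightarrow> real" and f :: "real \<Rightarrow> real" and \<sigma> :: real and p :: nat
    and f' w g k C L \<delta> +
  fixes V :: "(real, 'p) vec \<Rightarrow> 'v :: euclidean_space"
  assumes V_measurable [measurable]: "V \<in> borel_measurable borel"
    and V_square_integrable: "integrable M (\<lambda>\<omega>. (norm (V (lag_vec X 0 \<omega>)))\<^sup>2)"
begin

definition w_mean :: real where
  "w_mean = (\<integral>y. w y * f y \<partial>lborel)"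

definition w_square_mean :: real where
  "w_square_mean = (\<integral>y. (w y)\<^sup>2 * f y \<partial>lborel)"

lemma w_mean_nonneg: "w_mean \<ge> 0"
  unfolding w_mean_def using w_ge_1 f_pos
  by (intro Bochner_Integration.integral_nonneg) (meson less_imp_le mult_nonneg_nonneg order_trans zero_le_one)

lemma w_square_mean_nonneg: "w_square_mean \<ge> 0"
  unfolding w_square_mean_def using f_pos
  by (intro Bochner_Integration.integral_nonneg) (simp add: less_imp_le)

context
  fixes h :: "(real, 'p) vec \<Rightarrow> real" and \<beta> :: real
  assumes h [measurable]: "h \<in> borel_measurable borel"
    and h_small: "\<And>z. \<bar>h z\<bar> + \<bar>\<beta>\<bar> \<le> \<delta>"
begin

text \<open>The conditional mean, given the lag vector \<open>z\<close>, of \<open>smoothed \<beta> (\<epsilon> + h z) - g \<epsilon>\<close> for an independent innovation \<open>\<epsilon>\<close>.\<close>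

definition drift :: "(real, 'p) vec \<Rightarrow> real" where
  "drift z = (\<integral>y. smoothed \<beta> (y + h z) * f y \<partial>lborel) - shift_mean 0"

definition fluctuation :: "real \<Rightarrow> (real, 'p) vec \<Rightarrow> real" where
  "fluctuation y z = smoothed \<beta> (y + h z) - g y - drift z"

lemma drift_measurable [measurable]: "drift \<in> borel_measurable borel"
  unfolding drift_def[abs_def] by measurable

lemma fluctuation_measurable [measurable]:
  "(\<lambda>(y, z). fluctuation y z) \<in> borel_measurable (borel \<Otimes>\<^sub>M borel)"
  unfolding fluctuation_def by measurable

lemma increment_bound: "\<bar>smoothed \<beta> (y + h z) - g y\<bar> \<le> L * (\<bar>h z\<bar> + \<bar>\<beta>\<bar>) * w y"
  by (rule smoothed_minus_le[OF h_small])

lemma increment_integrable: "integrable lborel (\<lambda>y. (smoothed \<beta> (y + h z) - g y) * f y)"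
proof (rule Bochner_Integration.integrable_bound)
  show "integrable lborel (\<lambda>y. L * (\<bar>h z\<bar> + \<bar>\<beta>\<bar>) * (w y * f y))"
    using w_f_integrable by simp
  show "AE y in lborel. norm ((smoothed \<beta> (y + h z) - g y) * f y) \<le> norm (L * (\<bar>h z\<bar> + \<bar>\<beta>\<bar>) * (w y * f y))"
  proof (rule AE_I2)
    fix y
    have "\<bar>smoothed \<beta> (y + h z) - g y\<bar> * f y \<le> L * (\<bar>h z\<bar> + \<bar>\<beta>\<bar>) * w y * f y"
      using f_pos[of y] by (intro mult_right_mono increment_bound) auto
    then show "norm ((smoothed \<beta> (y + h z) - g y) * f y) \<le> norm (L * (\<bar>h z\<bar> + \<bar>\<beta>\<bar>) * (w y * f y))"
      using f_pos[of y] by (simp add: abs_mult mult.assoc) (smt (verit) L_nonneg w_ge_1 mult_nonneg_nonneg)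
  qed
qed simp

lemma drift_eq: "drift z = (\<integral>y. (smoothed \<beta> (y + h z) - g y) * f y \<partial>lborel)"
proof -
  have g: "integrable lborel (\<lambda>y. g y * f y)"
    using g_shift_f_integrable[of 0] \<delta>_pos by simp
  have "integrable lborel (\<lambda>y. (smoothed \<beta> (y + h z) - g y) * f y + g y * f y)"
    using increment_integrable g by (rule Bochner_Integration.integrable_add)
  then have "integrable lborel (\<lambda>y. smoothed \<beta> (y + h z) * f y)"
    by (simp add: left_diff_distrib)
  then show ?thesis
    using g by (simp add: drift_def shift_mean_def left_diff_distrib)
qed

lemma drift_bound: "\<bar>drift z\<bar> \<le> L * (\<bar>h z\<bar> + \<bar>\<beta>\<bar>) * w_mean"
proof -
  have "\<bar>drift z\<bar> \<le> (\<integral>y. \<bar>(smoothed \<beta> (y + h z) - g y) * f y\<bar> \<partial>lborel)"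
    unfolding drift_eq by (rule integral_abs_bound)
  also have "\<dots> \<le> (\<integral>y. L * (\<bar>h z\<bar> + \<bar>\<beta>\<bar>) * (w y * f y) \<partial>lborel)"
  proof (rule integral_mono)
    fix y
    have "\<bar>smoothed \<beta> (y + h z) - g y\<bar> * f y \<le> L * (\<bar>h z\<bar> + \<bar>\<beta>\<bar>) * w y * f y"
      using f_pos[of y] by (intro mult_right_mono increment_bound) auto
    then show "\<bar>(smoothed \<beta> (y + h z) - g y) * f y\<bar> \<le> L * (\<bar>h z\<bar> + \<bar>\<beta>\<bar>) * (w y * f y)"
      using f_pos[of y] by (simp add: abs_mult mult.assoc)
  qed (use increment_integrable w_f_integrable in auto)
  finally show ?thesis by (simp add: w_mean_def)
qed

lemma drift_expansion: "\<bar>drift z - shift_slope 0 * h z\<bar> \<le> slope_lipschitz * (\<bar>h z\<bar> + \<bar>\<beta>\<bar>)\<^sup>2"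
  using smoothed_mean_expansion[OF h_small, of z] unfolding drift_def by simp

lemma fluctuation_centred: "(\<integral>y. fluctuation y z * f y \<partial>lborel) = 0"
proof -
  have "(\<integral>y. fluctuation y z * f y \<partial>lborel)
      = (\<integral>y. (smoothed \<beta> (y + h z) - g y) * f y - drift z * f y \<partial>lborel)"
    by (simp add: fluctuation_def left_diff_distrib)
  also have "\<dots> = drift z - drift z * (\<integral>y. f y \<partial>lborel)"
    using increment_integrable density_integrable by (simp add: drift_eq)
  finally show ?thesis by (simp add: density_integrable)
qed

lemma fluctuation_bound: "\<bar>fluctuation y z\<bar> \<le> L * (1 + w_mean) * ((\<bar>h z\<bar> + \<bar>\<beta>\<bar>) * w y)"
proof -
  let ?c = "L * (\<bar>h z\<bar> + \<bar>\<beta>\<bar>)"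
  have "?c * w_mean * 1 \<le> ?c * w_mean * w y"
    using w_ge_1[of y] L_nonneg w_mean_nonneg by (intro mult_left_mono) auto
  then have "\<bar>fluctuation y z\<bar> \<le> ?c * w y + ?c * w_mean * w y"
    using increment_bound[of y z] drift_bound[of z] unfolding fluctuation_def by linarith
  then show ?thesis by (simp add: algebra_simps)
qed

text \<open>Orthogonality makes the second moment of the sum additive; each summand is controlled by a function of
  the innovation times a function of the lag vector, which are independent.\<close>

lemma fluctuation_second_moment:
  "integrable M (\<lambda>\<omega>. (sqrt (real n) * sample_mean n (\<lambda>i. fluctuation (eps i \<omega>) (lag_vec X (i - 1) \<omega>)))\<^sup>2)"
  "(\<integral>\<omega>. (sqrt (real n) * sample_mean n (\<lambda>i. fluctuation (eps i \<omega>) (lag_vec X (i - 1) \<omega>)))\<^sup>2 \<partial>M)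
    \<le> (L * (1 + w_mean))\<^sup>2 * w_square_mean * (\<integral>\<omega>. (\<bar>h (lag_vec X 0 \<omega>)\<bar> + \<bar>\<beta>\<bar>)\<^sup>2 \<partial>M)"
proof -
  let ?A = "L * (1 + w_mean)" and ?a = "\<lambda>i \<omega>. fluctuation (eps i \<omega>) (lag_vec X (i - 1) \<omega>)"
  let ?H = "\<integral>\<omega>. (\<bar>h (lag_vec X 0 \<omega>)\<bar> + \<bar>\<beta>\<bar>)\<^sup>2 \<partial>M"
  have A: "?A \<ge> 0" using L_nonneg w_mean_nonneg by simp
  have bound: "\<bar>fluctuation y z\<bar> \<le> ?A * \<delta> * w y" for y z
  proof -
    have "?A * ((\<bar>h z\<bar> + \<bar>\<beta>\<bar>) * w y) \<le> ?A * (\<delta> * w y)"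
      using h_small[of z] w_ge_1[of y] A by (intro mult_left_mono mult_right_mono) auto
    then show ?thesis using fluctuation_bound[of y z] by (simp add: mult.assoc)
  qed
  note second_moment = centred_sum_second_moment[OF fluctuation_measurable w_measurable bound
      w_square_integrable fluctuation_centred, of n]
  have sq: "(sqrt (real n) * sample_mean n (\<lambda>i. ?a i \<omega>))\<^sup>2 = (1 / real n) * (\<Sum>i=1..int n. ?a i \<omega>)\<^sup>2" for \<omega>
    unfolding sample_mean_def
    by (cases "n = 0") (simp_all add: power_mult_distrib power_divide power2_eq_square[of "real n"])
  show "integrable M (\<lambda>\<omega>. (sqrt (real n) * sample_mean n (\<lambda>i. ?a i \<omega>))\<^sup>2)"
    unfolding sq using second_moment(1) by simp
  have each: "(\<integral>\<omega>. (?a i \<omega>)\<^sup>2 \<partial>M) \<le> ?A\<^sup>2 * w_square_mean * ?H" if i: "i \<in> {1..int n}" for i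
  proof -
    have "i \<ge> 1" using i by simp
    have w2: "integrable M (\<lambda>\<omega>. (w (eps i \<omega>))\<^sup>2)" "(\<integral>\<omega>. (w (eps i \<omega>))\<^sup>2 \<partial>M) = w_square_mean"
      using innovation_integral[OF \<open>i \<ge> 1\<close>, of "\<lambda>y. (w y)\<^sup>2"] w_square_integrable
      by (auto simp: w_square_mean_def)
    have h0: "integrable M (\<lambda>\<omega>. (\<bar>h (lag_vec X 0 \<omega>)\<bar> + \<bar>\<beta>\<bar>)\<^sup>2)"
    proof (rule integrable_const_bound[of _ "\<delta>\<^sup>2"])
      show "AE \<omega> in M. norm ((\<bar>h (lag_vec X 0 \<omega>)\<bar> + \<bar>\<beta>\<bar>)\<^sup>2) \<le> \<delta>\<^sup>2"
        using h_small by (intro AE_I2) (auto intro: power_mono)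
    qed measurable
    note h2 = functional_stationary[of "\<lambda>_ z. (\<bar>h z\<bar> + \<bar>\<beta>\<bar>)\<^sup>2", OF _ h0 \<open>i \<ge> 1\<close>]
    have h2: "integrable M (\<lambda>\<omega>. (\<bar>h (lag_vec X (i - 1) \<omega>)\<bar> + \<bar>\<beta>\<bar>)\<^sup>2)"
      "(\<integral>\<omega>. (\<bar>h (lag_vec X (i - 1) \<omega>)\<bar> + \<bar>\<beta>\<bar>)\<^sup>2 \<partial>M) = ?H"
      by (rule h2; measurable)+
    note prod = product_expectation[of "\<lambda>y. (w y)\<^sup>2" "\<lambda>z. (\<bar>h z\<bar> + \<bar>\<beta>\<bar>)\<^sup>2" i, OF _ _ w2(1) h2(1) \<open>i \<ge> 1\<close>]
    have "(\<integral>\<omega>. (?a i \<omega>)\<^sup>2 \<partial>M) \<le> (\<integral>\<omega>. ?A\<^sup>2 * ((w (eps i \<omega>))\<^sup>2 * (\<bar>h (lag_vec X (i - 1) \<omega>)\<bar> + \<bar>\<beta>\<bar>)\<^sup>2) \<partial>M)"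
    proof (rule integral_mono)
      show "integrable M (\<lambda>\<omega>. (?a i \<omega>)\<^sup>2)"
        using centred_product_integrable[OF fluctuation_measurable w_measurable bound
          w_square_integrable fluctuation_centred \<open>i \<ge> 1\<close> \<open>i \<ge> 1\<close>] by (simp add: power2_eq_square)
      show "integrable M (\<lambda>\<omega>. ?A\<^sup>2 * ((w (eps i \<omega>))\<^sup>2 * (\<bar>h (lag_vec X (i - 1) \<omega>)\<bar> + \<bar>\<beta>\<bar>)\<^sup>2))"
        using prod(1) by simp
      show "(?a i \<omega>)\<^sup>2 \<le> ?A\<^sup>2 * ((w (eps i \<omega>))\<^sup>2 * (\<bar>h (lag_vec X (i - 1) \<omega>)\<bar> + \<bar>\<beta>\<bar>)\<^sup>2)" for \<omega>
        using power_mono[OF fluctuation_bound, of "eps i \<omega>" "lag_vec X (i - 1) \<omega>" 2]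
        by (simp add: power_mult_distrib mult_ac)
    qed
    also have "\<dots> = ?A\<^sup>2 * (w_square_mean * ?H)"
      using prod(2) w2(2) h2(2) by simp
    finally show ?thesis by (simp add: mult.assoc)
  qed
  have "(\<integral>\<omega>. (sqrt (real n) * sample_mean n (\<lambda>i. ?a i \<omega>))\<^sup>2 \<partial>M)
      = (1 / real n) * (\<Sum>i=1..int n. \<integral>\<omega>. (?a i \<omega>)\<^sup>2 \<partial>M)"
    unfolding sq using second_moment by simp
  also have "\<dots> \<le> (1 / real n) * (\<Sum>i=1..int n. ?A\<^sup>2 * w_square_mean * ?H)"
    using each by (intro mult_left_mono sum_mono) auto
  also have "\<dots> \<le> ?A\<^sup>2 * w_square_mean * ?H"
    using w_square_mean_nonneg by (cases "n = 0") (auto intro!: mult_nonneg_nonneg Bochner_Integration.integral_nonneg)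
  finally show "(\<integral>\<omega>. (sqrt (real n) * sample_mean n (\<lambda>i. ?a i \<omega>))\<^sup>2 \<partial>M) \<le> ?A\<^sup>2 * w_square_mean * ?H" .
qed

end

end

section \<open>Uniform linearisation in the shift parameter\<close>

locale ar_bandwidth = ar_functional M X eps \<rho> f \<sigma> p f' w g k C L \<delta> V
  for M :: "'w measure" and X eps :: "int \<Rightarrow> 'w \<Rightarrow> real"
    and \<rho> :: "(real, 'p :: {finite, linorder}) vec \<Rightarrow> real" and f :: "real \<Rightarrow> real" and \<sigma> :: real and p :: nat
    and f' w g k C L \<delta> and V :: "(real, 'p) vec \<Rightarrow> 'v :: euclidean_space" +
  fixes b :: "nat \<Rightarrow> real"
  assumes b_pos: "\<And>n. b n > 0"
    and b_rate: "(\<lambda>n. real n * b n ^ 4) \<longlonglongrightarrow> 0"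
begin

lemma sqrt_n_b_square: "(\<lambda>n. sqrt (real n) * (b n)\<^sup>2) \<longlonglongrightarrow> 0"
proof -
  have "sqrt (real n * b n ^ 4) = sqrt (real n) * (b n)\<^sup>2" for n
  proof -
    have "b n ^ 4 = ((b n)\<^sup>2)\<^sup>2" by simp
    then show ?thesis by (simp only: real_sqrt_mult real_sqrt_abs) simp
  qed
  then show ?thesis using tendsto_real_sqrt[OF b_rate] by simp
qed

lemma b_tendsto_zero: "b \<longlonglongrightarrow> 0"
proof -
  have "(\<lambda>n. (b n)\<^sup>2) \<longlonglongrightarrow> 0"
  proof (rule tendsto_sandwich[OF _ _ tendsto_const sqrt_n_b_square])
    show "\<forall>\<^sub>F n in sequentially. (b n)\<^sup>2 \<le> sqrt (real n) * (b n)\<^sup>2"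
      using eventually_ge_at_top[of 1]
    proof eventually_elim
      case (elim n)
      then have "1 * (b n)\<^sup>2 \<le> sqrt (real n) * (b n)\<^sup>2" by (intro mult_right_mono) auto
      then show ?case by simp
    qed
  qed simp
  then have "(\<lambda>n. sqrt ((b n)\<^sup>2)) \<longlonglongrightarrow> sqrt 0" by (rule tendsto_real_sqrt)
  then show ?thesis using b_pos by (simp add: less_imp_le)
qed

definition local_shift :: "nat \<Rightarrow> 'v \<Rightarrow> (real, 'p) vec \<Rightarrow> real" where
  "local_shift n t z = clip (\<delta> / 2) ((V z \<bullet> t) / sqrt (real n))"

lemma local_shift_measurable [measurable]: "local_shift n t \<in> borel_measurable borel"
  unfolding local_shift_def[abs_def] by measurable

lemma local_shift_le: "\<bar>local_shift n t z\<bar> \<le> \<delta> / 2"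
  "\<bar>local_shift n t z\<bar> \<le> norm (V z) * norm t / sqrt (real n)"
proof -
  show "\<bar>local_shift n t z\<bar> \<le> \<delta> / 2"
    unfolding local_shift_def using \<delta>_pos by (intro abs_clip_le) simp
  have "\<bar>local_shift n t z\<bar> \<le> \<bar>(V z \<bullet> t) / sqrt (real n)\<bar>"
    unfolding local_shift_def using \<delta>_pos by (intro abs_clip_le) simp
  also have "\<dots> \<le> norm (V z) * norm t / sqrt (real n)"
    using Cauchy_Schwarz_ineq2[of "V z" t] by (simp add: abs_divide divide_right_mono)
  finally show "\<bar>local_shift n t z\<bar> \<le> norm (V z) * norm t / sqrt (real n)" .
qed

lemma local_shift_square: "n > 0 \<Longrightarrow> (local_shift n t z)\<^sup>2 \<le> (norm (V z))\<^sup>2 * (norm t)\<^sup>2 / real n"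
  using power_mono[OF local_shift_le(2)[of n t z], of 2] by (simp add: power_mult_distrib power_divide)

definition V_mean :: 'v where
  "V_mean = (\<integral>\<omega>. V (lag_vec X 0 \<omega>) \<partial>M)"

lemma V_lag_measurable [measurable]: "(\<lambda>\<omega>. V (lag_vec X 0 \<omega>)) \<in> borel_measurable M"
  by measurable

lemma V_integrable: "integrable M (\<lambda>\<omega>. V (lag_vec X 0 \<omega>))"
proof -
  have "integrable M (\<lambda>\<omega>. 1 + (norm (V (lag_vec X 0 \<omega>)))\<^sup>2)"
    using V_square_integrable by simp
  then show ?thesis
  proof (rule Bochner_Integration.integrable_bound)
    have "x \<le> 1 + x\<^sup>2" for x :: real
      using zero_le_power2[of "x - 1"] by (simp add: power2_diff) (smt (verit) zero_le_power2)
    then show "AE \<omega> in M. norm (V (lag_vec X 0 \<omega>)) \<le> norm (1 + (norm (V (lag_vec X 0 \<omega>)))\<^sup>2)"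
      by (intro AE_I2) (metis abs_ge_self order_trans real_norm_def)
  qed measurable
qed

lemma mean_norm_V_square:
  "((\<lambda>q. sample_mean (fst q) (\<lambda>i. (norm (V (lag_vec X (i - 1) (snd q))))\<^sup>2))
     \<longlongrightarrow> (\<integral>\<omega>. (norm (V (lag_vec X 0 \<omega>)))\<^sup>2 \<partial>M)) (in_prob M)"
  by (rule sample_mean_tendsto_in_prob[of "\<lambda>_ z. (norm (V z))\<^sup>2"]) (measurable, rule V_square_integrable)

lemma mean_V_inner:
  "((\<lambda>q. sample_mean (fst q) (\<lambda>i. V (lag_vec X (i - 1) (snd q)) \<bullet> t)) \<longlongrightarrow> V_mean \<bullet> t) (in_prob M)"
proof -
  have "((\<lambda>q. sample_mean (fst q) (\<lambda>i. V (lag_vec X (i - 1) (snd q)) \<bullet> t))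
      \<longlongrightarrow> (\<integral>\<omega>. V (lag_vec X 0 \<omega>) \<bullet> t \<partial>M)) (in_prob M)"
    by (rule sample_mean_tendsto_in_prob[of "\<lambda>_ z. V z \<bullet> t"]) (measurable, use V_integrable in simp)
  then show ?thesis using V_integrable by (simp add: V_mean_def)
qed

lemma max_norm_V:
  assumes "\<eta> > 0"
  shows "eventually (\<lambda>q. \<forall>i\<in>{1..int (fst q)}. norm (V (lag_vec X (i - 1) (snd q))) \<le> \<eta> * sqrt (real (fst q)))
    (in_prob M)"
  by (rule max_root_negligible_in_prob[of "\<lambda>_ z. norm (V z)", unfolded abs_norm_cancel])
     (measurable, rule V_square_integrable, rule assms)

text \<open>The scaled effect of shifting the innovations in direction \<open>t\<close> and of smoothing, minus its predicted limit.\<close>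

definition linearisation_error :: "nat \<Rightarrow> 'v \<Rightarrow> 'w \<Rightarrow> real" where
  "linearisation_error n t \<omega> =
     sqrt (real n) * sample_mean n (\<lambda>i. smoothed (b n) (eps i \<omega> + local_shift n t (lag_vec X (i - 1) \<omega>)) - g (eps i \<omega>))
     - shift_slope 0 * (V_mean \<bullet> t)"

lemma inverse_sqrt_n: "(\<lambda>n. 1 / sqrt (real n)) \<longlonglongrightarrow> 0"
  by real_asymp

lemma fluctuation_mean_tendsto:
  "((\<lambda>q. sqrt (real (fst q)) * sample_mean (fst q)
      (\<lambda>i. fluctuation (local_shift (fst q) t) (min (b (fst q)) (\<delta> / 2)) (eps i (snd q)) (lag_vec X (i - 1) (snd q))))
    \<longlongrightarrow> 0) (in_prob M)"
proof (rule tendsto_in_prob_if_L2)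
  \<comment> \<open>The truncated bandwidth makes the estimates valid for every \<open>n\<close>; it agrees with \<open>b n\<close> eventually.\<close>
  define \<beta> where "\<beta> n = min (b n) (\<delta> / 2)" for n
  have small: "\<bar>local_shift n t z\<bar> + \<bar>\<beta> n\<bar> \<le> \<delta>" for n z
    using local_shift_le(1)[of n t z] b_pos[of n] \<delta>_pos by (simp add: \<beta>_def)
  let ?Z = "\<lambda>n \<omega>. sqrt (real n) * sample_mean n
      (\<lambda>i. fluctuation (local_shift n t) (\<beta> n) (eps i \<omega>) (lag_vec X (i - 1) \<omega>))"
  note fluct = fluctuation_measurable[OF local_shift_measurable small]
  note second = fluctuation_second_moment[OF local_shift_measurable small]
  show "?Z n \<in> borel_measurable M" for n
  proof -
    have "(\<lambda>\<omega>. fluctuation (local_shift n t) (\<beta> n) (eps (int i + 1) \<omega>) (lag_vec X (int i) \<omega>)) \<in> borel_measurable M" for i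
      using measurable_compose[OF measurable_Pair fluct[of n], of "eps (int i + 1)" M "lag_vec X (int i)"] by simp
    then show ?thesis unfolding sample_mean_def sum_int_interval by simp
  qed
  show "integrable M (\<lambda>\<omega>. (?Z n \<omega>)\<^sup>2)" for n
    by (rule second(1))
  define K where "K = (L * (1 + w_mean))\<^sup>2 * w_square_mean"
  define V2 where "V2 = (\<integral>\<omega>. (norm (V (lag_vec X 0 \<omega>)))\<^sup>2 \<partial>M)"
  have K: "K \<ge> 0" unfolding K_def using w_square_mean_nonneg by simp
  have le: "(\<integral>\<omega>. (?Z n \<omega>)\<^sup>2 \<partial>M) \<le> K * (2 * (V2 * (norm t)\<^sup>2) * (1 / real n) + 2 * (b n)\<^sup>2)" if "n > 0" for n
  proof -
    have int: "integrable M (\<lambda>\<omega>. 2 * ((norm (V (lag_vec X 0 \<omega>)))\<^sup>2 * (norm t)\<^sup>2 / real n) + 2 * (b n)\<^sup>2)"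
      using V_square_integrable by simp
    have "(\<integral>\<omega>. (\<bar>local_shift n t (lag_vec X 0 \<omega>)\<bar> + \<bar>\<beta> n\<bar>)\<^sup>2 \<partial>M)
        \<le> (\<integral>\<omega>. 2 * ((norm (V (lag_vec X 0 \<omega>)))\<^sup>2 * (norm t)\<^sup>2 / real n) + 2 * (b n)\<^sup>2 \<partial>M)"
    proof (rule integral_mono[OF _ int])
      show "integrable M (\<lambda>\<omega>. (\<bar>local_shift n t (lag_vec X 0 \<omega>)\<bar> + \<bar>\<beta> n\<bar>)\<^sup>2)"
      proof (rule integrable_const_bound[of _ "\<delta>\<^sup>2"])
        show "AE \<omega> in M. norm ((\<bar>local_shift n t (lag_vec X 0 \<omega>)\<bar> + \<bar>\<beta> n\<bar>)\<^sup>2) \<le> \<delta>\<^sup>2"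
          using small by (intro AE_I2) (auto intro: power_mono)
      qed measurable
      fix \<omega>
      have "(\<bar>local_shift n t (lag_vec X 0 \<omega>)\<bar> + \<bar>\<beta> n\<bar>)\<^sup>2
          \<le> 2 * (local_shift n t (lag_vec X 0 \<omega>))\<^sup>2 + 2 * (\<beta> n)\<^sup>2"
        using sum_squares_le[of "\<bar>local_shift n t (lag_vec X 0 \<omega>)\<bar>" "\<bar>\<beta> n\<bar>"] by simp
      moreover have "(\<beta> n)\<^sup>2 \<le> (b n)\<^sup>2"
        using b_pos[of n] \<delta>_pos by (intro power_mono) (auto simp: \<beta>_def)
      ultimately show "(\<bar>local_shift n t (lag_vec X 0 \<omega>)\<bar> + \<bar>\<beta> n\<bar>)\<^sup>2
          \<le> 2 * ((norm (V (lag_vec X 0 \<omega>)))\<^sup>2 * (norm t)\<^sup>2 / real n) + 2 * (b n)\<^sup>2"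
        using local_shift_square[OF that, of t "lag_vec X 0 \<omega>"] by linarith
    qed
    also have "\<dots> = 2 * (V2 * (norm t)\<^sup>2) * (1 / real n) + 2 * (b n)\<^sup>2"
      using V_square_integrable by (simp add: V2_def prob_space)
    finally have "K * (\<integral>\<omega>. (\<bar>local_shift n t (lag_vec X 0 \<omega>)\<bar> + \<bar>\<beta> n\<bar>)\<^sup>2 \<partial>M)
        \<le> K * (2 * (V2 * (norm t)\<^sup>2) * (1 / real n) + 2 * (b n)\<^sup>2)"
      using K by (rule mult_left_mono)
    then show ?thesis using second(2)[of n n] unfolding K_def by linarith
  qed
  have lim: "(\<lambda>n. K * (2 * (V2 * (norm t)\<^sup>2) * (1 / real n) + 2 * (b n)\<^sup>2)) \<longlonglongrightarrow> K * (2 * (V2 * (norm t)\<^sup>2) * 0 + 2 * 0\<^sup>2)"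
    by (intro tendsto_intros b_tendsto_zero lim_1_over_n)
  show "(\<lambda>n. \<integral>\<omega>. (?Z n \<omega>)\<^sup>2 \<partial>M) \<longlonglongrightarrow> 0"
  proof (rule tendsto_sandwich[OF _ _ tendsto_const])
    show "\<forall>\<^sub>F n in sequentially. (\<integral>\<omega>. (?Z n \<omega>)\<^sup>2 \<partial>M) \<le> K * (2 * (V2 * (norm t)\<^sup>2) * (1 / real n) + 2 * (b n)\<^sup>2)"
      using eventually_gt_at_top[of 0] by eventually_elim (rule le)
    show "(\<lambda>n. K * (2 * (V2 * (norm t)\<^sup>2) * (1 / real n) + 2 * (b n)\<^sup>2)) \<longlonglongrightarrow> 0"
      using lim by simp
  qed simp
qed

text \<open>The error splits into the martingale part, the quadratic remainder of the conditional means, and the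
  deviation of the average of \<open>V\<close> from its mean.\<close>

lemma linearisation_error_pointwise:
  "((\<lambda>q. linearisation_error (fst q) t (snd q)) \<longlongrightarrow> 0) (in_prob M)"
proof -
  define \<beta> where "\<beta> n = min (b n) (\<delta> / 2)" for n
  have small: "\<bar>local_shift n t z\<bar> + \<bar>\<beta> n\<bar> \<le> \<delta>" for n z
    using local_shift_le(1)[of n t z] b_pos[of n] \<delta>_pos by (simp add: \<beta>_def)
  define fl where "fl q = sqrt (real (fst q)) * sample_mean (fst q)
      (\<lambda>i. fluctuation (local_shift (fst q) t) (\<beta> (fst q)) (eps i (snd q)) (lag_vec X (i - 1) (snd q)))" for q
  define inn where "inn q = sample_mean (fst q) (\<lambda>i. V (lag_vec X (i - 1) (snd q)) \<bullet> t)" for q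
  define rem where "rem q = 2 * slope_lipschitz * (sample_mean (fst q) (\<lambda>i. (norm (V (lag_vec X (i - 1) (snd q))))\<^sup>2)
      * (norm t)\<^sup>2 * (1 / sqrt (real (fst q))) + sqrt (real (fst q)) * (b (fst q))\<^sup>2)" for q
  have fl: "(fl \<longlongrightarrow> 0) (in_prob M)"
    using fluctuation_mean_tendsto[of t] unfolding fl_def \<beta>_def .
  have inn: "(inn \<longlongrightarrow> V_mean \<bullet> t) (in_prob M)"
    using mean_V_inner[of t] unfolding inn_def .
  have "(rem \<longlongrightarrow> 2 * slope_lipschitz * ((\<integral>\<omega>. (norm (V (lag_vec X 0 \<omega>)))\<^sup>2 \<partial>M) * (norm t)\<^sup>2 * 0 + 0)) (in_prob M)"
    unfolding rem_def
    by (intro tendsto_intros mean_norm_V_square filterlim_compose[OF inverse_sqrt_n filterlim_fst_in_prob]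
        filterlim_compose[OF sqrt_n_b_square filterlim_fst_in_prob])
  then have rem: "(rem \<longlongrightarrow> 0) (in_prob M)" by simp
  have bound: "eventually (\<lambda>q. \<bar>linearisation_error (fst q) t (snd q)\<bar>
      \<le> \<bar>fl q\<bar> + rem q + \<bar>shift_slope 0 * (inn q - V_mean \<bullet> t)\<bar>) (in_prob M)"
  proof -
    have "\<forall>\<^sub>F n in sequentially. b n < \<delta> / 2 \<and> n > 0"
      using order_tendstoD(2)[OF b_tendsto_zero, of "\<delta> / 2"] \<delta>_pos eventually_gt_at_top[of 0]
      by (auto intro: eventually_conj)
    then have "eventually (\<lambda>q. b (fst q) < \<delta> / 2 \<and> fst q > 0) (in_prob M)"
      by (rule eventually_in_prob_fst)
    \<comment> \<open>With this bound on the largest \<open>norm V\<close> no shift is truncated.\<close>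
    moreover have "\<delta> / (2 * (norm t + 1)) > 0"
      using \<delta>_pos by (intro divide_pos_pos) (auto intro: add_nonneg_pos)
    note max_norm_V[OF this]
    ultimately show ?thesis
    proof eventually_elim
      case (elim q)
      define n where "n = fst q"
      define z where "z i = (lag_vec X (i - 1) (snd q) :: (real, 'p) vec)" for i
      have n: "n > 0" "b n = \<beta> n" using elim(1) by (auto simp: n_def \<beta>_def)
      let ?h = "\<lambda>i. local_shift n t (z i)"
      have h_eq: "?h i = (V (z i) \<bullet> t) / sqrt (real n)" if i: "i \<in> {1..int n}" for i
      proof -
        have "\<bar>V (z i) \<bullet> t\<bar> \<le> norm (V (z i)) * norm t" by (rule Cauchy_Schwarz_ineq2)
        also have "\<dots> \<le> \<delta> / (2 * (norm t + 1)) * sqrt (real n) * (norm t + 1)"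
          using elim(2) i \<delta>_pos unfolding n_def[symmetric] z_def[symmetric]
          by (intro mult_mono) (auto intro!: divide_nonneg_nonneg)
        also have "\<dots> = \<delta> / 2 * sqrt (real n)"
        proof -
          have "\<delta> / (2 * m) * y * m = \<delta> / 2 * y" if "m \<noteq> 0" for m y :: real
            using that by simp
          moreover have "norm t + 1 \<noteq> 0" using norm_ge_zero[of t] by linarith
          ultimately show ?thesis by blast
        qed
        finally show ?thesis
          unfolding local_shift_def using n(1)
          by (intro clip_eq) (simp add: abs_divide pos_divide_le_eq)
      qed
      have split: "linearisation_error n t (snd q) = fl q
          + sqrt (real n) * sample_mean n (\<lambda>i. drift (local_shift n t) (\<beta> n) (z i) - shift_slope 0 * ?h i)
          + shift_slope 0 * (inn q - V_mean \<bullet> t)"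
      proof -
        have "sqrt (real n) * sample_mean n ?h = sample_mean n (\<lambda>i. sqrt (real n) * ?h i)"
          by (simp add: sample_mean_cmult)
        also have "\<dots> = inn q"
          unfolding inn_def n_def[symmetric] z_def[symmetric]
          using n(1) by (intro sample_mean_cong) (simp add: h_eq)
        finally have h: "inn q = sqrt (real n) * sample_mean n ?h" ..
        have "linearisation_error n t (snd q) = sqrt (real n) * sample_mean n
            (\<lambda>i. fluctuation (local_shift n t) (\<beta> n) (eps i (snd q)) (z i)
              + ((drift (local_shift n t) (\<beta> n) (z i) - shift_slope 0 * ?h i) + shift_slope 0 * ?h i))
            - shift_slope 0 * (V_mean \<bullet> t)"
          unfolding linearisation_error_def fluctuation_def[OF local_shift_measurable small] n(2) z_def by simp
        also have "\<dots> = fl q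
          + sqrt (real n) * sample_mean n (\<lambda>i. drift (local_shift n t) (\<beta> n) (z i) - shift_slope 0 * ?h i)
          + shift_slope 0 * (inn q - V_mean \<bullet> t)"
          unfolding sample_mean_add sample_mean_cmult fl_def h n_def z_def by (simp add: algebra_simps)
        finally show ?thesis .
      qed
      have "\<bar>sqrt (real n) * sample_mean n (\<lambda>i. drift (local_shift n t) (\<beta> n) (z i) - shift_slope 0 * ?h i)\<bar>
          \<le> sqrt (real n) * sample_mean n (\<lambda>i. \<bar>drift (local_shift n t) (\<beta> n) (z i) - shift_slope 0 * ?h i\<bar>)"
        unfolding abs_mult by (auto intro!: mult_left_mono abs_sample_mean_le)
      also have "\<dots> \<le> sqrt (real n) * sample_mean n
          (\<lambda>i. 2 * slope_lipschitz * ((norm t)\<^sup>2 / real n) * (norm (V (z i)))\<^sup>2 + 2 * slope_lipschitz * (b n)\<^sup>2)"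
      proof (intro mult_left_mono sample_mean_mono)
        fix i
        have "\<bar>drift (local_shift n t) (\<beta> n) (z i) - shift_slope 0 * ?h i\<bar> \<le> slope_lipschitz * (\<bar>?h i\<bar> + \<bar>\<beta> n\<bar>)\<^sup>2"
          by (rule drift_expansion[OF local_shift_measurable small])
        also have "\<dots> \<le> slope_lipschitz * (2 * ((norm (V (z i)))\<^sup>2 * (norm t)\<^sup>2 / real n) + 2 * (b n)\<^sup>2)"
        proof (intro mult_left_mono slope_lipschitz_nonneg)
          show "(\<bar>?h i\<bar> + \<bar>\<beta> n\<bar>)\<^sup>2 \<le> 2 * ((norm (V (z i)))\<^sup>2 * (norm t)\<^sup>2 / real n) + 2 * (b n)\<^sup>2"
            using sum_squares_le[of "\<bar>?h i\<bar>" "\<bar>\<beta> n\<bar>"] local_shift_square[OF n(1), of t "z i"] n(2) by simp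
        qed
        finally show "\<bar>drift (local_shift n t) (\<beta> n) (z i) - shift_slope 0 * ?h i\<bar>
            \<le> 2 * slope_lipschitz * ((norm t)\<^sup>2 / real n) * (norm (V (z i)))\<^sup>2 + 2 * slope_lipschitz * (b n)\<^sup>2"
          by (simp add: algebra_simps)
      qed simp
      also have "\<dots> = rem q"
      proof -
        have sn: "sqrt (real n) / real n = 1 / sqrt (real n)" 
          using n(1) by (simp add: field_simps)
        have "sqrt (real n) * sample_mean n
          (\<lambda>i. 2 * slope_lipschitz * ((norm t)\<^sup>2 / real n) * (norm (V (z i)))\<^sup>2 + 2 * slope_lipschitz * (b n)\<^sup>2)
          = 2 * slope_lipschitz * (norm t)\<^sup>2 * (sqrt (real n) / real n) * sample_mean n (\<lambda>i. (norm (V (z i)))\<^sup>2)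
            + 2 * slope_lipschitz * (sqrt (real n) * (b n)\<^sup>2)"
          unfolding sample_mean_add sample_mean_cmult sample_mean_const[OF n(1)] by (simp add: algebra_simps)
        then show ?thesis
          unfolding sn rem_def n_def[symmetric] z_def[symmetric] by (simp add: algebra_simps)
      qed
      finally show ?case using split unfolding n_def by linarith
    qed
  qed
  have "((\<lambda>q. \<bar>fl q\<bar> + rem q + \<bar>shift_slope 0 * (inn q - V_mean \<bullet> t)\<bar>)
      \<longlongrightarrow> \<bar>0\<bar> + 0 + \<bar>shift_slope 0 * (V_mean \<bullet> t - V_mean \<bullet> t)\<bar>) (in_prob M)"
    by (rule tendsto_add[OF tendsto_add[OF tendsto_rabs[OF fl] rem]
          tendsto_rabs[OF tendsto_mult_left[OF tendsto_diff[OF inn tendsto_const]]]])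
  then have lim: "((\<lambda>q. \<bar>fl q\<bar> + rem q + \<bar>shift_slope 0 * (inn q - V_mean \<bullet> t)\<bar>) \<longlongrightarrow> 0) (in_prob M)"
    by (simp only: diff_self mult_zero_right abs_zero add_0_right)
  show ?thesis
    by (rule Lim_null_comparison[OF _ lim]) (simp only: real_norm_def bound)
qed

lemma w_V_integrable: "integrable M (\<lambda>\<omega>. w (eps 1 \<omega>) * norm (V (lag_vec X 0 \<omega>)))"
proof -
  have "integrable M (\<lambda>\<omega>. w (eps 1 \<omega>) * norm (V (lag_vec X (1 - 1) \<omega>)))"
    using innovation_integral(1)[of 1 w] w_f_integrable V_integrable
    by (intro product_expectation) auto
  then show ?thesis by simp
qed

theorem linearisation_error_uniform:
  assumes "\<eta> > 0"
  shows "eventually (\<lambda>q. \<forall>t\<in>cball 0 K. \<bar>linearisation_error (fst q) t (snd q)\<bar> < \<eta>) (in_prob M)"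
proof (rule uniformly_small_in_prob[OF linearisation_error_pointwise _ _ assms])
  let ?B = "\<lambda>n \<omega>. L * sample_mean n (\<lambda>i. w (eps i \<omega>) * norm (V (lag_vec X (i - 1) \<omega>))) + \<bar>shift_slope 0\<bar> * norm V_mean"
  have "((\<lambda>q. sample_mean (fst q) (\<lambda>i. w (eps i (snd q)) * norm (V (lag_vec X (i - 1) (snd q)))))
      \<longlongrightarrow> (\<integral>\<omega>. w (eps 1 \<omega>) * norm (V (lag_vec X 0 \<omega>)) \<partial>M)) (in_prob M)"
    by (rule sample_mean_tendsto_in_prob[of "\<lambda>y z. w y * norm (V z)"]) (measurable, rule w_V_integrable)
  then show "((\<lambda>q. ?B (fst q) (snd q)) \<longlongrightarrow>
      L * (\<integral>\<omega>. w (eps 1 \<omega>) * norm (V (lag_vec X 0 \<omega>)) \<partial>M) + \<bar>shift_slope 0\<bar> * norm V_mean) (in_prob M)"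
    by (intro tendsto_intros)
  have "\<forall>\<^sub>F n in sequentially. b n < \<delta> / 2 \<and> n > 0"
    using order_tendstoD(2)[OF b_tendsto_zero, of "\<delta> / 2"] \<delta>_pos eventually_gt_at_top[of 0]
    by (auto intro: eventually_conj)
  then have "eventually (\<lambda>q. b (fst q) < \<delta> / 2 \<and> fst q > 0) (in_prob M)"
    by (rule eventually_in_prob_fst)
  then show "eventually (\<lambda>q. \<forall>s t. \<bar>linearisation_error (fst q) s (snd q) - linearisation_error (fst q) t (snd q)\<bar>
      \<le> ?B (fst q) (snd q) * dist s t) (in_prob M)"
  proof eventually_elim
    case (elim q)
    define n where "n = fst q"
    define z where "z i = (lag_vec X (i - 1) (snd q) :: (real, 'p) vec)" for i
    define e where "e i = eps i (snd q)" for i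
    have n: "n > 0" "b n < \<delta> / 2" using elim by (auto simp: n_def)
    have "\<bar>linearisation_error n s (snd q) - linearisation_error n t (snd q)\<bar> \<le> ?B n (snd q) * dist s t" for s t
    proof -
      have diff: "linearisation_error n s (snd q) - linearisation_error n t (snd q)
          = sqrt (real n) * sample_mean n (\<lambda>i. smoothed (b n) (e i + local_shift n s (z i)) - smoothed (b n) (e i + local_shift n t (z i)))
            + shift_slope 0 * (V_mean \<bullet> (t - s))"
        unfolding linearisation_error_def e_def[symmetric] z_def[symmetric] sample_mean_diff
        by (simp add: inner_diff_right algebra_simps)
      have "\<bar>linearisation_error n s (snd q) - linearisation_error n t (snd q)\<bar>
          \<le> sqrt (real n) * sample_mean n (\<lambda>i. (L * dist s t / sqrt (real n)) * (w (e i) * norm (V (z i))))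
          + \<bar>shift_slope 0\<bar> * (norm V_mean * dist s t)"
        unfolding diff
      proof (rule order_trans[OF abs_triangle_ineq], rule add_mono)
        have "\<bar>sqrt (real n) * sample_mean n (\<lambda>i. smoothed (b n) (e i + local_shift n s (z i)) - smoothed (b n) (e i + local_shift n t (z i)))\<bar>
            \<le> sqrt (real n) * sample_mean n (\<lambda>i. \<bar>smoothed (b n) (e i + local_shift n s (z i)) - smoothed (b n) (e i + local_shift n t (z i))\<bar>)"
          unfolding abs_mult by (auto intro!: mult_left_mono abs_sample_mean_le)
        also have "\<dots> \<le> sqrt (real n) * sample_mean n (\<lambda>i. (L * dist s t / sqrt (real n)) * (w (e i) * norm (V (z i))))"
        proof (intro mult_left_mono sample_mean_mono)
          fix i
          have "\<bar>smoothed (b n) (e i + local_shift n s (z i)) - smoothed (b n) (e i + local_shift n t (z i))\<bar>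
              \<le> L * \<bar>local_shift n s (z i) - local_shift n t (z i)\<bar> * w (e i)"
            using local_shift_le(1)[of n s "z i"] local_shift_le(1)[of n t "z i"] n(2) b_pos[of n]
            by (intro smoothed_lipschitz) auto
          also have "\<dots> \<le> L * (norm (V (z i)) * dist s t / sqrt (real n)) * w (e i)"
          proof (intro mult_right_mono mult_left_mono L_nonneg)
            have "\<bar>local_shift n s (z i) - local_shift n t (z i)\<bar>
                \<le> \<bar>(V (z i) \<bullet> s) / sqrt (real n) - (V (z i) \<bullet> t) / sqrt (real n)\<bar>"
              unfolding local_shift_def by (rule clip_lipschitz)
            also have "\<dots> = \<bar>V (z i) \<bullet> (s - t)\<bar> / sqrt (real n)"
              by (simp add: inner_diff_right diff_divide_distrib[symmetric] abs_divide)
            also have "\<dots> \<le> norm (V (z i)) * dist s t / sqrt (real n)"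
              unfolding dist_norm by (intro divide_right_mono Cauchy_Schwarz_ineq2) simp
            finally show "\<bar>local_shift n s (z i) - local_shift n t (z i)\<bar> \<le> norm (V (z i)) * dist s t / sqrt (real n)" .
            show "0 \<le> w (e i)" using w_ge_1[of "e i"] by simp
          qed
          finally show "\<bar>smoothed (b n) (e i + local_shift n s (z i)) - smoothed (b n) (e i + local_shift n t (z i))\<bar>
              \<le> (L * dist s t / sqrt (real n)) * (w (e i) * norm (V (z i)))"
            by (simp add: mult_ac)
        qed simp
        finally show "\<bar>sqrt (real n) * sample_mean n (\<lambda>i. smoothed (b n) (e i + local_shift n s (z i)) - smoothed (b n) (e i + local_shift n t (z i)))\<bar>
            \<le> sqrt (real n) * sample_mean n (\<lambda>i. (L * dist s t / sqrt (real n)) * (w (e i) * norm (V (z i))))" .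
        show "\<bar>shift_slope 0 * (V_mean \<bullet> (t - s))\<bar> \<le> \<bar>shift_slope 0\<bar> * (norm V_mean * dist s t)"
          unfolding abs_mult dist_norm norm_minus_commute[of s t]
          by (intro mult_left_mono Cauchy_Schwarz_ineq2) simp
      qed
      also have "\<dots> = ?B n (snd q) * dist s t"
        unfolding sample_mean_cmult e_def z_def using n(1) by (simp add: algebra_simps)
      finally show ?thesis .
    qed
    then show ?case unfolding n_def by blast
  qed
qed

end

section \<open>Expansions at the estimator\<close>

text \<open>For limits that need two quantities to be bounded, the localisation is applied twice and hidden behind an
  arbitrary finer filter \<open>F\<close>.\<close>

lemma tendsto_in_prob_localise2:
  assumes Y: "bigO_prob M Y (\<lambda>_. 1)" and Z: "bigO_prob M Z (\<lambda>_. 1)"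
    and lim: "\<And>F K K'. F \<le> in_prob M \<Longrightarrow> K > 0 \<Longrightarrow> K' > 0 \<Longrightarrow>
      eventually (\<lambda>q. norm (Y (fst q) (snd q)) \<le> K) F \<Longrightarrow>
      eventually (\<lambda>q. norm (Z (fst q) (snd q)) \<le> K') F \<Longrightarrow> (f \<longlongrightarrow> l) F"
  shows "(f \<longlongrightarrow> l) (in_prob M)"
  unfolding tendsto_def
proof (intro allI impI)
  fix S assume S: "open S" "l \<in> S"
  show "eventually (\<lambda>q. f q \<in> S) (in_prob M)"
  proof (rule eventually_in_prob_localise[OF Y])
    fix K :: real assume K: "K > 0"
    let ?A = "{q. norm (Y (fst q) (snd q)) \<le> K * 1}"
    have "eventually (\<lambda>q. q \<in> ?A \<longrightarrow> f q \<in> S) (in_prob M)"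
    proof (rule eventually_in_prob_localise[OF Z])
      fix K' :: real assume K': "K' > 0"
      let ?B = "{q. norm (Z (fst q) (snd q)) \<le> K' * 1}"
      let ?F = "inf (inf (in_prob M) (principal ?B)) (principal ?A)"
      have "?F \<le> in_prob M" by (simp add: le_infI1)
      moreover have "eventually (\<lambda>q. q \<in> ?A) ?F"
        unfolding eventually_inf_principal by (rule always_eventually) blast
      moreover have "eventually (\<lambda>q. q \<in> ?B) ?F"
        unfolding eventually_inf_principal by (rule always_eventually) blast
      ultimately have "(f \<longlongrightarrow> l) ?F"
        using K K' by (intro lim[of ?F K K']) auto
      then have "eventually (\<lambda>q. f q \<in> S) ?F" using S by (rule topological_tendstoD)
      then show "eventually (\<lambda>q. q \<in> ?A \<longrightarrow> f q \<in> S) (inf (in_prob M) (principal ?B))"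
        unfolding eventually_inf_principal[of _ "inf (in_prob M) (principal ?B)"] .
    qed simp
    then show "eventually (\<lambda>q. f q \<in> S) (inf (in_prob M) (principal ?A))"
      unfolding eventually_inf_principal .
  qed simp
qed

lemma tendsto_zero_mult_bounded:
  fixes u v :: "'a \<Rightarrow> real"
  assumes u: "eventually (\<lambda>q. \<bar>u q\<bar> \<le> B) F" and v: "(v \<longlongrightarrow> 0) F"
  shows "((\<lambda>q. u q * v q) \<longlongrightarrow> 0) F"
proof -
  have lim: "((\<lambda>q. B * \<bar>v q\<bar>) \<longlongrightarrow> 0) F"
    using tendsto_mult_left[OF tendsto_rabs[OF v], of B] by simp
  have "eventually (\<lambda>q. norm (u q * v q) \<le> B * \<bar>v q\<bar>) F"
    using u by eventually_elim (simp add: abs_mult mult_right_mono)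
  then show ?thesis by (rule Lim_null_comparison[OF _ lim])
qed

lemma eventually_abs_le_if_tendsto:
  fixes u :: "'a \<Rightarrow> real"
  assumes "(u \<longlongrightarrow> c) F"
  shows "eventually (\<lambda>q. \<bar>u q\<bar> \<le> \<bar>c\<bar> + 1) F"
proof -
  have "eventually (\<lambda>q. dist (u q) c < 1) F" by (rule tendstoD[OF assms]) simp
  then show ?thesis by eventually_elim (auto simp: dist_real_def)
qed

lemma sum_three_squares_le: "(a + b + c)\<^sup>2 \<le> 3 * a\<^sup>2 + 3 * b\<^sup>2 + 3 * c\<^sup>2" for a b c :: real
  using zero_le_power2[of "a - b"] zero_le_power2[of "b - c"] zero_le_power2[of "a - c"]
  by (simp add: power2_sum power2_diff algebra_simps power2_eq_square)

context ar_process
begin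

lemma innovation_moments:
  assumes "i \<ge> 1"
  shows "integrable M (eps i)" "(\<integral>\<omega>. eps i \<omega> \<partial>M) = 0"
    "integrable M (\<lambda>\<omega>. (eps i \<omega>)\<^sup>2)" "(\<integral>\<omega>. (eps i \<omega>)\<^sup>2 \<partial>M) = \<sigma>\<^sup>2"
  using model assms unfolding ar_model_def by blast+

lemma density_moments:
  "integrable lborel (\<lambda>y. y\<^sup>2 * f y)" "(\<integral>y. y * f y \<partial>lborel) = 0"
  using innovation_moments[of 1] innovation_integral[of 1 "\<lambda>y. y\<^sup>2"] innovation_integral[of 1 "\<lambda>y. y"]
  by auto

text \<open>A square integrable variable with a density cannot vanish almost surely.\<close>

lemma variance_pos: "\<sigma>\<^sup>2 > 0"
proof -
  have "(\<integral>y. y\<^sup>2 * f y \<partial>lborel) \<noteq> 0"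
  proof
    assume "(\<integral>y. y\<^sup>2 * f y \<partial>lborel) = 0"
    then have "AE y in lborel. y\<^sup>2 * f y = 0"
      using density_moments(1) density_pos by (subst (asm) integral_nonneg_eq_0_iff_AE) (auto simp: less_imp_le)
    then have "AE y in lborel. y = (0 :: real)"
    proof eventually_elim
      case (elim y)
      then show "y = 0" using density_pos[of y] by simp
    qed
    moreover have "AE y in lborel. y \<noteq> (0 :: real)" by (rule AE_lborel_singleton)
    ultimately have "AE y in (lborel :: real measure). False" by eventually_elim simp
    then show False by (subst (asm) AE_iff_measurable[of UNIV]) auto
  qed
  then show ?thesis
    using innovation_moments[of 1] innovation_integral(2)[of 1 "\<lambda>y. y\<^sup>2"] by (auto simp: zero_less_power2)
qed

lemma innovation_mean_bigO:
  "bigO_prob M (\<lambda>n \<omega>. sqrt (real n) * sample_mean n (\<lambda>i. eps i \<omega>)) (\<lambda>_. 1)"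
proof (rule bigO_prob_if_L2)
  have meas: "(\<lambda>(y, z). y) \<in> borel_measurable (borel \<Otimes>\<^sub>M (borel :: (real, 'p) vec measure))" by measurable
  note second = centred_sum_second_moment[of "\<lambda>y z. y" abs 1, OF meas]
  have second: "integrable M (\<lambda>\<omega>. (\<Sum>i=1..int n. eps i \<omega>)\<^sup>2)"
    "(\<integral>\<omega>. (\<Sum>i=1..int n. eps i \<omega>)\<^sup>2 \<partial>M) = (\<Sum>i=1..int n. \<integral>\<omega>. (eps i \<omega>)\<^sup>2 \<partial>M)" for n
    by (rule second; use density_moments in simp)+
  have sq: "(sqrt (real n) * sample_mean n (\<lambda>i. eps i \<omega>))\<^sup>2 = (1 / real n) * (\<Sum>i=1..int n. eps i \<omega>)\<^sup>2" for n \<omega>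
    unfolding sample_mean_def
    by (cases "n = 0") (simp_all add: power_mult_distrib power_divide power2_eq_square[of "real n"])
  show "(\<lambda>\<omega>. sqrt (real n) * sample_mean n (\<lambda>i. eps i \<omega>)) \<in> borel_measurable M" for n
    unfolding sample_mean_def sum_int_interval by measurable
  show "integrable M (\<lambda>\<omega>. (sqrt (real n) * sample_mean n (\<lambda>i. eps i \<omega>))\<^sup>2)" for n
    unfolding sq using second by simp
  show "(\<integral>\<omega>. (sqrt (real n) * sample_mean n (\<lambda>i. eps i \<omega>))\<^sup>2 \<partial>M) \<le> \<sigma>\<^sup>2" for n
    unfolding sq using second innovation_moments(4) by (cases "n = 0") auto
qed

end

text \<open>The regression model enters only through the displacement \<open>d\<close> of the residuals and the displacement \<open>s\<close> of the
  regression function at the fixed point. Both are linear in \<open>Del\<close> up to negligible errors, the first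
  with gradient \<open>v0 - V\<close> at the lag vector and the second with gradient \<open>v0\<close>.\<close>

locale residual_expansion = ar_bandwidth M X eps \<rho> f \<sigma> p f' w g k C L \<delta> V b
  for M :: "'w measure" and X eps :: "int \<Rightarrow> 'w \<Rightarrow> real"
    and \<rho> :: "(real, 'p :: {finite, linorder}) vec \<Rightarrow> real" and f :: "real \<Rightarrow> real" and \<sigma> :: real and p :: nat
    and f' w g k C L \<delta> and V :: "(real, 'p) vec \<Rightarrow> 'v :: euclidean_space" and b +
  fixes v0 :: 'v and Del :: "nat \<Rightarrow> 'w \<Rightarrow> 'v" and s :: "nat \<Rightarrow> 'w \<Rightarrow> real"
    and d res :: "nat \<Rightarrow> 'w \<Rightarrow> int \<Rightarrow> real" and lam :: "nat \<Rightarrow> 'w \<Rightarrow> real"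
  assumes Del_bigO: "bigO_prob M (\<lambda>n \<omega>. sqrt (real n) *\<^sub>R Del n \<omega>) (\<lambda>_. 1)"
    and s_expansion: "((\<lambda>q. sqrt (real (fst q)) * (s (fst q) (snd q) - v0 \<bullet> Del (fst q) (snd q))) \<longlongrightarrow> 0) (in_prob M)"
    and d_expansion: "((\<lambda>q. \<Sum>i=1..int (fst q). (d (fst q) (snd q) i
        - (v0 - V (lag_vec X (i - 1) (snd q))) \<bullet> Del (fst q) (snd q))\<^sup>2) \<longlongrightarrow> 0) (in_prob M)"
    and res_eq: "AE \<omega> in M. \<forall>n. \<forall>i\<ge>1. res n \<omega> i = eps i \<omega> - d n \<omega> i"
    and multiplier: "\<And>n \<omega>. \<omega> \<in> space M \<Longrightarrow> is_multiplier n (res n \<omega>) (lam n \<omega>)"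
begin

definition fitted :: "nat \<Rightarrow> 'w \<Rightarrow> int \<Rightarrow> real" where
  "fitted n \<omega> i = smoothed (b n) (res n \<omega> i + s n \<omega>)"

definition innovation_g_mean :: real where
  "innovation_g_mean = (\<integral>\<omega>. eps 1 \<omega> * g (eps 1 \<omega>) \<partial>M)"

lemma eps_g_integrable: "integrable M (\<lambda>\<omega>. eps 1 \<omega> * g (eps 1 \<omega>))"
proof -
  have "integrable M (\<lambda>\<omega>. (w (eps 1 \<omega>))\<^sup>2)"
    using innovation_integral(1)[of 1 "\<lambda>y. (w y)\<^sup>2"] w_square_integrable by simp
  then have "integrable M (\<lambda>\<omega>. (eps 1 \<omega>)\<^sup>2 + C\<^sup>2 * (w (eps 1 \<omega>))\<^sup>2)"
    using innovation_moments(3)[of 1] by simp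
  then show ?thesis
  proof (rule Bochner_Integration.integrable_bound)
    show "AE \<omega> in M. norm (eps 1 \<omega> * g (eps 1 \<omega>)) \<le> norm ((eps 1 \<omega>)\<^sup>2 + C\<^sup>2 * (w (eps 1 \<omega>))\<^sup>2)"
    proof (rule AE_I2)
      fix \<omega>
      have "2 * \<bar>eps 1 \<omega> * g (eps 1 \<omega>)\<bar> \<le> (eps 1 \<omega>)\<^sup>2 + (g (eps 1 \<omega>))\<^sup>2"
        using zero_le_power2[of "\<bar>eps 1 \<omega>\<bar> - \<bar>g (eps 1 \<omega>)\<bar>"] by (simp add: power2_diff abs_mult)
      moreover have "(g (eps 1 \<omega>))\<^sup>2 \<le> C\<^sup>2 * (w (eps 1 \<omega>))\<^sup>2"
        using power_mono[OF g_growth[of "eps 1 \<omega>"], of 2] by (simp add: power_mult_distrib)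
      ultimately have "\<bar>eps 1 \<omega> * g (eps 1 \<omega>)\<bar> \<le> (eps 1 \<omega>)\<^sup>2 + C\<^sup>2 * (w (eps 1 \<omega>))\<^sup>2" by linarith
      then show "norm (eps 1 \<omega> * g (eps 1 \<omega>)) \<le> norm ((eps 1 \<omega>)\<^sup>2 + C\<^sup>2 * (w (eps 1 \<omega>))\<^sup>2)" by simp
    qed
  qed measurable
qed

definition V_average :: "nat \<times> 'w \<Rightarrow> 'v" where
  "V_average q = (1 / real (fst q)) *\<^sub>R (\<Sum>i=1..int (fst q). V (lag_vec X (i - 1) (snd q)))"

lemma sample_mean_V_inner:
  "sample_mean (fst q) (\<lambda>i. V (lag_vec X (i - 1) (snd q)) \<bullet> t) = V_average q \<bullet> t"
  unfolding sample_mean_def V_average_def by (simp add: inner_sum_left)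

lemma V_average_tendsto: "(V_average \<longlongrightarrow> V_mean) (in_prob M)"
proof -
  have "((\<lambda>q. V_average q \<bullet> i) \<longlongrightarrow> V_mean \<bullet> i) (in_prob M)" for i
    using mean_V_inner[of i] unfolding sample_mean_V_inner .
  then show ?thesis by (subst tendsto_componentwise_iff) simp
qed

lemma max_innovation:
  assumes "\<eta> > 0"
  shows "eventually (\<lambda>q. \<forall>i\<in>{1..int (fst q)}. \<bar>eps i (snd q)\<bar> \<le> \<eta> * sqrt (real (fst q))) (in_prob M)"
  by (rule max_root_negligible_in_prob[of "\<lambda>y _. y"])
     (measurable, use innovation_moments(3)[of 1] assms in simp_all)

text \<open>Along \<open>F\<close> the two stochastically bounded quantities are bounded by constants. The abbreviations fix a point
  \<open>q = (n, \<omega>)\<close>.\<close>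

context
  fixes F :: "(nat \<times> 'w) filter" and K K' :: real
  assumes F_le: "F \<le> in_prob M" and K_pos: "K > 0" and K'_pos: "K' > 0"
    and Del_le: "eventually (\<lambda>q. norm (sqrt (real (fst q)) *\<^sub>R Del (fst q) (snd q)) \<le> K) F"
    and eps_mean_le: "eventually (\<lambda>q. norm (sqrt (real (fst q)) * sample_mean (fst q) (\<lambda>i. eps i (snd q))) \<le> K') F"
begin

abbreviation "rt q \<equiv> sqrt (real (fst q))"
abbreviation "D q \<equiv> Del (fst q) (snd q)"
abbreviation "e q i \<equiv> eps i (snd q)"
abbreviation "z q i \<equiv> lag_vec X (i - 1) (snd q) :: (real, 'p) vec"
abbreviation "rs q i \<equiv> res (fst q) (snd q) i"
abbreviation "dd q i \<equiv> d (fst q) (snd q) i"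
abbreviation "G q i \<equiv> fitted (fst q) (snd q) i"
abbreviation "sm q u \<equiv> sample_mean (fst q) u"
abbreviation "la q \<equiv> lam (fst q) (snd q)"

definition rem where "rem q i = dd q i - (v0 - V (z q i)) \<bullet> D q"
definition kap where "kap q = s (fst q) (snd q) - v0 \<bullet> D q"
text \<open>The total shift of the \<open>i\<close>-th innovation inside \<open>smoothed\<close>; \<open>kap\<close> and \<open>rem\<close> are the errors of linearising the
  regression function at the fixed point and at the lag vectors.\<close>

definition sh where "sh q i = V (z q i) \<bullet> D q + (kap q - rem q i)"
definition remainder_sum where "remainder_sum q = (\<Sum>i=1..int (fst q). (rem q i)\<^sup>2)"
text \<open>A convergent bound for the sum of squares of the displacements of the residuals.\<close>

definition displacement_bound where "displacement_bound q = 3 * K\<^sup>2 * ((norm v0)\<^sup>2 + sm q (\<lambda>i. (norm (V (z q i)))\<^sup>2)) + 3 * remainder_sum q"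

lemmas to_F = tendsto_mono[OF F_le] and ev_F = filter_leD[OF F_le]

lemma ev_pos: "eventually (\<lambda>q. fst q > 0) F"
  by (rule ev_F, rule eventually_in_prob_fst, rule eventually_gt_at_top)

lemma inverse_rt: "((\<lambda>q. 1 / rt q) \<longlongrightarrow> 0) F"
  by (rule to_F, rule filterlim_compose[OF inverse_sqrt_n filterlim_fst_in_prob])

lemma remainder_sum_tendsto: "(remainder_sum \<longlongrightarrow> 0) F"
  using to_F[OF d_expansion] unfolding remainder_sum_def rem_def .

lemma kap_tendsto: "((\<lambda>q. rt q * kap q) \<longlongrightarrow> 0) F"
  using to_F[OF s_expansion] unfolding kap_def .

lemma rem_le: "i \<in> {1..int (fst q)} \<Longrightarrow> \<bar>rem q i\<bar> \<le> sqrt (remainder_sum q)"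
  unfolding remainder_sum_def by (intro real_le_rsqrt, simp, intro member_le_sum) auto

lemma mean_rem_square: "sm q (\<lambda>i. (rem q i)\<^sup>2) = remainder_sum q / real (fst q)"
  unfolding sample_mean_def remainder_sum_def by simp

lemma ev_res: "eventually (\<lambda>q. \<forall>i\<ge>1. rs q i = e q i - dd q i) F"
  by (rule ev_F, rule eventually_mono[OF eventually_in_prob_AE[OF res_eq]]) simp

lemma mean_e_square: "((\<lambda>q. sm q (\<lambda>i. (e q i)\<^sup>2)) \<longlongrightarrow> \<sigma>\<^sup>2) F"
proof -
  have "((\<lambda>q. sm q (\<lambda>i. (e q i)\<^sup>2)) \<longlongrightarrow> (\<integral>\<omega>. (eps 1 \<omega>)\<^sup>2 \<partial>M)) (in_prob M)"
    by (rule sample_mean_tendsto_in_prob[of "\<lambda>y _. y\<^sup>2"]) (measurable, use innovation_moments(3)[of 1] in simp)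
  then show ?thesis using to_F innovation_moments(4)[of 1] by simp
qed

lemma mean_w_square: "((\<lambda>q. sm q (\<lambda>i. (w (e q i))\<^sup>2)) \<longlongrightarrow> w_square_mean) F"
proof -
  have "((\<lambda>q. sm q (\<lambda>i. (w (e q i))\<^sup>2)) \<longlongrightarrow> (\<integral>\<omega>. (w (eps 1 \<omega>))\<^sup>2 \<partial>M)) (in_prob M)"
    by (rule sample_mean_tendsto_in_prob[of "\<lambda>y _. (w y)\<^sup>2"])
       (measurable, use innovation_integral(1)[of 1 "\<lambda>y. (w y)\<^sup>2"] w_square_integrable in simp)
  then show ?thesis using to_F innovation_integral(2)[of 1 "\<lambda>y. (w y)\<^sup>2"] by (simp add: w_square_mean_def)
qed

lemma mean_e_g: "((\<lambda>q. sm q (\<lambda>i. e q i * g (e q i))) \<longlongrightarrow> innovation_g_mean) F"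
  unfolding innovation_g_mean_def
  by (rule to_F, rule sample_mean_tendsto_in_prob[of "\<lambda>y _. y * g y"]) (measurable, rule eps_g_integrable)

lemma displacement_bound_tendsto:
  "(displacement_bound \<longlongrightarrow> 3 * K\<^sup>2 * ((norm v0)\<^sup>2 + (\<integral>\<omega>. (norm (V (lag_vec X 0 \<omega>)))\<^sup>2 \<partial>M)) + 3 * 0) F"
  unfolding displacement_bound_def by (intro tendsto_intros to_F[OF mean_norm_V_square] remainder_sum_tendsto)

lemma ev_V_D:
  assumes "\<eta> > 0"
  shows "eventually (\<lambda>q. \<forall>i\<in>{1..int (fst q)}. \<bar>V (z q i) \<bullet> D q\<bar> \<le> \<eta>) F"
proof -
  have pos: "\<eta> / K > 0" using assms K_pos by simp
  show ?thesis
    using ev_F[OF max_norm_V[OF pos]] Del_le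
  proof eventually_elim
    case (elim q)
    show ?case
    proof
      fix i assume i: "i \<in> {1..int (fst q)}"
      have "\<bar>V (z q i) \<bullet> D q\<bar> \<le> norm (V (z q i)) * norm (D q)" by (rule Cauchy_Schwarz_ineq2)
      also have "\<dots> \<le> \<eta> / K * rt q * norm (D q)"
        using elim(1) i by (intro mult_right_mono) auto
      also have "\<dots> = \<eta> / K * (rt q * norm (D q))" by simp
      also have "\<dots> \<le> \<eta> / K * K"
        using elim(2) pos by (intro mult_left_mono) auto
      also have "\<dots> = \<eta>" using K_pos by simp
      finally show "\<bar>V (z q i) \<bullet> D q\<bar> \<le> \<eta>" .
    qed
  qed
qed

lemma ev_sh_rem:
  assumes "\<eta> > 0"
  shows "eventually (\<lambda>q. \<forall>i\<in>{1..int (fst q)}. \<bar>kap q - rem q i\<bar> \<le> \<eta>) F"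
proof -
  have "((\<lambda>q. sqrt (remainder_sum q)) \<longlongrightarrow> sqrt 0) F" by (intro tendsto_real_sqrt remainder_sum_tendsto)
  then have "eventually (\<lambda>q. sqrt (remainder_sum q) < \<eta> / 2) F"
    by (rule order_tendstoD(2)) (use assms in simp)
  moreover have "eventually (\<lambda>q. \<bar>rt q * kap q\<bar> < \<eta> / 2) F"
    using tendstoD[OF kap_tendsto, of "\<eta> / 2"] assms by simp
  ultimately show ?thesis
    using ev_pos
  proof eventually_elim
    case (elim q)
    have "1 * \<bar>kap q\<bar> \<le> rt q * \<bar>kap q\<bar>" using elim(3) by (intro mult_right_mono) auto
    then have "\<bar>kap q\<bar> < \<eta> / 2" using elim(2) by (simp add: abs_mult)
    then show ?case using rem_le[of _ q] elim(1) by fastforce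
  qed
qed

lemma ev_sh:
  assumes "\<eta> > 0"
  shows "eventually (\<lambda>q. \<forall>i\<in>{1..int (fst q)}. \<bar>sh q i\<bar> \<le> \<eta>) F"
proof -
  have half: "\<eta> / 2 > 0" using assms by simp
  show ?thesis
    using ev_V_D[OF half] ev_sh_rem[OF half]
  proof eventually_elim
    case (elim q)
    show ?case
    proof
      fix i assume "i \<in> {1..int (fst q)}"
      then have "\<bar>V (z q i) \<bullet> D q\<bar> \<le> \<eta> / 2" "\<bar>kap q - rem q i\<bar> \<le> \<eta> / 2"
        using elim by auto
      then show "\<bar>sh q i\<bar> \<le> \<eta>" unfolding sh_def by linarith
    qed
  qed
qed

lemma ev_b: "\<eta> > 0 \<Longrightarrow> eventually (\<lambda>q. b (fst q) < \<eta>) F"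
  by (rule ev_F, rule eventually_in_prob_fst, rule order_tendstoD(2)[OF b_tendsto_zero])

lemma ev_G: "eventually (\<lambda>q. \<forall>i\<in>{1..int (fst q)}. G q i = smoothed (b (fst q)) (e q i + sh q i)) F"
  using ev_res
proof eventually_elim
  case (elim q)
  show ?case
  proof
    fix i assume "i \<in> {1..int (fst q)}"
    then have "rs q i + s (fst q) (snd q) = e q i + sh q i"
      using elim by (simp add: sh_def kap_def rem_def inner_diff_left)
    then show "G q i = smoothed (b (fst q)) (e q i + sh q i)" unfolding fitted_def by simp
  qed
qed

lemma ev_G_close:
  assumes "\<eta> > 0"
  shows "eventually (\<lambda>q. \<forall>i\<in>{1..int (fst q)}. \<bar>G q i - g (e q i)\<bar> \<le> L * \<eta> * w (e q i)) F"
proof -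
  define \<eta>' where "\<eta>' = min (\<eta> / 2) (\<delta> / 2)"
  have \<eta>': "\<eta>' > 0" "2 * \<eta>' \<le> \<eta>" "2 * \<eta>' \<le> \<delta>" using assms \<delta>_pos by (auto simp: \<eta>'_def)
  show ?thesis
    using ev_G ev_sh[OF \<eta>'(1)] ev_b[OF \<eta>'(1)]
  proof eventually_elim
    case (elim q)
    show ?case
    proof
      fix i assume i: "i \<in> {1..int (fst q)}"
      have small: "\<bar>sh q i\<bar> + \<bar>b (fst q)\<bar> \<le> 2 * \<eta>'"
        using elim(2,3) i b_pos[of "fst q"] by fastforce
      then have "\<bar>G q i - g (e q i)\<bar> \<le> L * (\<bar>sh q i\<bar> + \<bar>b (fst q)\<bar>) * w (e q i)"
        using elim(1) i \<eta>'(3) by (simp add: smoothed_minus_le)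
      also have "\<dots> \<le> L * \<eta> * w (e q i)"
        using small \<eta>'(2) L_nonneg w_ge_1[of "e q i"] by (intro mult_right_mono mult_left_mono) auto
      finally show "\<bar>G q i - g (e q i)\<bar> \<le> L * \<eta> * w (e q i)" .
    qed
  qed
qed

lemma ev_G_bound: "eventually (\<lambda>q. \<forall>i\<in>{1..int (fst q)}. \<bar>G q i\<bar> \<le> (C + L) * w (e q i)) F"
  using ev_G_close[of 1, simplified]
proof eventually_elim
  case (elim q)
  show ?case
  proof
    fix i assume "i \<in> {1..int (fst q)}"
    then show "\<bar>G q i\<bar> \<le> (C + L) * w (e q i)"
      using elim g_growth[of "e q i"] by (fastforce simp: distrib_right)
  qed
qed

lemma linearisation_error_at_estimate:
  "((\<lambda>q. linearisation_error (fst q) (rt q *\<^sub>R D q) (snd q)) \<longlongrightarrow> 0) F"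
proof (rule tendstoI)
  fix \<eta> :: real assume "\<eta> > 0"
  from ev_F[OF linearisation_error_uniform[OF this, of K]] Del_le
  show "eventually (\<lambda>q. dist (linearisation_error (fst q) (rt q *\<^sub>R D q) (snd q)) 0 < \<eta>) F"
    by eventually_elim (simp add: mem_cball_0)
qed

text \<open>Replacing the shifts by their linear parts costs, by the Lipschitz property and the Cauchy-Schwarz inequality, at most
  the root of a vanishing sum of squares times the root of a mean of \<open>w\<^sup>2\<close>. What remains is the
  linearisation error at \<open>\<surd>n \<Delta>\<close>.\<close>

lemma unweighted_expansion_F:
  "((\<lambda>q. rt q * (sm q (G q) - (sm q (\<lambda>i. g (e q i)) + (shift_slope 0 *\<^sub>R V_mean) \<bullet> D q))) \<longlongrightarrow> 0) F"
proof -
  define err where "err q = rt q * sm q (\<lambda>i. G q i - smoothed (b (fst q)) (e q i + V (z q i) \<bullet> D q))" for q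
  define Q' where "Q' q = 2 * (rt q * kap q)\<^sup>2 + 2 * remainder_sum q" for q
  have "((\<lambda>q. L * (sqrt (Q' q) * sqrt (sm q (\<lambda>i. (w (e q i))\<^sup>2)))) \<longlongrightarrow>
      L * (sqrt (2 * 0\<^sup>2 + 2 * 0) * sqrt w_square_mean)) F"
    unfolding Q'_def by (intro tendsto_intros kap_tendsto remainder_sum_tendsto mean_w_square)
  then have lim: "((\<lambda>q. L * (sqrt (Q' q) * sqrt (sm q (\<lambda>i. (w (e q i))\<^sup>2)))) \<longlongrightarrow> 0) F"
    by simp
  have quarter: "\<delta> / 4 > 0" using \<delta>_pos by simp
  have "eventually (\<lambda>q. norm (err q) \<le> L * (sqrt (Q' q) * sqrt (sm q (\<lambda>i. (w (e q i))\<^sup>2)))) F"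
    using ev_G ev_V_D[OF quarter] ev_sh_rem[OF quarter] ev_b[OF quarter] ev_pos
  proof eventually_elim
    case (elim q)
    let ?r = "\<lambda>i. kap q - rem q i"
    have "\<bar>err q\<bar> \<le> rt q * sm q (\<lambda>i. \<bar>G q i - smoothed (b (fst q)) (e q i + V (z q i) \<bullet> D q)\<bar>)"
      unfolding err_def abs_mult by (auto intro!: mult_left_mono abs_sample_mean_le)
    also have "\<dots> \<le> rt q * sm q (\<lambda>i. L * \<bar>?r i * w (e q i)\<bar>)"
    proof (intro mult_left_mono sample_mean_mono)
      fix i assume i: "i \<in> {1..int (fst q)}"
      have "\<bar>smoothed (b (fst q)) (e q i + sh q i) - smoothed (b (fst q)) (e q i + V (z q i) \<bullet> D q)\<bar>
          \<le> L * \<bar>sh q i - V (z q i) \<bullet> D q\<bar> * w (e q i)"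
      proof (rule smoothed_lipschitz)
        have *: "\<bar>V (z q i) \<bullet> D q\<bar> \<le> \<delta> / 4" "\<bar>?r i\<bar> \<le> \<delta> / 4" "b (fst q) < \<delta> / 4"
          using elim i by auto
        then show "\<bar>sh q i\<bar> + \<bar>b (fst q)\<bar> \<le> \<delta>" "\<bar>V (z q i) \<bullet> D q\<bar> + \<bar>b (fst q)\<bar> \<le> \<delta>"
          using b_pos[of "fst q"] \<delta>_pos unfolding sh_def by linarith+
      qed
      then show "\<bar>G q i - smoothed (b (fst q)) (e q i + V (z q i) \<bullet> D q)\<bar> \<le> L * \<bar>?r i * w (e q i)\<bar>"
        using elim(1) i w_ge_1[of "e q i"] by (simp add: sh_def abs_mult mult.assoc)
    qed simp
    also have "\<dots> = L * (rt q * sm q (\<lambda>i. \<bar>?r i * w (e q i)\<bar>))"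
      by (simp add: sample_mean_cmult)
    also have "\<dots> \<le> L * (rt q * (sqrt (sm q (\<lambda>i. (?r i)\<^sup>2)) * sqrt (sm q (\<lambda>i. (w (e q i))\<^sup>2))))"
      using L_nonneg by (intro mult_left_mono sample_mean_Cauchy_Schwarz) auto
    also have "\<dots> = L * (sqrt (real (fst q) * sm q (\<lambda>i. (?r i)\<^sup>2)) * sqrt (sm q (\<lambda>i. (w (e q i))\<^sup>2)))"
      by (simp add: real_sqrt_mult)
    also have "\<dots> \<le> L * (sqrt (Q' q) * sqrt (sm q (\<lambda>i. (w (e q i))\<^sup>2)))"
    proof (intro mult_left_mono mult_right_mono real_sqrt_le_mono L_nonneg)
      have "sm q (\<lambda>i. (?r i)\<^sup>2) \<le> sm q (\<lambda>i. 2 * (kap q)\<^sup>2 + 2 * (rem q i)\<^sup>2)"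
        using sum_squares_le[of "kap q" "- rem q _"] by (intro sample_mean_mono) simp
      also have "\<dots> = 2 * (kap q)\<^sup>2 + 2 * (remainder_sum q / real (fst q))"
        unfolding sample_mean_add sample_mean_cmult mean_rem_square using elim(5) by (simp add: sample_mean_const)
      finally show "real (fst q) * sm q (\<lambda>i. (?r i)\<^sup>2) \<le> Q' q"
        using elim(5) mult_left_mono[of "sm q (\<lambda>i. (?r i)\<^sup>2)" "2 * (kap q)\<^sup>2 + 2 * (remainder_sum q / real (fst q))" "real (fst q)"]
        by (simp add: Q'_def power_mult_distrib distrib_left mult_ac)
      show "0 \<le> sqrt (sm q (\<lambda>i. (w (e q i))\<^sup>2))" by (intro real_sqrt_ge_zero sample_mean_nonneg) simp
    qed
    finally show ?case by simp
  qed
  then have err: "(err \<longlongrightarrow> 0) F" by (rule Lim_null_comparison[OF _ lim])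
  have half: "\<delta> / 2 > 0" using \<delta>_pos by simp
  have "eventually (\<lambda>q. err q + linearisation_error (fst q) (rt q *\<^sub>R D q) (snd q)
      = rt q * (sm q (G q) - (sm q (\<lambda>i. g (e q i)) + (shift_slope 0 *\<^sub>R V_mean) \<bullet> D q))) F"
    using ev_V_D[OF half] ev_pos
  proof eventually_elim
    case (elim q)
    have "local_shift (fst q) (rt q *\<^sub>R D q) (z q i) = V (z q i) \<bullet> D q" if "i \<in> {1..int (fst q)}" for i
      unfolding local_shift_def using elim that by (simp add: clip_eq)
    then have "sm q (\<lambda>i. smoothed (b (fst q)) (e q i + local_shift (fst q) (rt q *\<^sub>R D q) (z q i)) - g (e q i))
        = sm q (\<lambda>i. smoothed (b (fst q)) (e q i + V (z q i) \<bullet> D q) - g (e q i))"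
      by (intro sample_mean_cong) simp
    then show ?case
      unfolding err_def linearisation_error_def by (simp add: sample_mean_diff algebra_simps)
  qed
  moreover have "((\<lambda>q. err q + linearisation_error (fst q) (rt q *\<^sub>R D q) (snd q)) \<longlongrightarrow> 0 + 0) F"
    by (intro tendsto_add err linearisation_error_at_estimate)
  ultimately show ?thesis by (simp add: tendsto_cong)
qed

lemma ev_mean_d_square: "eventually (\<lambda>q. real (fst q) * sm q (\<lambda>i. (dd q i)\<^sup>2) \<le> displacement_bound q) F"
  using ev_pos Del_le
proof eventually_elim
  case (elim q)
  have "sm q (\<lambda>i. (dd q i)\<^sup>2)
      \<le> sm q (\<lambda>i. 3 * (norm (D q))\<^sup>2 * (norm v0)\<^sup>2 + 3 * (norm (D q))\<^sup>2 * (norm (V (z q i)))\<^sup>2 + 3 * (rem q i)\<^sup>2)"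
  proof (rule sample_mean_mono)
    fix i
    have inner_sq: "(u \<bullet> D q)\<^sup>2 \<le> (norm (D q))\<^sup>2 * (norm u)\<^sup>2" for u
      using Cauchy_Schwarz_ineq[of u "D q"] by (simp add: power2_norm_eq_inner mult.commute)
    have "dd q i = v0 \<bullet> D q + (- (V (z q i) \<bullet> D q)) + rem q i"
      by (simp add: rem_def inner_diff_left)
    then have "(dd q i)\<^sup>2 \<le> 3 * (v0 \<bullet> D q)\<^sup>2 + 3 * (V (z q i) \<bullet> D q)\<^sup>2 + 3 * (rem q i)\<^sup>2"
      using sum_three_squares_le[of "v0 \<bullet> D q" "- (V (z q i) \<bullet> D q)" "rem q i"] by simp
    then show "(dd q i)\<^sup>2 \<le> 3 * (norm (D q))\<^sup>2 * (norm v0)\<^sup>2 + 3 * (norm (D q))\<^sup>2 * (norm (V (z q i)))\<^sup>2 + 3 * (rem q i)\<^sup>2"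
      using inner_sq[of v0] inner_sq[of "V (z q i)"] by linarith
  qed
  also have "\<dots> = 3 * (norm (D q))\<^sup>2 * ((norm v0)\<^sup>2 + sm q (\<lambda>i. (norm (V (z q i)))\<^sup>2)) + 3 * (remainder_sum q / real (fst q))"
    unfolding sample_mean_add sample_mean_cmult mean_rem_square sample_mean_const[OF elim(1)]
    by (simp add: algebra_simps)
  finally have "real (fst q) * sm q (\<lambda>i. (dd q i)\<^sup>2)
      \<le> real (fst q) * (3 * (norm (D q))\<^sup>2 * ((norm v0)\<^sup>2 + sm q (\<lambda>i. (norm (V (z q i)))\<^sup>2)) + 3 * (remainder_sum q / real (fst q)))"
    by (intro mult_left_mono) auto
  also have "\<dots> = 3 * (norm (rt q *\<^sub>R D q))\<^sup>2 * ((norm v0)\<^sup>2 + sm q (\<lambda>i. (norm (V (z q i)))\<^sup>2)) + 3 * remainder_sum q"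
    using elim(1) by (simp add: power_mult_distrib distrib_left mult_ac)
  also have "\<dots> \<le> 3 * K\<^sup>2 * ((norm v0)\<^sup>2 + sm q (\<lambda>i. (norm (V (z q i)))\<^sup>2)) + 3 * remainder_sum q"
  proof (intro add_right_mono mult_right_mono mult_left_mono power_mono elim(2))
    show "0 \<le> (norm v0)\<^sup>2 + sm q (\<lambda>i. (norm (V (z q i)))\<^sup>2)"
      by (intro add_nonneg_nonneg sample_mean_nonneg) auto
  qed auto
  finally show ?case unfolding displacement_bound_def .
qed

lemma mean_square_nonneg: "0 \<le> sm q (\<lambda>i. (u i)\<^sup>2)"
  by (intro sample_mean_nonneg) simp

lemma mean_d_square: "((\<lambda>q. sm q (\<lambda>i. (dd q i)\<^sup>2)) \<longlongrightarrow> 0) F"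
proof -
  have "((\<lambda>q. displacement_bound q * (1 / rt q)\<^sup>2) \<longlongrightarrow>
      (3 * K\<^sup>2 * ((norm v0)\<^sup>2 + (\<integral>\<omega>. (norm (V (lag_vec X 0 \<omega>)))\<^sup>2 \<partial>M)) + 3 * 0) * 0\<^sup>2) F"
    by (intro tendsto_mult tendsto_power displacement_bound_tendsto inverse_rt)
  then have lim: "((\<lambda>q. displacement_bound q * (1 / rt q)\<^sup>2) \<longlongrightarrow> 0) F" by simp
  have "eventually (\<lambda>q. norm (sm q (\<lambda>i. (dd q i)\<^sup>2)) \<le> displacement_bound q * (1 / rt q)\<^sup>2) F"
    using ev_mean_d_square ev_pos
  proof eventually_elim
    case (elim q)
    then have "sm q (\<lambda>i. (dd q i)\<^sup>2) \<le> displacement_bound q / real (fst q)"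
      by (simp add: pos_le_divide_eq mult.commute)
    then show ?case using mean_square_nonneg[of q "dd q"] by (simp add: power_divide)
  qed
  then show ?thesis by (rule Lim_null_comparison[OF _ lim])
qed

text \<open>The innovations are uniformly \<open>o\<^sub>p(\<surd>n)\<close> and the displacements uniformly \<open>O\<^sub>p(1)\<close>.\<close>

lemma ev_max_res:
  assumes "\<eta> > 0"
  shows "eventually (\<lambda>q. \<forall>i\<in>{1..int (fst q)}. \<bar>rs q i\<bar> \<le> \<eta> * rt q) F"
proof -
  have half: "\<eta> / 2 > 0" using assms by simp
  have "((\<lambda>q. sqrt (displacement_bound q) * (1 / rt q)) \<longlongrightarrow>
      sqrt (3 * K\<^sup>2 * ((norm v0)\<^sup>2 + (\<integral>\<omega>. (norm (V (lag_vec X 0 \<omega>)))\<^sup>2 \<partial>M)) + 3 * 0) * 0) F"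
    by (intro tendsto_mult tendsto_real_sqrt displacement_bound_tendsto inverse_rt)
  then have "((\<lambda>q. sqrt (displacement_bound q) * (1 / rt q)) \<longlongrightarrow> 0) F" by simp
  then have "eventually (\<lambda>q. sqrt (displacement_bound q) * (1 / rt q) < \<eta> / 2) F"
    by (rule order_tendstoD(2)) (use assms in simp)
  then show ?thesis
    using ev_F[OF max_innovation[OF half]] ev_res ev_mean_d_square ev_pos
  proof eventually_elim
    case (elim q)
    have displacement_bound: "sqrt (displacement_bound q) \<le> \<eta> / 2 * rt q"
      using elim(1,5) by (simp add: pos_divide_less_eq less_imp_le)
    show ?case
    proof
      fix i assume i: "i \<in> {1..int (fst q)}"
      have "(dd q i)\<^sup>2 \<le> (\<Sum>i=1..int (fst q). (dd q i)\<^sup>2)"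
        using i by (intro member_le_sum) auto
      also have "\<dots> = real (fst q) * sm q (\<lambda>i. (dd q i)\<^sup>2)"
        using elim(5) by (simp add: sample_mean_def)
      also have "\<dots> \<le> displacement_bound q" by (rule elim(4))
      finally have "\<bar>dd q i\<bar> \<le> sqrt (displacement_bound q)" by (intro real_le_rsqrt) simp
      moreover have "\<bar>e q i\<bar> \<le> \<eta> / 2 * rt q" "rs q i = e q i - dd q i"
        using elim(2,3) i by auto
      ultimately show "\<bar>rs q i\<bar> \<le> \<eta> * rt q" using displacement_bound by (simp add: abs_le_iff; linarith)
    qed
  qed
qed

lemma mean_res_square: "((\<lambda>q. sm q (\<lambda>i. (rs q i)\<^sup>2)) \<longlongrightarrow> \<sigma>\<^sup>2) F"
proof -
  have cross: "((\<lambda>q. sm q (\<lambda>i. e q i * dd q i)) \<longlongrightarrow> 0) F"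
  proof -
    have "((\<lambda>q. sqrt (sm q (\<lambda>i. (e q i)\<^sup>2)) * sqrt (sm q (\<lambda>i. (dd q i)\<^sup>2))) \<longlongrightarrow> sqrt (\<sigma>\<^sup>2) * sqrt 0) F"
      by (intro tendsto_mult tendsto_real_sqrt mean_e_square mean_d_square)
    then have lim: "((\<lambda>q. sqrt (sm q (\<lambda>i. (e q i)\<^sup>2)) * sqrt (sm q (\<lambda>i. (dd q i)\<^sup>2))) \<longlongrightarrow> 0) F" by simp
    have "norm (sm q (\<lambda>i. e q i * dd q i)) \<le> sqrt (sm q (\<lambda>i. (e q i)\<^sup>2)) * sqrt (sm q (\<lambda>i. (dd q i)\<^sup>2))" for q
      unfolding real_norm_def by (rule order_trans[OF abs_sample_mean_le sample_mean_Cauchy_Schwarz])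
    then show ?thesis by (intro Lim_null_comparison[OF always_eventually lim]) blast
  qed
  have "((\<lambda>q. sm q (\<lambda>i. (e q i)\<^sup>2) - 2 * sm q (\<lambda>i. e q i * dd q i) + sm q (\<lambda>i. (dd q i)\<^sup>2)) \<longlongrightarrow> \<sigma>\<^sup>2 - 2 * 0 + 0) F"
    by (intro tendsto_add tendsto_diff tendsto_mult_left mean_e_square mean_d_square cross)
  then have lim: "((\<lambda>q. sm q (\<lambda>i. (e q i)\<^sup>2) - 2 * sm q (\<lambda>i. e q i * dd q i) + sm q (\<lambda>i. (dd q i)\<^sup>2)) \<longlongrightarrow> \<sigma>\<^sup>2) F"
    by simp
  have "eventually (\<lambda>q. sm q (\<lambda>i. (e q i)\<^sup>2) - 2 * sm q (\<lambda>i. e q i * dd q i) + sm q (\<lambda>i. (dd q i)\<^sup>2)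
      = sm q (\<lambda>i. (rs q i)\<^sup>2)) F"
    using ev_res
  proof eventually_elim
    case (elim q)
    have "sm q (\<lambda>i. (rs q i)\<^sup>2) = sm q (\<lambda>i. (e q i)\<^sup>2 - 2 * (e q i * dd q i) + (dd q i)\<^sup>2)"
      by (rule sample_mean_cong) (use elim in \<open>simp add: power2_diff\<close>)
    then show ?case unfolding sample_mean_add sample_mean_diff sample_mean_cmult by simp
  qed
  then show ?thesis using lim by (simp add: tendsto_cong)
qed

definition linear_residual_mean where
  "linear_residual_mean q = rt q * sm q (e q) - (v0 - V_mean) \<bullet> (rt q *\<^sub>R D q)"

lemma mean_res: "((\<lambda>q. rt q * sm q (rs q) - linear_residual_mean q) \<longlongrightarrow> 0) F"
proof -
  have lim1: "((\<lambda>q. norm (V_average q - V_mean)) \<longlongrightarrow> 0) F"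
    using tendsto_norm_zero[OF LIM_zero[OF to_F[OF V_average_tendsto]]] .
  have "((\<lambda>q. norm (V_average q - V_mean) * K + sqrt (remainder_sum q)) \<longlongrightarrow> 0 * K + sqrt 0) F"
    by (intro tendsto_add tendsto_mult_right tendsto_real_sqrt lim1 remainder_sum_tendsto)
  then have lim: "((\<lambda>q. norm (V_average q - V_mean) * K + sqrt (remainder_sum q)) \<longlongrightarrow> 0) F" by simp
  have "eventually (\<lambda>q. norm (rt q * sm q (rs q) - linear_residual_mean q)
      \<le> norm (V_average q - V_mean) * K + sqrt (remainder_sum q)) F"
    using ev_res ev_pos Del_le
  proof eventually_elim
    case (elim q)
    have "sm q (rs q) = sm q (\<lambda>i. e q i - (v0 \<bullet> D q - V (z q i) \<bullet> D q + rem q i))"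
      by (rule sample_mean_cong) (use elim in \<open>simp add: rem_def inner_diff_left\<close>)
    also have "\<dots> = sm q (e q) - v0 \<bullet> D q + V_average q \<bullet> D q - sm q (rem q)"
      unfolding sample_mean_add sample_mean_diff sample_mean_V_inner sample_mean_const[OF elim(2)] by simp
    finally have mean_rs: "sm q (rs q) = sm q (e q) - v0 \<bullet> D q + V_average q \<bullet> D q - sm q (rem q)" .
    have "rt q * sm q (rs q) - linear_residual_mean q
        = (V_average q - V_mean) \<bullet> (rt q *\<^sub>R D q) - rt q * sm q (rem q)"
      unfolding linear_residual_mean_def mean_rs by (simp add: algebra_simps inner_diff_left)
    moreover have "\<bar>(V_average q - V_mean) \<bullet> (rt q *\<^sub>R D q)\<bar> \<le> norm (V_average q - V_mean) * K"
      by (rule order_trans[OF Cauchy_Schwarz_ineq2 mult_left_mono[OF elim(3)]]) simp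
    moreover have "\<bar>rt q * sm q (rem q)\<bar> \<le> sqrt (remainder_sum q)"
    proof -
      have "\<bar>sm q (rem q)\<bar> \<le> sm q (\<lambda>i. \<bar>1 * rem q i\<bar>)" using abs_sample_mean_le[of "fst q" "rem q"] by simp
      also have "\<dots> \<le> sqrt (sm q (\<lambda>i. 1\<^sup>2)) * sqrt (sm q (\<lambda>i. (rem q i)\<^sup>2))"
        by (rule sample_mean_Cauchy_Schwarz)
      also have "\<dots> = sqrt (remainder_sum q) / rt q"
        unfolding mean_rem_square sample_mean_const[OF elim(2)] by (simp add: real_sqrt_divide)
      finally show ?thesis using elim(2) by (simp add: abs_mult pos_le_divide_eq mult.commute)
    qed
    ultimately show ?case unfolding real_norm_def by linarith
  qed
  then show ?thesis by (rule Lim_null_comparison[OF _ lim])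
qed

definition residual_mean_bound :: real where
  "residual_mean_bound = K' + norm (v0 - V_mean) * K + 1"

lemma residual_mean_bound_pos: "residual_mean_bound > 0"
  unfolding residual_mean_bound_def using K_pos K'_pos by (intro add_nonneg_pos add_nonneg_nonneg mult_nonneg_nonneg) auto

lemma ev_mean_res_bound: "eventually (\<lambda>q. \<bar>rt q * sm q (rs q)\<bar> \<le> residual_mean_bound) F"
  using eventually_abs_le_if_tendsto[OF mean_res] Del_le eps_mean_le
proof eventually_elim
  case (elim q)
  have "\<bar>(v0 - V_mean) \<bullet> (rt q *\<^sub>R D q)\<bar> \<le> norm (v0 - V_mean) * K"
    by (rule order_trans[OF Cauchy_Schwarz_ineq2 mult_left_mono[OF elim(2)]]) simp
  then show ?case
    using elim(1,3) unfolding linear_residual_mean_def residual_mean_bound_def real_norm_def by linarith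
qed

definition scaled_multiplier_bound :: real where
  "scaled_multiplier_bound = 4 * residual_mean_bound / \<sigma>\<^sup>2"

lemma multiplier_bound_pos: "scaled_multiplier_bound > 0"
  unfolding scaled_multiplier_bound_def using residual_mean_bound_pos variance_pos by simp

text \<open>The constant \<open>\<eta>\<close> is chosen such that the largest residual times the mean residual stays below half of the mean square,
  which yields both existence and the bound.\<close>

lemma ev_multiplier: "eventually (\<lambda>q. admissible_multiplier (fst q) (rs q) (la q) \<and> rt q * \<bar>la q\<bar> \<le> scaled_multiplier_bound) F"
proof -
  define \<eta> where "\<eta> = \<sigma>\<^sup>2 / (4 * residual_mean_bound)"
  have \<eta>: "\<eta> > 0" "\<eta> * residual_mean_bound = \<sigma>\<^sup>2 / 4"
    unfolding \<eta>_def using residual_mean_bound_pos variance_pos by auto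
  have "eventually (\<lambda>q. sm q (\<lambda>i. (rs q i)\<^sup>2) > \<sigma>\<^sup>2 / 2) F"
    by (rule order_tendstoD(1)[OF mean_res_square]) (use variance_pos in simp)
  then show ?thesis
    using ev_max_res[OF \<eta>(1)] ev_mean_res_bound ev_pos ev_F[OF eventually_in_prob_space]
  proof eventually_elim
    case (elim q)
    let ?m = "sm q (rs q)" and ?S = "sm q (\<lambda>i. (rs q i)\<^sup>2)"
    have Zm: "\<eta> * rt q * \<bar>?m\<bar> \<le> \<sigma>\<^sup>2 / 4"
    proof -
      have "\<eta> * rt q * \<bar>?m\<bar> = \<eta> * \<bar>rt q * ?m\<bar>" by (simp add: abs_mult)
      also have "\<dots> \<le> \<eta> * residual_mean_bound" using elim(3) \<eta>(1) by (intro mult_left_mono) auto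
      finally show ?thesis using \<eta>(2) by simp
    qed
    have Z: "\<And>i. i \<in> {1..int (fst q)} \<Longrightarrow> \<bar>rs q i\<bar> \<le> \<eta> * rt q" using elim(2) by blast
    have "\<exists>l. admissible_multiplier (fst q) (rs q) l"
    proof (rule multiplier_exists_if_mean_small[OF elim(4) Z])
      have "\<sigma>\<^sup>2 / 4 < ?S" using elim(1) variance_pos by linarith
      then show "\<eta> * rt q * \<bar>?m\<bar> < ?S" by (rule le_less_trans[OF Zm])
    qed
    then have adm: "admissible_multiplier (fst q) (rs q) (la q)"
      using multiplier[OF elim(5), of "fst q"] unfolding is_multiplier_def by simp
    have "\<bar>la q\<bar> * (\<sigma>\<^sup>2 / 4) \<le> \<bar>la q\<bar> * (?S - \<eta> * rt q * \<bar>?m\<bar>)"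
      using Zm elim(1) by (intro mult_left_mono) auto
    also have "\<dots> \<le> \<bar>?m\<bar>" by (rule multiplier_bound[OF elim(4) adm Z])
    finally have "rt q * (\<bar>la q\<bar> * (\<sigma>\<^sup>2 / 4)) \<le> rt q * \<bar>?m\<bar>" by (intro mult_left_mono) auto
    also have "\<dots> \<le> residual_mean_bound" using elim(3) by (simp add: abs_mult)
    finally have "rt q * \<bar>la q\<bar> \<le> scaled_multiplier_bound"
      unfolding scaled_multiplier_bound_def using variance_pos by (simp add: field_simps)
    then show ?case using adm by blast
  qed
qed

text \<open>Both expansions in the multiplier have remainders quadratic in it and linear in the largest residual. As
  \<open>\<surd>n \<cdot> |la|\<close> is bounded and the largest residual is \<open>o\<^sub>p(\<surd>n)\<close>, they are \<open>o\<^sub>p(n\<^bsup>-1/2\<^esup>)\<close>.\<close>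

lemma multiplier_remainder:
  assumes u: "eventually (\<lambda>q. 0 \<le> u q \<and> u q \<le> B) F" and "B > 0"
    and v: "\<And>q \<eta>. \<eta> > 0 \<Longrightarrow> \<forall>i\<in>{1..int (fst q)}. \<bar>rs q i\<bar> \<le> \<eta> * rt q \<Longrightarrow> \<bar>la q\<bar> * (\<eta> * rt q) \<le> 1 / 2 \<Longrightarrow>
      admissible_multiplier (fst q) (rs q) (la q) \<Longrightarrow> \<bar>v q\<bar> \<le> 2 * (la q)\<^sup>2 * (\<eta> * rt q) * u q"
  shows "((\<lambda>q. rt q * v q) \<longlongrightarrow> 0) F"
proof (rule tendstoI)
  fix \<epsilon> :: real assume \<epsilon>: "\<epsilon> > 0"
  \<comment> \<open>The first bound is for the condition on \<open>|la|\<close> times the largest residual, the second for the size of the remainder.\<close>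
  define \<eta> where "\<eta> = min (1 / (2 * scaled_multiplier_bound)) (\<epsilon> / (4 * scaled_multiplier_bound\<^sup>2 * B))"
  have "\<eta> > 0" unfolding \<eta>_def using multiplier_bound_pos \<epsilon> \<open>B > 0\<close> by simp
  have "\<eta> \<le> 1 / (2 * scaled_multiplier_bound)" "\<eta> \<le> \<epsilon> / (4 * scaled_multiplier_bound\<^sup>2 * B)"
    unfolding \<eta>_def by auto
  then have \<eta>: "\<eta> > 0" "scaled_multiplier_bound * \<eta> \<le> 1 / 2" "2 * scaled_multiplier_bound\<^sup>2 * \<eta> * B < \<epsilon>"
    using multiplier_bound_pos \<epsilon> \<open>B > 0\<close> \<open>\<eta> > 0\<close> by (auto simp: pos_le_divide_eq field_simps)
  show "eventually (\<lambda>q. dist (rt q * v q) 0 < \<epsilon>) F"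
    using u ev_multiplier ev_max_res[OF \<eta>(1)]
  proof eventually_elim
    case (elim q)
    have "\<bar>la q\<bar> * (\<eta> * rt q) = (rt q * \<bar>la q\<bar>) * \<eta>" by simp
    also have "\<dots> \<le> scaled_multiplier_bound * \<eta>" using elim(2) \<eta>(1) by (intro mult_right_mono) auto
    finally have "\<bar>v q\<bar> \<le> 2 * (la q)\<^sup>2 * (\<eta> * rt q) * u q"
      using \<eta>(2) elim by (intro v \<eta>(1)) auto
    then have "rt q * \<bar>v q\<bar> \<le> rt q * (2 * (la q)\<^sup>2 * (\<eta> * rt q) * u q)"
      by (intro mult_left_mono) auto
    also have "\<dots> = 2 * (rt q * \<bar>la q\<bar>)\<^sup>2 * \<eta> * u q"
      by (simp add: power_mult_distrib)
    also have "\<dots> \<le> 2 * scaled_multiplier_bound\<^sup>2 * \<eta> * B"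
      using elim(1,2) \<eta>(1) by (intro mult_mono power_mono) auto
    finally show ?case using \<eta>(3) by (simp add: abs_mult)
  qed
qed

lemma multiplier_expansion_F: "((\<lambda>q. rt q * la q * \<sigma>\<^sup>2 - rt q * sm q (rs q)) \<longlongrightarrow> 0) F"
proof -
  have "((\<lambda>q. rt q * (la q * sm q (\<lambda>i. (rs q i)\<^sup>2) - sm q (rs q))) \<longlongrightarrow> 0) F"
  proof (rule multiplier_remainder[where u = "\<lambda>q. sm q (\<lambda>i. (rs q i)\<^sup>2)" and B = "\<sigma>\<^sup>2 + 1"])
    show "eventually (\<lambda>q. 0 \<le> sm q (\<lambda>i. (rs q i)\<^sup>2) \<and> sm q (\<lambda>i. (rs q i)\<^sup>2) \<le> \<sigma>\<^sup>2 + 1) F"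
      using eventually_abs_le_if_tendsto[OF mean_res_square] by eventually_elim (simp add: mean_square_nonneg)
    show "\<sigma>\<^sup>2 + 1 > 0" using variance_pos by linarith
  qed (rule multiplier_expansion; blast)
  moreover have "((\<lambda>q. (rt q * la q) * (\<sigma>\<^sup>2 - sm q (\<lambda>i. (rs q i)\<^sup>2))) \<longlongrightarrow> 0) F"
  proof (rule tendsto_zero_mult_bounded)
    show "eventually (\<lambda>q. \<bar>rt q * la q\<bar> \<le> scaled_multiplier_bound) F"
      using ev_multiplier by eventually_elim (simp add: abs_mult)
    show "((\<lambda>q. \<sigma>\<^sup>2 - sm q (\<lambda>i. (rs q i)\<^sup>2)) \<longlongrightarrow> 0) F"
      using tendsto_diff[OF tendsto_const mean_res_square, of "\<sigma>\<^sup>2"] by simp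
  qed
  ultimately have "((\<lambda>q. rt q * (la q * sm q (\<lambda>i. (rs q i)\<^sup>2) - sm q (rs q))
      + (rt q * la q) * (\<sigma>\<^sup>2 - sm q (\<lambda>i. (rs q i)\<^sup>2))) \<longlongrightarrow> 0 + 0) F"
    by (rule tendsto_add)
  then show ?thesis by (simp add: algebra_simps)
qed

lemma mean_res_G: "((\<lambda>q. sm q (\<lambda>i. rs q i * G q i)) \<longlongrightarrow> innovation_g_mean) F"
proof -
  define B where "B = sqrt (\<sigma>\<^sup>2) * sqrt w_square_mean"
  have first: "((\<lambda>q. sm q (\<lambda>i. dd q i * G q i)) \<longlongrightarrow> 0) F"
  proof -
    have "((\<lambda>q. (C + L) * (sqrt (sm q (\<lambda>i. (dd q i)\<^sup>2)) * sqrt (sm q (\<lambda>i. (w (e q i))\<^sup>2)))) \<longlongrightarrow>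
        (C + L) * (sqrt 0 * sqrt w_square_mean)) F"
      by (intro tendsto_mult_left tendsto_mult tendsto_real_sqrt mean_d_square mean_w_square)
    then have lim: "((\<lambda>q. (C + L) * (sqrt (sm q (\<lambda>i. (dd q i)\<^sup>2)) * sqrt (sm q (\<lambda>i. (w (e q i))\<^sup>2)))) \<longlongrightarrow> 0) F"
      by simp
    have "eventually (\<lambda>q. norm (sm q (\<lambda>i. dd q i * G q i))
        \<le> (C + L) * (sqrt (sm q (\<lambda>i. (dd q i)\<^sup>2)) * sqrt (sm q (\<lambda>i. (w (e q i))\<^sup>2)))) F"
      using ev_G_bound
    proof eventually_elim
      case (elim q)
      have "\<bar>sm q (\<lambda>i. dd q i * G q i)\<bar> \<le> sm q (\<lambda>i. \<bar>dd q i * G q i\<bar>)" by (rule abs_sample_mean_le)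
      also have "\<dots> \<le> sm q (\<lambda>i. (C + L) * \<bar>dd q i * w (e q i)\<bar>)"
      proof (rule sample_mean_mono)
        fix i assume "i \<in> {1..int (fst q)}"
        then have "\<bar>dd q i\<bar> * \<bar>G q i\<bar> \<le> \<bar>dd q i\<bar> * ((C + L) * w (e q i))"
          using elim by (intro mult_left_mono) auto
        then show "\<bar>dd q i * G q i\<bar> \<le> (C + L) * \<bar>dd q i * w (e q i)\<bar>"
          using w_ge_1[of "e q i"] by (simp add: abs_mult mult_ac)
      qed
      also have "\<dots> \<le> (C + L) * (sqrt (sm q (\<lambda>i. (dd q i)\<^sup>2)) * sqrt (sm q (\<lambda>i. (w (e q i))\<^sup>2)))"
        unfolding sample_mean_cmult using C_nonneg L_nonneg by (intro mult_left_mono sample_mean_Cauchy_Schwarz) auto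
      finally show ?case by simp
    qed
    then show ?thesis by (rule Lim_null_comparison[OF _ lim])
  qed
  have second: "((\<lambda>q. sm q (\<lambda>i. e q i * (G q i - g (e q i)))) \<longlongrightarrow> 0) F"
  proof (rule tendstoI)
    fix \<epsilon> :: real assume \<epsilon>: "\<epsilon> > 0"
    define \<eta> where "\<eta> = \<epsilon> / (2 * (L + 1) * (\<bar>B\<bar> + 1))"
    have \<eta>: "\<eta> > 0" unfolding \<eta>_def using \<epsilon> L_nonneg by (intro divide_pos_pos mult_pos_pos) auto
    have L\<eta>: "L * \<eta> * (\<bar>B\<bar> + 1) < \<epsilon>"
    proof -
      have "L * \<eta> * (\<bar>B\<bar> + 1) \<le> (L + 1) * \<eta> * (\<bar>B\<bar> + 1)"
        using \<eta> by (intro mult_right_mono) auto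
      also have "\<dots> = \<epsilon> / 2"
      proof -
        have "L + 1 \<noteq> 0" "\<bar>B\<bar> + 1 \<noteq> 0" using L_nonneg by linarith+
        then show ?thesis unfolding \<eta>_def by (simp add: divide_simps)
      qed
      finally show ?thesis using \<epsilon> by linarith
    qed
    have "((\<lambda>q. sqrt (sm q (\<lambda>i. (e q i)\<^sup>2)) * sqrt (sm q (\<lambda>i. (w (e q i))\<^sup>2))) \<longlongrightarrow> B) F"
      unfolding B_def by (intro tendsto_mult tendsto_real_sqrt mean_e_square mean_w_square)
    from eventually_abs_le_if_tendsto[OF this] ev_G_close[OF \<eta>]
    show "eventually (\<lambda>q. dist (sm q (\<lambda>i. e q i * (G q i - g (e q i)))) 0 < \<epsilon>) F"
    proof eventually_elim
      case (elim q)
      have "\<bar>sm q (\<lambda>i. e q i * (G q i - g (e q i)))\<bar> \<le> sm q (\<lambda>i. \<bar>e q i * (G q i - g (e q i))\<bar>)"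
        by (rule abs_sample_mean_le)
      also have "\<dots> \<le> sm q (\<lambda>i. L * \<eta> * \<bar>e q i * w (e q i)\<bar>)"
      proof (rule sample_mean_mono)
        fix i assume "i \<in> {1..int (fst q)}"
        then have "\<bar>e q i\<bar> * \<bar>G q i - g (e q i)\<bar> \<le> \<bar>e q i\<bar> * (L * \<eta> * w (e q i))"
          using elim by (intro mult_left_mono) auto
        then show "\<bar>e q i * (G q i - g (e q i))\<bar> \<le> L * \<eta> * \<bar>e q i * w (e q i)\<bar>"
          using w_ge_1[of "e q i"] by (simp add: abs_mult mult_ac)
      qed
      also have "\<dots> \<le> L * \<eta> * (sqrt (sm q (\<lambda>i. (e q i)\<^sup>2)) * sqrt (sm q (\<lambda>i. (w (e q i))\<^sup>2)))"
        unfolding sample_mean_cmult using \<eta> L_nonneg by (intro mult_left_mono sample_mean_Cauchy_Schwarz) auto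
      also have "\<dots> \<le> L * \<eta> * (\<bar>B\<bar> + 1)"
        using elim(1) \<eta> L_nonneg by (intro mult_left_mono) auto
      finally show ?case using L\<eta> by simp
    qed
  qed
  have "((\<lambda>q. sm q (\<lambda>i. e q i * g (e q i)) + sm q (\<lambda>i. e q i * (G q i - g (e q i))) - sm q (\<lambda>i. dd q i * G q i))
      \<longlongrightarrow> innovation_g_mean + 0 - 0) F"
    by (intro tendsto_add tendsto_diff mean_e_g second first)
  moreover have "eventually (\<lambda>q. sm q (\<lambda>i. e q i * g (e q i)) + sm q (\<lambda>i. e q i * (G q i - g (e q i)))
      - sm q (\<lambda>i. dd q i * G q i) = sm q (\<lambda>i. rs q i * G q i)) F"
    using ev_res
  proof eventually_elim
    case (elim q)
    show ?case
      unfolding sample_mean_add[symmetric] sample_mean_diff[symmetric]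
    proof (rule sample_mean_cong)
      fix i assume "i \<in> {1..int (fst q)}"
      then have rs: "rs q i = e q i - dd q i" using elim by auto
      show "e q i * g (e q i) + e q i * (G q i - g (e q i)) - dd q i * G q i = rs q i * G q i"
        unfolding rs by (simp add: algebra_simps)
    qed
  qed
  ultimately show ?thesis by (simp add: tendsto_cong)
qed

lemma ev_mean_abs_res_G:
  "eventually (\<lambda>q. 0 \<le> sm q (\<lambda>i. \<bar>rs q i * G q i\<bar>) \<and>
     sm q (\<lambda>i. \<bar>rs q i * G q i\<bar>) \<le> \<bar>(C + L) * (sqrt (\<sigma>\<^sup>2) * sqrt w_square_mean)\<bar> + 1) F"
proof -
  have "((\<lambda>q. (C + L) * (sqrt (sm q (\<lambda>i. (rs q i)\<^sup>2)) * sqrt (sm q (\<lambda>i. (w (e q i))\<^sup>2)))) \<longlongrightarrow>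
        (C + L) * (sqrt (\<sigma>\<^sup>2) * sqrt w_square_mean)) F"
    by (intro tendsto_mult_left tendsto_mult tendsto_real_sqrt mean_res_square mean_w_square)
  from eventually_abs_le_if_tendsto[OF this] ev_G_bound show ?thesis
  proof eventually_elim
    case (elim q)
    have "sm q (\<lambda>i. \<bar>rs q i * G q i\<bar>) \<le> sm q (\<lambda>i. (C + L) * \<bar>rs q i * w (e q i)\<bar>)"
    proof (rule sample_mean_mono)
      fix i assume "i \<in> {1..int (fst q)}"
      then have "\<bar>rs q i\<bar> * \<bar>G q i\<bar> \<le> \<bar>rs q i\<bar> * ((C + L) * w (e q i))"
        using elim by (intro mult_left_mono) auto
      then show "\<bar>rs q i * G q i\<bar> \<le> (C + L) * \<bar>rs q i * w (e q i)\<bar>"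
        using w_ge_1[of "e q i"] by (simp add: abs_mult mult_ac)
    qed
    also have "\<dots> \<le> (C + L) * (sqrt (sm q (\<lambda>i. (rs q i)\<^sup>2)) * sqrt (sm q (\<lambda>i. (w (e q i))\<^sup>2)))"
      unfolding sample_mean_cmult using C_nonneg L_nonneg by (intro mult_left_mono sample_mean_Cauchy_Schwarz) auto
    finally show ?case using elim(1) by (auto intro: sample_mean_nonneg)
  qed
qed

text \<open>The difference is an exact combination of five vanishing terms: the remainder of expanding the weights, the unweighted
  expansion, the error in the mean of residual times fitted value, the error of the multiplier, and
  the error of the mean residual.\<close>

lemma weighted_expansion_F:
  "((\<lambda>q. rt q * (sm q (\<lambda>i. 1 / (1 + la q * rs q i) * G q i)
      - (sm q (\<lambda>i. g (e q i) - innovation_g_mean / \<sigma>\<^sup>2 * e q i)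
         + (shift_slope 0 *\<^sub>R V_mean + (innovation_g_mean / \<sigma>\<^sup>2) *\<^sub>R (v0 - V_mean)) \<bullet> D q))) \<longlongrightarrow> 0) F"
proof -
  define t1 where "t1 q = rt q * (sm q (\<lambda>i. 1 / (1 + la q * rs q i) * G q i) - (sm q (G q) - la q * sm q (\<lambda>i. rs q i * G q i)))" for q
  define t2 where "t2 q = rt q * (sm q (G q) - (sm q (\<lambda>i. g (e q i)) + (shift_slope 0 *\<^sub>R V_mean) \<bullet> D q))" for q
  define t3 where "t3 q = (rt q * la q) * (sm q (\<lambda>i. rs q i * G q i) - innovation_g_mean)" for q
  define t4 where "t4 q = rt q * la q * \<sigma>\<^sup>2 - rt q * sm q (rs q)" for q
  define t5 where "t5 q = rt q * sm q (rs q) - linear_residual_mean q" for q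
  have "(t1 \<longlongrightarrow> 0) F"
    unfolding t1_def
  proof (rule multiplier_remainder[OF ev_mean_abs_res_G])
    show "\<bar>(C + L) * (sqrt (\<sigma>\<^sup>2) * sqrt w_square_mean)\<bar> + 1 > 0" by (rule add_nonneg_pos) auto
  qed (rule weighted_mean_expansion; blast)
  moreover have "(t2 \<longlongrightarrow> 0) F" unfolding t2_def by (rule unweighted_expansion_F)
  moreover have "(t3 \<longlongrightarrow> 0) F"
    unfolding t3_def
  proof (rule tendsto_zero_mult_bounded)
    show "eventually (\<lambda>q. \<bar>rt q * la q\<bar> \<le> scaled_multiplier_bound) F"
      using ev_multiplier by eventually_elim (simp add: abs_mult)
    show "((\<lambda>q. sm q (\<lambda>i. rs q i * G q i) - innovation_g_mean) \<longlongrightarrow> 0) F"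
      using LIM_zero[OF mean_res_G] .
  qed
  moreover have "(t4 \<longlongrightarrow> 0) F" unfolding t4_def by (rule multiplier_expansion_F)
  moreover have "(t5 \<longlongrightarrow> 0) F" unfolding t5_def by (rule mean_res)
  ultimately have "((\<lambda>q. t1 q + t2 q - t3 q - innovation_g_mean / \<sigma>\<^sup>2 * (t4 q + t5 q)) \<longlongrightarrow> 0 + 0 - 0 - innovation_g_mean / \<sigma>\<^sup>2 * (0 + 0)) F"
    by (intro tendsto_add tendsto_diff tendsto_mult_left)
  moreover have "t1 q + t2 q - t3 q - innovation_g_mean / \<sigma>\<^sup>2 * (t4 q + t5 q)
      = rt q * (sm q (\<lambda>i. 1 / (1 + la q * rs q i) * G q i)
      - (sm q (\<lambda>i. g (e q i) - innovation_g_mean / \<sigma>\<^sup>2 * e q i)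
         + (shift_slope 0 *\<^sub>R V_mean + (innovation_g_mean / \<sigma>\<^sup>2) *\<^sub>R (v0 - V_mean)) \<bullet> D q))" for q
  proof -
    define \<kappa> where "\<kappa> = innovation_g_mean / \<sigma>\<^sup>2"
    have mean_eq: "innovation_g_mean = \<kappa> * \<sigma>\<^sup>2" unfolding \<kappa>_def using variance_pos by simp
    have mean_diff: "sm q (\<lambda>i. g (e q i) - \<kappa> * e q i) = sm q (\<lambda>i. g (e q i)) - \<kappa> * sm q (e q)"
      by (simp add: sample_mean_diff sample_mean_cmult)
    show ?thesis
      unfolding \<kappa>_def[symmetric] t1_def t2_def t3_def t4_def t5_def linear_residual_mean_def mean_diff
        inner_add_left inner_scaleR_left inner_scaleR_right
      unfolding mean_eq
      by (simp add: algebra_simps)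
  qed
  ultimately show ?thesis by simp
qed

end

theorem unweighted_expansion:
  "((\<lambda>q. sqrt (real (fst q)) * (sample_mean (fst q) (fitted (fst q) (snd q))
      - (sample_mean (fst q) (\<lambda>i. g (eps i (snd q))) + (shift_slope 0 *\<^sub>R V_mean) \<bullet> Del (fst q) (snd q))))
    \<longlongrightarrow> 0) (in_prob M)"
  by (rule tendsto_in_prob_localise2[OF Del_bigO innovation_mean_bigO]) (rule unweighted_expansion_F)

theorem weighted_expansion:
  "((\<lambda>q. sqrt (real (fst q)) * (sample_mean (fst q)
        (\<lambda>i. 1 / (1 + lam (fst q) (snd q) * res (fst q) (snd q) i) * fitted (fst q) (snd q) i)
      - (sample_mean (fst q) (\<lambda>i. g (eps i (snd q)) - innovation_g_mean / \<sigma>\<^sup>2 * eps i (snd q))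
         + (shift_slope 0 *\<^sub>R V_mean + (innovation_g_mean / \<sigma>\<^sup>2) *\<^sub>R (v0 - V_mean)) \<bullet> Del (fst q) (snd q))))
    \<longlongrightarrow> 0) (in_prob M)"
  by (rule tendsto_in_prob_localise2[OF Del_bigO innovation_mean_bigO]) (rule weighted_expansion_F)

end

section \<open>Kernel integrals and smoothness in the parameter\<close>

context shifted_functional
begin

lemma integral_against_scaled_kernel:
  assumes "0 < \<beta>" "\<beta> \<le> \<delta>"
  shows "integrable lborel (\<lambda>y. g (y + t) * scaled_kernel k \<beta> (y - x))"
    and "(\<integral>y. g (y + t) * scaled_kernel k \<beta> (y - x) \<partial>lborel) = smoothed \<beta> (x + t)"
proof -
  let ?F = "\<lambda>y. g (y + t) * scaled_kernel k \<beta> (y - x)"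
  have F: "?F (x + \<beta> * u) = (1 / \<beta>) * (g (x + t + \<beta> * u) * k u)" for u
    using assms by (simp add: scaled_kernel_def add_ac)
  have "integrable lborel (\<lambda>u. g (x + t + 0 + \<beta> * u) * k u)"
    by (rule smoothed_integrable) (use assms in simp)
  then have "integrable lborel (\<lambda>u. ?F (x + \<beta> * u))"
    unfolding F by simp
  then show "integrable lborel ?F"
    by (subst (asm) lborel_integrable_real_affine_iff) (use assms in auto)
  have "(\<integral>y. ?F y \<partial>lborel) = \<bar>\<beta>\<bar> *\<^sub>R (\<integral>u. ?F (x + \<beta> * u) \<partial>lborel)"
    by (rule lborel_integral_real_affine) (use assms in simp)
  also have "\<dots> = smoothed \<beta> (x + t)"
    unfolding F smoothed_def using assms by simp
  finally show "(\<integral>y. ?F y \<partial>lborel) = smoothed \<beta> (x + t)" .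
qed

lemma integral_against_weighted_kernels:
  assumes "0 < \<beta>" "\<beta> \<le> \<delta>"
  shows "(\<integral>y. g (y + t) * ((1 / real n) * (\<Sum>i=1..int n. a i * scaled_kernel k \<beta> (y - x i))) \<partial>lborel)
    = sample_mean n (\<lambda>i. a i * smoothed \<beta> (x i + t))"
proof -
  note kernel = integral_against_scaled_kernel[OF assms]
  have "(\<integral>y. g (y + t) * ((1 / real n) * (\<Sum>i=1..int n. a i * scaled_kernel k \<beta> (y - x i))) \<partial>lborel)
      = (\<integral>y. (1 / real n) * (\<Sum>i=1..int n. a i * (g (y + t) * scaled_kernel k \<beta> (y - x i))) \<partial>lborel)"
    by (simp add: sum_distrib_left mult_ac)
  also have "\<dots> = (1 / real n) * (\<Sum>i=1..int n. a i * (\<integral>y. g (y + t) * scaled_kernel k \<beta> (y - x i) \<partial>lborel))"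
    using kernel(1) by simp
  finally show ?thesis unfolding kernel(2) sample_mean_def .
qed

end

lemma C2_kernel_properties:
  assumes "C2_kernel k"
  shows "k \<in> borel_measurable borel" and "\<bar>u\<bar> > 1 \<Longrightarrow> k u = 0"
proof -
  obtain k' where "\<And>u. (k has_real_derivative k' u) (at u)"
    using assms unfolding C2_kernel_def by blast
  then have "continuous_on UNIV k"
    by (auto intro!: continuous_at_imp_continuous_on DERIV_isCont)
  then show "k \<in> borel_measurable borel" by (rule borel_measurable_continuous_onI)
  assume u: "\<bar>u\<bar> > 1"
  show "k u = 0"
  proof (rule ccontr)
    assume "k u \<noteq> 0"
    then have "u \<in> closure {u. k u \<noteq> 0}" by (intro subsetD[OF closure_subset]) simp
    then show False using assms u unfolding C2_kernel_def by auto
  qed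
qed

lemma polynomial_weight_square_integrable:
  fixes f :: "real \<Rightarrow> real"
  assumes f: "integrable lborel f" "\<And>y. f y > 0" and "\<gamma> \<ge> 0" "\<beta> > 2 * \<gamma> + 1"
    and moment: "integrable lborel (\<lambda>y. \<bar>y\<bar> powr \<beta> * f y)"
  shows "integrable lborel (\<lambda>y. ((1 + \<bar>y\<bar>) powr \<gamma>)\<^sup>2 * f y)"
proof (rule Bochner_Integration.integrable_bound)
  have [measurable]: "f \<in> borel_measurable borel" using f(1) by simp
  show "(\<lambda>y. ((1 + \<bar>y\<bar>) powr \<gamma>)\<^sup>2 * f y) \<in> borel_measurable lborel" by measurable
  show "integrable lborel (\<lambda>y. 2 powr \<beta> * (f y + \<bar>y\<bar> powr \<beta> * f y))"
    using f(1) moment by simp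
  show "AE y in lborel. norm (((1 + \<bar>y\<bar>) powr \<gamma>)\<^sup>2 * f y) \<le> norm (2 powr \<beta> * (f y + \<bar>y\<bar> powr \<beta> * f y))"
  proof (rule AE_I2)
    fix y :: real
    have "((1 + \<bar>y\<bar>) powr \<gamma>)\<^sup>2 = (1 + \<bar>y\<bar>) powr (2 * \<gamma>)"
      by (simp only: power2_eq_square mult_2 powr_add)
    also have "\<dots> \<le> (1 + \<bar>y\<bar>) powr \<beta>"
      using assms by (intro powr_mono) auto
    also have "\<dots> \<le> (2 * max 1 \<bar>y\<bar>) powr \<beta>"
      using assms by (intro powr_mono2) auto
    also have "\<dots> = 2 powr \<beta> * max 1 \<bar>y\<bar> powr \<beta>"
      by (simp add: powr_mult)
    also have "\<dots> \<le> 2 powr \<beta> * (1 + \<bar>y\<bar> powr \<beta>)"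
      by (intro mult_left_mono) (auto simp: max_def)
    finally have "((1 + \<bar>y\<bar>) powr \<gamma>)\<^sup>2 * f y \<le> 2 powr \<beta> * (1 + \<bar>y\<bar> powr \<beta>) * f y"
      using f(2)[of y] by (intro mult_right_mono) auto
    then show "norm (((1 + \<bar>y\<bar>) powr \<gamma>)\<^sup>2 * f y) \<le> norm (2 powr \<beta> * (f y + \<bar>y\<bar> powr \<beta> * f y))"
      using f(2)[of y] by (simp add: algebra_simps)
  qed
qed

text \<open>Each component is a limit of difference quotients, whose parameters lie in the open set from some index on.\<close>

lemma gradient_measurable:
  fixes r :: "'a::euclidean_space \<Rightarrow> 'b::topological_space \<Rightarrow> real" and D :: "'b \<Rightarrow> 'a"
  assumes \<Theta>: "open \<Theta>" "\<theta> \<in> \<Theta>"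
    and r: "\<And>\<tau>. \<tau> \<in> \<Theta> \<Longrightarrow> r \<tau> \<in> borel_measurable borel"
    and D: "\<And>z. GDERIV (\<lambda>t. r t z) \<theta> :> D z"
  shows "D \<in> borel_measurable borel"
proof (subst borel_measurable_euclidean_space, rule ballI)
  fix i :: 'a assume i: "i \<in> Basis"
  define h where "h m = 1 / real (Suc m)" for m
  have h: "h \<longlonglongrightarrow> 0" "\<And>m. h m \<noteq> 0"
    unfolding h_def by (rule LIMSEQ_Suc[OF lim_1_over_n], simp)
  have "(\<lambda>m. \<theta> + h m *\<^sub>R i) \<longlonglongrightarrow> \<theta> + 0 *\<^sub>R i"
    by (intro tendsto_intros h)
  then have "\<forall>\<^sub>F m in sequentially. \<theta> + h m *\<^sub>R i \<in> \<Theta>"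
    using \<Theta> by (intro topological_tendstoD) auto
  then obtain N where N: "\<And>m. m \<ge> N \<Longrightarrow> \<theta> + h m *\<^sub>R i \<in> \<Theta>"
    by (auto simp: eventually_sequentially)
  define Q where "Q m z = (r (\<theta> + h (m + N) *\<^sub>R i) z - r \<theta> z) / h (m + N)" for m z
  have Q: "Q m \<in> borel_measurable borel" for m
    unfolding Q_def[abs_def] using r[OF N[of "m + N"]] r[OF \<Theta>(2)] by measurable
  show "(\<lambda>z. D z \<bullet> i) \<in> borel_measurable borel"
  proof (rule borel_measurable_LIMSEQ_real[OF _ Q])
    fix z
    have der: "((\<lambda>t. r t z) has_derivative (\<lambda>v. v \<bullet> D z)) (at \<theta>)"
      using D[of z] by (simp add: gderiv_def)
    have "((\<lambda>u. r (\<theta> + u *\<^sub>R i) z) has_derivative (\<lambda>u. (u *\<^sub>R i) \<bullet> D z)) (at 0)"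
      by (rule has_derivative_compose[of "\<lambda>u. \<theta> + u *\<^sub>R i" "\<lambda>u. u *\<^sub>R i" 0 UNIV "\<lambda>t. r t z", simplified])
         (use der in \<open>auto intro!: derivative_eq_intros\<close>)
    moreover have "(\<lambda>u. (u *\<^sub>R i) \<bullet> D z) = (*) (D z \<bullet> i)"
      by (auto simp: fun_eq_iff inner_commute)
    ultimately have "((\<lambda>u. r (\<theta> + u *\<^sub>R i) z) has_real_derivative (D z \<bullet> i)) (at 0)"
      by (simp only: has_field_derivative_def)
    then have "((\<lambda>u. (r (\<theta> + u *\<^sub>R i) z - r \<theta> z) / u) \<longlongrightarrow> D z \<bullet> i) (at 0)"
      by (simp add: has_field_derivative_iff)
    moreover have "filterlim (\<lambda>m. h (m + N)) (at 0) sequentially"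
      using LIMSEQ_ignore_initial_segment[OF h(1), of N] h(2) by (simp add: filterlim_at)
    ultimately show "(\<lambda>m. Q m z) \<longlonglongrightarrow> D z \<bullet> i"
      unfolding Q_def by (rule filterlim_compose)
  qed
qed

lemma sqrt_n_scaled_bigO:
  fixes Z :: "nat \<Rightarrow> 'w \<Rightarrow> 'b::real_normed_vector"
  assumes "bigO_prob M Z (\<lambda>n. real n powr (- 1 / 2))"
  shows "bigO_prob M (\<lambda>n \<omega>. sqrt (real n) *\<^sub>R Z n \<omega>) (\<lambda>_. 1)"
  unfolding bigO_prob_def
proof (intro allI impI)
  fix \<eta> :: real assume "\<eta> > 0"
  then obtain K where K: "\<forall>\<^sub>F n in sequentially.
      outer_measure_of M {\<omega>\<in>space M. norm (Z n \<omega>) > K * real n powr (- 1 / 2)} \<le> ennreal \<eta>"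
    using assms unfolding bigO_prob_def by blast
  have "\<forall>\<^sub>F n in sequentially. outer_measure_of M {\<omega>\<in>space M. norm (sqrt (real n) *\<^sub>R Z n \<omega>) > K * 1} \<le> ennreal \<eta>"
    using K eventually_gt_at_top[of 0]
  proof eventually_elim
    case (elim n)
    have "real n powr (- 1 / 2) = 1 / sqrt (real n)"
      by (simp add: powr_minus_divide powr_half_sqrt)
    then have "K * 1 < norm (sqrt (real n) *\<^sub>R u) \<longleftrightarrow> K * real n powr (- 1 / 2) < norm u" for u :: 'b
      using elim(2) by (simp only:) (simp add: field_simps)
    then show ?case using elim(1) by (simp only:)
  qed
  then show "\<exists>K. \<forall>\<^sub>F n in sequentially.
      outer_measure_of M {\<omega>\<in>space M. norm (sqrt (real n) *\<^sub>R Z n \<omega>) > K * 1} \<le> ennreal \<eta>" ..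
qed

lemma differentiable_at_estimate:
  fixes Z :: "nat \<Rightarrow> 'w \<Rightarrow> 'b::euclidean_space"
  assumes Z: "bigO_prob M (\<lambda>n \<omega>. sqrt (real n) *\<^sub>R (Z n \<omega> - \<theta>)) (\<lambda>_. 1)"
    and D: "GDERIV F \<theta> :> D"
  shows "((\<lambda>q. sqrt (real (fst q)) * (F (Z (fst q) (snd q)) - F \<theta> - D \<bullet> (Z (fst q) (snd q) - \<theta>))) \<longlongrightarrow> 0) (in_prob M)"
proof (rule tendsto_in_prob_localise[OF Z])
  fix K :: real assume K: "K > 0"
  let ?F = "inf (in_prob M) (principal {p. norm (sqrt (real (fst p)) *\<^sub>R (Z (fst p) (snd p) - \<theta>)) \<le> K * 1})"
  show "((\<lambda>q. sqrt (real (fst q)) * (F (Z (fst q) (snd q)) - F \<theta> - D \<bullet> (Z (fst q) (snd q) - \<theta>))) \<longlongrightarrow> 0) ?F"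
  proof (rule tendstoI)
    fix \<epsilon> :: real assume \<epsilon>: "\<epsilon> > 0"
    have "(F has_derivative (\<lambda>v. v \<bullet> D)) (at \<theta>)" using D by (simp add: gderiv_def)
    moreover have "\<epsilon> / (2 * K) > 0" using \<epsilon> K by simp
    ultimately obtain \<delta> where \<delta>: "\<delta> > 0"
      "\<And>t. norm (t - \<theta>) < \<delta> \<Longrightarrow> norm (F t - F \<theta> - (t - \<theta>) \<bullet> D) \<le> \<epsilon> / (2 * K) * norm (t - \<theta>)"
      unfolding has_derivative_at_alt by blast
    have "(\<lambda>n. K * (1 / sqrt (real n))) \<longlonglongrightarrow> K * 0"
      by (intro tendsto_mult_left) real_asymp
    then have "\<forall>\<^sub>F n in sequentially. K * (1 / sqrt (real n)) < \<delta>"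
      by (rule order_tendstoD(2)) (use \<delta> in simp)
    then have "\<forall>\<^sub>F n in sequentially. K * (1 / sqrt (real n)) < \<delta> \<and> n > 0"
      using eventually_gt_at_top[of 0] by (rule eventually_conj)
    from eventually_in_prob_fst[OF this, of M]
    show "eventually (\<lambda>q. dist (sqrt (real (fst q)) * (F (Z (fst q) (snd q)) - F \<theta> - D \<bullet> (Z (fst q) (snd q) - \<theta>))) 0 < \<epsilon>) ?F"
      unfolding eventually_inf_principal
    proof eventually_elim
      case (elim q)
      show ?case
      proof
        assume "q \<in> {p. norm (sqrt (real (fst p)) *\<^sub>R (Z (fst p) (snd p) - \<theta>)) \<le> K * 1}"
        then have le: "sqrt (real (fst q)) * norm (Z (fst q) (snd q) - \<theta>) \<le> K" by simp
        have "norm (Z (fst q) (snd q) - \<theta>) \<le> K * (1 / sqrt (real (fst q)))"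
          using le elim by (simp add: pos_le_divide_eq mult.commute)
        then have "\<bar>F (Z (fst q) (snd q)) - F \<theta> - D \<bullet> (Z (fst q) (snd q) - \<theta>)\<bar>
            \<le> \<epsilon> / (2 * K) * norm (Z (fst q) (snd q) - \<theta>)"
          using \<delta>(2)[of "Z (fst q) (snd q)"] elim by (simp add: inner_commute)
        then have "sqrt (real (fst q)) * \<bar>F (Z (fst q) (snd q)) - F \<theta> - D \<bullet> (Z (fst q) (snd q) - \<theta>)\<bar>
            \<le> sqrt (real (fst q)) * (\<epsilon> / (2 * K) * norm (Z (fst q) (snd q) - \<theta>))"
          by (intro mult_left_mono) auto
        also have "\<dots> = \<epsilon> / (2 * K) * (sqrt (real (fst q)) * norm (Z (fst q) (snd q) - \<theta>))"
          by simp
        also have "\<dots> \<le> \<epsilon> / (2 * K) * K"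
          using le \<epsilon> K by (intro mult_left_mono) auto
        also have "\<dots> < \<epsilon>" using \<epsilon> K by simp
        finally show "dist (sqrt (real (fst q)) * (F (Z (fst q) (snd q)) - F \<theta> - D \<bullet> (Z (fst q) (snd q) - \<theta>))) 0 < \<epsilon>"
          by (simp add: abs_mult)
      qed
    qed
  qed
qed simp

text \<open>The supremum bounds the value at the estimate as soon as the ball lies in a compact ball inside \<open>\<Theta>\<close>, where
  continuity makes the supremum finite; for unbounded sets of reals \<open>SUP\<close> would carry no information.\<close>

lemma uniform_remainder_at_estimate:
  fixes est :: "nat \<Rightarrow> 'w \<Rightarrow> 'b::euclidean_space" and S :: "nat \<Rightarrow> 'b \<Rightarrow> 'w \<Rightarrow> real"
  assumes \<Theta>: "open \<Theta>" "\<theta> \<in> \<Theta>"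
    and est: "bigO_prob M (\<lambda>n \<omega>. sqrt (real n) *\<^sub>R (est n \<omega> - \<theta>)) (\<lambda>_. 1)" "\<And>n \<omega>. \<omega> \<in> space M \<Longrightarrow> est n \<omega> \<in> \<Theta>"
    and cont: "\<And>n \<omega>. continuous_on \<Theta> (\<lambda>\<tau>. S n \<tau> \<omega>)"
    and nonneg: "\<And>n \<tau> \<omega>. S n \<tau> \<omega> \<ge> 0"
    and rate: "\<And>C. C > 0 \<Longrightarrow> bigO_prob M
         (\<lambda>n \<omega>. SUP \<tau>\<in>\<Theta> \<inter> {\<tau>. norm (\<tau> - \<theta>) \<le> C * real n powr (- 1 / 2)}. S n \<tau> \<omega>) (\<lambda>n. real n powr (- 2 / 3))"
  shows "((\<lambda>q. S (fst q) (est (fst q) (snd q)) (snd q)) \<longlongrightarrow> 0) (in_prob M)"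
proof (rule tendsto_in_prob_localise[OF est(1)])
  fix K :: real assume K: "K > 0"
  let ?A = "\<lambda>n. \<Theta> \<inter> {\<tau>. norm (\<tau> - \<theta>) \<le> K * real n powr (- 1 / 2)}"
  let ?B = "{p. norm (sqrt (real (fst p)) *\<^sub>R (est (fst p) (snd p) - \<theta>)) \<le> K * 1}"
  let ?F = "inf (in_prob M) (principal ?B)"
  have half: "real n powr (- 1 / 2) = 1 / sqrt (real n)" for n
    by (simp add: powr_minus_divide powr_half_sqrt)
  have "(\<lambda>n. real n powr (- 2 / 3)) \<longlonglongrightarrow> 0" by real_asymp
  then have "((\<lambda>q. SUP \<tau>\<in>?A (fst q). S (fst q) \<tau> (snd q)) \<longlongrightarrow> 0) (in_prob M)"
    by (rule bigO_prob_imp_tendsto_zero[OF rate[OF K], rotated]) simp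
  then have lim: "((\<lambda>q. SUP \<tau>\<in>?A (fst q). S (fst q) \<tau> (snd q)) \<longlongrightarrow> 0) ?F"
    by (rule tendsto_mono[OF inf_le1])
  obtain c where c: "c > 0" "cball \<theta> c \<subseteq> \<Theta>"
    using \<Theta> open_contains_cball by blast
  have "(\<lambda>n. K * (1 / sqrt (real n))) \<longlonglongrightarrow> K * 0"
    by (intro tendsto_mult_left) real_asymp
  then have "\<forall>\<^sub>F n in sequentially. K * (1 / sqrt (real n)) < c"
    by (rule order_tendstoD(2)) (use c in simp)
  then have "\<forall>\<^sub>F n in sequentially. K * (1 / sqrt (real n)) < c \<and> n > 0"
    using eventually_gt_at_top[of 0] by (rule eventually_conj)
  from eventually_in_prob_fst[OF this, of M] eventually_in_prob_space[of M]
  have "eventually (\<lambda>q. norm (S (fst q) (est (fst q) (snd q)) (snd q))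
      \<le> (SUP \<tau>\<in>?A (fst q). S (fst q) \<tau> (snd q))) ?F"
    unfolding eventually_inf_principal
  proof eventually_elim
    case (elim q)
    show ?case
    proof
      assume "q \<in> ?B"
      then have "norm (est (fst q) (snd q) - \<theta>) \<le> K * real (fst q) powr (- 1 / 2)"
        unfolding half using elim(1) by (simp add: pos_le_divide_eq mult.commute)
      then have mem: "est (fst q) (snd q) \<in> ?A (fst q)" using est(2)[OF elim(2)] by blast
      have "?A (fst q) \<subseteq> cball \<theta> c"
        using elim(1) unfolding half by (auto simp: dist_norm norm_minus_commute)
      moreover have "bounded ((\<lambda>\<tau>. S (fst q) \<tau> (snd q)) ` cball \<theta> c)"
        by (intro compact_imp_bounded compact_continuous_image continuous_on_subset[OF cont c(2)]) simp
      ultimately have "bdd_above ((\<lambda>\<tau>. S (fst q) \<tau> (snd q)) ` ?A (fst q))"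
        by (meson bdd_above_mono bounded_imp_bdd_above image_mono)
      then show "norm (S (fst q) (est (fst q) (snd q)) (snd q)) \<le> (SUP \<tau>\<in>?A (fst q). S (fst q) \<tau> (snd q))"
        using cSUP_upper[OF mem] nonneg by simp
    qed
  qed
  then show "((\<lambda>q. S (fst q) (est (fst q) (snd q)) (snd q)) \<longlongrightarrow> 0) ?F"
    by (rule Lim_null_comparison[OF _ lim])
qed simp

section \<open>The stochastic expansions of the plug-in estimators\<close>

theorem theorem3p3:
  fixes M :: "'w measure"
    and X eps :: "int \<Rightarrow> 'w \<Rightarrow> real"
    and r :: "real ^ 'd \<Rightarrow> real ^ ('p :: {finite, linorder}) \<Rightarrow> real"
    and rdot :: "real ^ 'd \<Rightarrow> real ^ ('p :: {finite, linorder}) \<Rightarrow> real ^ 'd"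
    and \<Theta> :: "(real ^ 'd) set" and \<theta> :: "real ^ 'd"
    and f f' k q :: "real \<Rightarrow> real"
    and \<sigma> \<gamma> :: real
    and est :: "nat \<Rightarrow> 'w \<Rightarrow> real ^ 'd"
    and lam :: "nat \<Rightarrow> 'w \<Rightarrow> real"
    and b :: "nat \<Rightarrow> real"
    and x :: "real ^ ('p :: {finite, linorder})"
    and Dq Dq_bar :: "real ^ 'd" and cq :: real
  defines "Dq \<equiv> (\<integral>\<omega>. q (eps 1 \<omega> + r \<theta> x) * score f f' (eps 1 \<omega>) \<partial>M) *\<^sub>R
                  (rdot \<theta> x - (\<integral>\<omega>. rdot \<theta> (lag_vec X 0 \<omega>) \<partial>M))"
    and "cq \<equiv> (\<integral>\<omega>. eps 1 \<omega> * q (eps 1 \<omega> + r \<theta> x) \<partial>M) / \<sigma>\<^sup>2"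
    and "Dq_bar \<equiv> Dq + cq *\<^sub>R (\<integral>\<omega>. rdot \<theta> (lag_vec X 0 \<omega>) \<partial>M)"
  assumes param: "open \<Theta>" "\<theta> \<in> \<Theta>"
    and r_measurable: "\<And>\<tau>. \<tau> \<in> \<Theta> \<Longrightarrow> r \<tau> \<in> borel_measurable borel"
    and model: "ar_model M X eps (r \<theta>) f \<sigma>"
    and estimator: "is_estimator M CARD('p) X \<Theta> est"
    and root_n_consistent: "bigO_prob M (\<lambda>n \<omega>. est n \<omega> - \<theta>) (\<lambda>n. real n powr (- 1 / 2))"
    and multiplier: "\<And>n \<omega>. \<omega> \<in> space M \<Longrightarrow> is_multiplier n (residual r X est n \<omega>) (lam n \<omega>)"
    and q_measurable: "q \<in> borel_measurable borel"
    and gamma_nonneg: "\<gamma> \<ge> 0"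
    and a: "C2_kernel k"
    and b: "\<And>n. b n > 0"
      "(\<lambda>n. real n * b n ^ 4) \<longlonglongrightarrow> 0"
      "filterlim (\<lambda>n. real n * b n powr ((50 + 20 * real CARD('d)) / (14 + 5 * real CARD('d))))
         at_top sequentially"
    and c: "\<And>\<tau> z. \<tau> \<in> \<Theta> \<Longrightarrow> GDERIV (\<lambda>t. r t z) \<tau> :> rdot \<tau> z"
      "\<And>z. continuous_on \<Theta> (\<lambda>\<tau>. rdot \<tau> z)"
      "\<And>C. C > 0 \<Longrightarrow> bigO_prob M
         (\<lambda>n \<omega>. SUP \<tau>\<in>\<Theta> \<inter> {\<tau>. norm (\<tau> - \<theta>) \<le> C * real n powr (- 1 / 2)}.
            (\<Sum>i=1..int n. (r \<tau> (lag_vec X (i - 1) \<omega>) - r \<theta> (lag_vec X (i - 1) \<omega>)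
                           - rdot \<theta> (lag_vec X (i - 1) \<omega>) \<bullet> (\<tau> - \<theta>))\<^sup>2))
         (\<lambda>n. real n powr (- 2 / 3))"
      "integrable M (\<lambda>\<omega>. norm (rdot \<theta> (lag_vec X 0 \<omega>)) powr (5 / 2))"
      "positive_definite (\<integral>\<omega>. outer_prod (rdot \<theta> (lag_vec X 0 \<omega>)) \<partial>M)"
    and d: "\<And>y. \<bar>q y\<bar> \<le> (1 + \<bar>y\<bar>) powr \<gamma>"
      "\<exists>L U. open U \<and> r \<theta> x \<in> U \<and>
         (\<forall>y. \<forall>s1\<in>U. \<forall>s2\<in>U. \<bar>q (y + s1) - q (y + s2)\<bar> \<le> L * \<bar>s1 - s2\<bar> * (1 + \<bar>y\<bar>) powr \<gamma>)"
    and e: "finite_fisher_information f f'"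
      "\<exists>\<beta>>2 * \<gamma> + 1. integrable lborel (\<lambda>y. \<bar>y\<bar> powr \<beta> * f y)"
  shows "smallo_prob M
           (\<lambda>n \<omega>. (\<integral>y. q (y + r (est n \<omega>) x)
                        * density_est k (b n) n (residual r X est n \<omega>) y \<partial>lborel)
              - ((1 / real n) * (\<Sum>i=1..int n. q (eps i \<omega> + r \<theta> x)) + Dq \<bullet> (est n \<omega> - \<theta>)))
           (\<lambda>n. real n powr (- 1 / 2)) \<and>
         smallo_prob M
           (\<lambda>n \<omega>. (\<integral>y. q (y + r (est n \<omega>) x)
                        * weighted_density_est k (b n) n (residual r X est n \<omega>) (lam n \<omega>) y \<partial>lborel)
              - ((1 / real n) * (\<Sum>i=1..int n. q (eps i \<omega> + r \<theta> x) - cq * eps i \<omega>)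
                 + Dq_bar \<bullet> (est n \<omega> - \<theta>)))
           (\<lambda>n. real n powr (- 1 / 2))"
proof -
  let ?p = "CARD('p)"
  define V where "V z = rdot \<theta> x - rdot \<theta> z" for z
  define g where "g y = q (y + r \<theta> x)" for y
  define w where "w y = (1 + \<bar>y\<bar>) powr \<gamma>" for y :: real
  define C where "C = (1 + \<bar>r \<theta> x\<bar>) powr \<gamma>"
  obtain L0 U where U: "open U" "r \<theta> x \<in> U"
    "\<And>y s1 s2. s1 \<in> U \<Longrightarrow> s2 \<in> U \<Longrightarrow> \<bar>q (y + s1) - q (y + s2)\<bar> \<le> L0 * \<bar>s1 - s2\<bar> * (1 + \<bar>y\<bar>) powr \<gamma>"
    using d(2) by blast
  obtain \<delta> where \<delta>: "\<delta> > 0" "cball (r \<theta> x) \<delta> \<subseteq> U"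
    using U(1,2) open_contains_cball by blast
  define L where "L = max L0 0"
  obtain \<beta> where \<beta>: "\<beta> > 2 * \<gamma> + 1" "integrable lborel (\<lambda>y. \<bar>y\<bar> powr \<beta> * f y)"
    using e(2) by blast
  have w_ge_1: "w y \<ge> 1" for y
    unfolding w_def using gamma_nonneg by (intro ge_one_powr_ge_zero) auto

  interpret A: ar_process M X eps "r \<theta>" f \<sigma> ?p
    by unfold_locales (use model r_measurable param in auto)

  have [measurable]: "rdot \<theta> \<in> borel_measurable borel"
    by (rule gradient_measurable[OF param r_measurable c(1)[OF param(2)]])
  have [measurable]: "q \<in> borel_measurable borel" by (rule q_measurable)
  have gradient_square: "integrable M (\<lambda>\<omega>. (norm (rdot \<theta> (lag_vec X 0 \<omega>)))\<^sup>2)"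
  proof (rule Bochner_Integration.integrable_bound)
    show "integrable M (\<lambda>\<omega>. 1 + norm (rdot \<theta> (lag_vec X 0 \<omega>)) powr (5 / 2))"
      using c(4) by simp
    have "t\<^sup>2 \<le> 1 + t powr (5 / 2)" if "t \<ge> 0" for t :: real
    proof (cases "t \<le> 1")
      case True
      then have "t\<^sup>2 \<le> 1" using that by (simp add: power_le_one)
      then show ?thesis by (simp add: add_increasing2)
    next
      case False
      then have "t\<^sup>2 = t powr 2" by simp
      also have "\<dots> \<le> t powr (5 / 2)" using False by (intro powr_mono) auto
      finally show ?thesis by simp
    qed
    then show "AE \<omega> in M. norm ((norm (rdot \<theta> (lag_vec X 0 \<omega>)))\<^sup>2)
        \<le> norm (1 + norm (rdot \<theta> (lag_vec X 0 \<omega>)) powr (5 / 2))"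
      by (intro AE_I2) simp
  qed measurable
  have V_measurable: "V \<in> borel_measurable borel"
    unfolding V_def[abs_def] by measurable
  have V_square: "integrable M (\<lambda>\<omega>. (norm (V (lag_vec X 0 \<omega>)))\<^sup>2)"
  proof (rule Bochner_Integration.integrable_bound)
    show "integrable M (\<lambda>\<omega>. 2 * (norm (rdot \<theta> x))\<^sup>2 + 2 * (norm (rdot \<theta> (lag_vec X 0 \<omega>)))\<^sup>2)"
      using gradient_square by simp
    show "AE \<omega> in M. norm ((norm (V (lag_vec X 0 \<omega>)))\<^sup>2)
        \<le> norm (2 * (norm (rdot \<theta> x))\<^sup>2 + 2 * (norm (rdot \<theta> (lag_vec X 0 \<omega>)))\<^sup>2)"
    proof (rule AE_I2)
      fix \<omega>
      have "(norm (V (lag_vec X 0 \<omega>)))\<^sup>2 \<le> (norm (rdot \<theta> x) + norm (rdot \<theta> (lag_vec X 0 \<omega>)))\<^sup>2"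
        unfolding V_def by (intro power_mono norm_triangle_ineq4) auto
      also have "\<dots> \<le> 2 * (norm (rdot \<theta> x))\<^sup>2 + 2 * (norm (rdot \<theta> (lag_vec X 0 \<omega>)))\<^sup>2"
        by (rule sum_squares_le)
      finally show "norm ((norm (V (lag_vec X 0 \<omega>)))\<^sup>2)
        \<le> norm (2 * (norm (rdot \<theta> x))\<^sup>2 + 2 * (norm (rdot \<theta> (lag_vec X 0 \<omega>)))\<^sup>2)" by simp
    qed
  qed (use V_measurable in measurable)

  have est_bigO: "bigO_prob M (\<lambda>n \<omega>. sqrt (real n) *\<^sub>R (est n \<omega> - \<theta>)) (\<lambda>_. 1)"
    by (rule sqrt_n_scaled_bigO[OF root_n_consistent])
  have est_mem: "est n \<omega> \<in> \<Theta>" if "\<omega> \<in> space M" for n \<omega>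
    using estimator that unfolding is_estimator_def by blast

  \<comment> \<open>Displacements of the regression function at the point \<open>x\<close> and at the lag vectors.\<close>
  define s where "s n \<omega> = r (est n \<omega>) x - r \<theta> x" for n \<omega>
  define dd where "dd n \<omega> i = r (est n \<omega>) (lag_vec X (i - 1) \<omega>) - r \<theta> (lag_vec X (i - 1) \<omega>)" for n \<omega> and i :: int

  have s_expansion: "((\<lambda>q. sqrt (real (fst q)) * (s (fst q) (snd q) - rdot \<theta> x \<bullet> (est (fst q) (snd q) - \<theta>)))
      \<longlongrightarrow> 0) (in_prob M)"
    unfolding s_def by (rule differentiable_at_estimate[OF est_bigO c(1)[OF param(2)]])

  have r_continuous: "continuous_on \<Theta> (\<lambda>\<tau>. r \<tau> z)" for z
    using c(1)[of _ z] unfolding gderiv_def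
    by (intro continuous_at_imp_continuous_on ballI) (blast intro: has_derivative_continuous)
  have "((\<lambda>q. (\<lambda>n \<tau> \<omega>. \<Sum>i=1..int n. (r \<tau> (lag_vec X (i - 1) \<omega>) - r \<theta> (lag_vec X (i - 1) \<omega>)
      - rdot \<theta> (lag_vec X (i - 1) \<omega>) \<bullet> (\<tau> - \<theta>))\<^sup>2) (fst q) (est (fst q) (snd q)) (snd q)) \<longlongrightarrow> 0) (in_prob M)"
    by (rule uniform_remainder_at_estimate[OF param est_bigO est_mem _ _ c(3)])
       (auto intro!: continuous_intros r_continuous sum_nonneg)
  then have d_expansion: "((\<lambda>q. \<Sum>i=1..int (fst q). (dd (fst q) (snd q) i
      - (rdot \<theta> x - V (lag_vec X (i - 1) (snd q))) \<bullet> (est (fst q) (snd q) - \<theta>))\<^sup>2) \<longlongrightarrow> 0) (in_prob M)"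
    by (simp add: dd_def V_def)

  have res_eq: "AE \<omega> in M. \<forall>n. \<forall>i\<ge>1. residual r X est n \<omega> i = eps i \<omega> - dd n \<omega> i"
  proof -
    have "AE \<omega> in M. \<forall>i. i \<ge> 1 \<longrightarrow> X i \<omega> = r \<theta> (lag_vec X (i - 1) \<omega>) + eps i \<omega>"
      unfolding AE_all_countable using A.recursion by (auto intro: AE_impI)
    then show ?thesis
      by eventually_elim (auto simp: residual_def dd_def)
  qed

  interpret E: residual_expansion M X eps "r \<theta>" f \<sigma> ?p f' w g k C L \<delta> V b
    "rdot \<theta> x" "\<lambda>n \<omega>. est n \<omega> - \<theta>" s dd "residual r X est" lam
  proof unfold_locales
    show "w \<in> borel_measurable borel" "g \<in> borel_measurable borel"
      unfolding w_def[abs_def] g_def[abs_def] by measurable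
    show "integrable lborel (\<lambda>y. (w y)\<^sup>2 * f y)"
      unfolding w_def
      by (rule polynomial_weight_square_integrable[OF A.density_integrable(1) A.density_pos gamma_nonneg \<beta>])
    show "\<bar>g y\<bar> \<le> C * w y" for y
    proof -
      have "\<bar>g y\<bar> \<le> (1 + \<bar>y + r \<theta> x\<bar>) powr \<gamma>" unfolding g_def by (rule d(1))
      also have "\<dots> \<le> ((1 + \<bar>r \<theta> x\<bar>) * (1 + \<bar>y\<bar>)) powr \<gamma>"
      proof (intro powr_mono2 gamma_nonneg)
        have "\<bar>y + r \<theta> x\<bar> \<le> \<bar>y\<bar> + \<bar>r \<theta> x\<bar>" by (rule abs_triangle_ineq)
        moreover have "0 \<le> \<bar>r \<theta> x\<bar> * \<bar>y\<bar>" by simp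
        moreover have "(1 + \<bar>r \<theta> x\<bar>) * (1 + \<bar>y\<bar>) = 1 + \<bar>y\<bar> + \<bar>r \<theta> x\<bar> + \<bar>r \<theta> x\<bar> * \<bar>y\<bar>"
          by (simp add: algebra_simps)
        ultimately show "1 + \<bar>y + r \<theta> x\<bar> \<le> (1 + \<bar>r \<theta> x\<bar>) * (1 + \<bar>y\<bar>)"
          by linarith
      qed auto
      finally show ?thesis unfolding C_def w_def by (simp add: powr_mult)
    qed
    show "\<bar>g (y + h) - g (y + h')\<bar> \<le> L * \<bar>h - h'\<bar> * w y" if "\<bar>h\<bar> \<le> \<delta>" "\<bar>h'\<bar> \<le> \<delta>" for y h h'
    proof -
      have "r \<theta> x + h \<in> U" "r \<theta> x + h' \<in> U"
        using that \<delta>(2) by (auto simp: subset_eq dist_real_def)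
      from U(3)[OF this, of y] have "\<bar>g (y + h) - g (y + h')\<bar> \<le> L0 * \<bar>h - h'\<bar> * w y"
        by (simp add: g_def w_def add_ac)
      also have "\<dots> \<le> L * \<bar>h - h'\<bar> * w y"
        using w_ge_1[of y] by (intro mult_right_mono) (auto simp: L_def)
      finally show ?thesis .
    qed
    show "k u \<ge> 0" "k (- u) = k u" for u
      using a by (auto simp: C2_kernel_def)
    show "integrable lborel k" "(\<integral>u. k u \<partial>lborel) = 1"
      using a by (auto simp: C2_kernel_def)
    show "bigO_prob M (\<lambda>n \<omega>. sqrt (real n) *\<^sub>R (est n \<omega> - \<theta>)) (\<lambda>_. 1)"
      by (rule est_bigO)
  qed (use A.density_pos A.density_measurable e(1) w_ge_1 \<delta>(1) C2_kernel_properties[OF a] V_measurable V_square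
      b(1,2) s_expansion d_expansion res_eq multiplier in \<open>auto simp: L_def\<close>)

  have slope: "E.shift_slope 0 = (\<integral>\<omega>. q (eps 1 \<omega> + r \<theta> x) * score f f' (eps 1 \<omega>) \<partial>M)"
  proof -
    have "(\<lambda>y. g y * score f f' y) \<in> borel_measurable borel"
      unfolding score_def by measurable
    from A.innovation_integral(2)[OF _ this, of 1]
    have "(\<integral>\<omega>. q (eps 1 \<omega> + r \<theta> x) * score f f' (eps 1 \<omega>) \<partial>M) = (\<integral>y. g y * score f f' y * f y \<partial>lborel)"
      by (simp add: g_def)
    also have "\<dots> = (\<integral>y. - (g y * f' y) \<partial>lborel)"
      using A.density_pos by (intro Bochner_Integration.integral_cong) (auto simp: score_def less_imp_neq[symmetric])
    finally show ?thesis by (simp add: E.shift_slope_def)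
  qed
  have gradient_integrable: "integrable M (\<lambda>\<omega>. rdot \<theta> (lag_vec X 0 \<omega>))"
  proof -
    have "integrable M (\<lambda>\<omega>. rdot \<theta> x - V (lag_vec X 0 \<omega>))"
      using E.V_integrable by simp
    then show ?thesis by (simp add: V_def)
  qed
  have V_mean: "E.V_mean = rdot \<theta> x - (\<integral>\<omega>. rdot \<theta> (lag_vec X 0 \<omega>) \<partial>M)"
    unfolding E.V_mean_def V_def using gradient_integrable by (simp add: A.prob_space)
  have cq: "E.innovation_g_mean / \<sigma>\<^sup>2 = cq"
    unfolding E.innovation_g_mean_def cq_def g_def ..
  have Dq: "E.shift_slope 0 *\<^sub>R E.V_mean = Dq"
    by (simp add: slope V_mean Dq_def)
  have Dq_bar: "E.shift_slope 0 *\<^sub>R E.V_mean + (E.innovation_g_mean / \<sigma>\<^sup>2) *\<^sub>R (rdot \<theta> x - E.V_mean) = Dq_bar"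
    unfolding Dq cq Dq_bar_def unfolding V_mean by simp

  have rate: "n > 0 \<Longrightarrow> sqrt (real n) > 0 \<and> real n powr (- 1 / 2) = 1 / sqrt (real n)" for n
    by (simp add: powr_minus_divide powr_half_sqrt)
  have small_b: "eventually (\<lambda>p. b (fst p) < \<delta>) (in_prob M)"
    by (rule eventually_in_prob_fst, rule order_tendstoD(2)[OF E.b_tendsto_zero \<delta>(1)])
  have shifted: "q (y + r (est n \<omega>) x) = g (y + s n \<omega>)" for y n \<omega>
    by (simp add: g_def s_def)
  \<comment> \<open>Once the bandwidth is below \<open>\<delta>\<close> the kernel integrals converge and equal the smoothed values.\<close>
  have unweighted: "(\<integral>y. q (y + r (est n \<omega>) x) * density_est k (b n) n (residual r X est n \<omega>) y \<partial>lborel)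
      = sample_mean n (E.fitted n \<omega>)" if "b n < \<delta>" for n \<omega>
    unfolding shifted density_est_def E.fitted_def[abs_def]
    using E.integral_against_weighted_kernels[of "b n" "s n \<omega>" n "\<lambda>_. 1" "residual r X est n \<omega>"] b(1)[of n] that
    by simp
  have weighted: "(\<integral>y. q (y + r (est n \<omega>) x)
        * weighted_density_est k (b n) n (residual r X est n \<omega>) (lam n \<omega>) y \<partial>lborel)
      = sample_mean n (\<lambda>i. 1 / (1 + lam n \<omega> * residual r X est n \<omega> i) * E.fitted n \<omega> i)" if "b n < \<delta>" for n \<omega>
    unfolding shifted weighted_density_est_def E.fitted_def
    using b(1)[of n] that by (intro E.integral_against_weighted_kernels) auto
  show ?thesis
  proof (intro conjI; rule smallo_prob_if_tendsto[where s = "\<lambda>n. sqrt (real n)"])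
    show "((\<lambda>p. ((\<integral>y. q (y + r (est (fst p) (snd p)) x)
          * density_est k (b (fst p)) (fst p) (residual r X est (fst p) (snd p)) y \<partial>lborel)
        - ((1 / real (fst p)) * (\<Sum>i=1..int (fst p). q (eps i (snd p) + r \<theta> x)) + Dq \<bullet> (est (fst p) (snd p) - \<theta>)))
        * sqrt (real (fst p))) \<longlongrightarrow> 0) (in_prob M)"
    proof (rule Lim_transform_eventually[OF E.unweighted_expansion], use small_b in eventually_elim)
      case (elim p)
      show ?case
        unfolding unweighted[OF elim] Dq unfolding sample_mean_def g_def by (simp add: mult.commute)
    qed
    show "((\<lambda>p. ((\<integral>y. q (y + r (est (fst p) (snd p)) x)
          * weighted_density_est k (b (fst p)) (fst p) (residual r X est (fst p) (snd p)) (lam (fst p) (snd p)) y \<partial>lborel)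
        - ((1 / real (fst p)) * (\<Sum>i=1..int (fst p). q (eps i (snd p) + r \<theta> x) - cq * eps i (snd p))
            + Dq_bar \<bullet> (est (fst p) (snd p) - \<theta>)))
        * sqrt (real (fst p))) \<longlongrightarrow> 0) (in_prob M)"
    proof (rule Lim_transform_eventually[OF E.weighted_expansion], use small_b in eventually_elim)
      case (elim p)
      show ?case
        unfolding weighted[OF elim] Dq_bar unfolding cq sample_mean_def g_def by (simp add: mult.commute)
    qed
  qed (use rate in auto)
qed

end
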